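(* There are absolute constants such that the following holds. Let $n\ge d\ge 1$, let $U\in\mathbb{R}^{n\times d}$ have orthonormal columns, let $\varepsilon\in(0,1)$ and $\delta\in(0,1)$. Let $\Pi\in\mathbb{R}^{m\times n}$ be an OSNAP with sparsity $s=\Theta(\log^3(d/\delta)/\varepsilon)$ and with $m=\Omega(d\log^8(d/\delta)/\varepsilon^2)$, where the random signs $\sigma$ and the hash function(s) $h$ used to sample $\Pi$ are $\Omega(\log(d/\delta))$-wise independent. Then with probability at least $1-\delta$, all singular values of $\Pi U$ lie in $[1-\varepsilon,1+\varepsilon]$.
   Context: An OSNAP (oblivious sparse norm-approximating projection) with sparsity $s$ is a random matrix $\Pi\in\mathbb{R}^{m\times n}$ with entries $\Pi_{i,j}=\delta_{i,j}\sigma_{i,j}/\sqrt{s}$, where $\delta_{i,j}\in\{0,1\}$ are random indicator variables and $\sigma_{i,j}\in\{-1,1\}$ are random signs, such that (1) for every column $j\in[n]$, $\sum_{i=1}^m\delta_{i,j}=s$ with probability $1$, and (2) for every $S\subseteq[m]\times[n]$, $\mathbb{E}\prod_{(i,j)\in S}\delta_{i,j}\le (s/m)^{|S|}$. Examples: each column independently has exactly $s$ non-zero entries in random positions with random signs; or, with $s\mid m$, hash functions $h:[n]\times[s]\to[m/s]$ and $\sigma:[n]\times[s]\to\{-1,1\}$ and $\Pi_{(j-1)(m/s)+h(i,j),\,i}=\sigma(i,j)/\sqrt{s}$ for $(i,j)\in[n]\times[s]$, all other entries $0$. Here $h$ denotes the hash function(s) determining the positions of the non-zero entries. A hash family is $k$-wise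 independent if the values at any $k$ distinct inputs are independent and uniform. The $\Theta,\Omega$ mean with sufficiently large absolute constants.
   Formalization: log(d/δ) is read as max(1, ln(d/δ)), since with plain log the claim fails for d = 1 and δ near 1 (for d/δ ≥ 2 only constants change); the signs are taken uniform and independent of the positions, as is implicit. *)

theory Defs
  imports "HOL-Probability.Probability" "Jordan_Normal_Form.Char_Poly"
begin

text \<open>
  Rows and columns are numbered from 0, so an entry is a pair \<open>(i, j)\<close> with \<open>i < m\<close>, \<open>j < n\<close>.
  All random objects take finitely many values, hence their laws are given as PMFs on fixed
  types; there is no sample-space type on which the absolute constants could depend.
\<close>

definition entries :: "nat \<Rightarrow> nat \<Rightarrow> (nat \<times> nat) set" where
  "entries m n = {..<m} \<times> {..<n}"

text \<open>Since the indicators are Boolean, \<open>of_bool (\<delta> i j)\<close> is the number \<open>\<delta>\<^sub>i\<^sub>j \<in> {0, 1}\<close>.\<close>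

definition osnap_indicators :: "nat \<Rightarrow> nat \<Rightarrow> nat \<Rightarrow> (nat \<Rightarrow> nat \<Rightarrow> bool) pmf \<Rightarrow> bool" where
  "osnap_indicators m n s D \<longleftrightarrow>
     (\<forall>j<n. AE \<delta> in measure_pmf D. (\<Sum>i<m. of_bool (\<delta> i j)) = s) \<and>
     (\<forall>S \<subseteq> entries m n.
        measure_pmf.expectation D (\<lambda>\<delta>. \<Prod>(i, j)\<in>S. of_bool (\<delta> i j)) \<le> (real s / real m) ^ card S)"

definition sketch_matrix ::
    "nat \<Rightarrow> nat \<Rightarrow> nat \<Rightarrow> (nat \<Rightarrow> nat \<Rightarrow> bool) \<Rightarrow> (nat \<Rightarrow> nat \<Rightarrow> real) \<Rightarrow> real mat" where
  "sketch_matrix m n s \<delta> \<sigma> =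
     Matrix.mat m n (\<lambda>(i, j). of_bool (\<delta> i j) * \<sigma> i j / sqrt (real s))"

text \<open>
  The clause \<open>card A \<le> k\<close> rather than \<open>card A = k\<close> gives full independence when there are fewer
  than \<open>k\<close> inputs.
\<close>

definition kwise_independent :: "nat \<Rightarrow> 'i set \<Rightarrow> 'v set \<Rightarrow> ('i \<Rightarrow> 'v) pmf \<Rightarrow> bool" where
  "kwise_independent k I V H \<longleftrightarrow>
     (\<forall>a\<in>I. map_pmf (\<lambda>h. h a) H = pmf_of_set V) \<and>
     (\<forall>A\<subseteq>I. finite A \<and> card A \<le> k \<longrightarrow>
        prob_space.indep_vars (measure_pmf H) (\<lambda>_. count_space UNIV) (\<lambda>a h. h a) A)"

text \<open>
  Reading indicators off a hash function \<open>h\<close>: whether entry \<open>(i, j)\<close> is non-zero depends on the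
  single hash value at the input \<open>loc i j\<close>, through the deterministic test \<open>hit i j\<close>. With
  \<open>s dvd m\<close> and \<open>q = m div s\<close>, the block construction is \<open>loc i j = (j, i div q)\<close>,
  \<open>hit i j v \<longleftrightarrow> v = i mod q\<close>, with hash values in \<open>{..<q}\<close>. Independent uniformly random
  \<open>s\<close>-element supports are \<open>loc i j = (j, 0)\<close>, \<open>hit i j v \<longleftrightarrow> i \<in> set_decode v\<close>, with hash values
  the codes of the \<open>s\<close>-element subsets of \<open>{..<m}\<close>.
\<close>

definition hash_indicators ::
    "(nat \<Rightarrow> nat \<Rightarrow> nat \<times> nat) \<Rightarrow> (nat \<Rightarrow> nat \<Rightarrow> nat \<Rightarrow> bool) \<Rightarrow> (nat \<times> nat \<Rightarrow> nat) \<Rightarrow>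
     nat \<Rightarrow> nat \<Rightarrow> bool" where
  "hash_indicators loc hit h = (\<lambda>i j. hit i j (h (loc i j)))"

text \<open>
  The predicate \<open>osnap_sketch k m n s P\<close> says that \<open>P\<close> is the law of an OSNAP sampled with
  \<open>k\<close>-wise independent randomness. The signs are independent of the positions.

  \<^item> \<open>general\<close>: arbitrary indicators satisfying both OSNAP conditions, with \<open>k\<close>-wise independent
    signs.

  \<^item> \<open>hashed\<close>: the positions come from a hash function. A \<open>k\<close>-wise independent \<open>h\<close> can violate
    the moment condition for sets with more than \<open>k\<close> elements, so the OSNAP conditions are those of
    the construction with a fully independent uniform \<open>h\<close> (the \<open>Pi_pmf\<close>), while the \<open>h\<close> actually
    used is only \<open>k\<close>-wise independent. The map \<open>sloc\<close> gives the input of the sign function used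
    for an entry; non-zero entries never share a sign. It is \<open>\<lambda>i j. (i, j)\<close> for one sign
    per entry, and \<open>\<lambda>i j. (j, i div q)\<close> in the block construction.
\<close>

inductive osnap_sketch :: "nat \<Rightarrow> nat \<Rightarrow> nat \<Rightarrow> nat \<Rightarrow> real mat pmf \<Rightarrow> bool"
  for k m n s :: nat where
  general:
    "osnap_sketch k m n s
       (map_pmf (\<lambda>(\<delta>, \<sigma>). sketch_matrix m n s \<delta> (\<lambda>i j. \<sigma> (i, j))) (pair_pmf D Sg))"
    if "osnap_indicators m n s D"
      and "kwise_independent k (entries m n) {-1, 1} Sg"
| hashed:
    "osnap_sketch k m n s
       (map_pmf (\<lambda>(h, \<sigma>). sketch_matrix m n s (hash_indicators loc hit h) (\<lambda>i j. \<sigma> (sloc i j)))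
          (pair_pmf H Sg))"
    if "finite V" and "V \<noteq> {}"
      and "I = case_prod loc ` entries m n"
      and "osnap_indicators m n s
             (map_pmf (hash_indicators loc hit) (Pi_pmf I 0 (\<lambda>_. pmf_of_set V)))"
      and "\<And>h. h \<in> I \<rightarrow> V \<Longrightarrow>
             inj_on (case_prod sloc) {(i, j) \<in> entries m n. hash_indicators loc hit h i j}"
      and "kwise_independent k I V H"
      and "kwise_independent k (case_prod sloc ` entries m n) {-1, 1}
             (Sg :: (nat \<times> nat \<Rightarrow> real) pmf)"

text \<open>
  The singular values of \<open>A\<close>, one for each column counted with multiplicity. For more columns than
  rows this includes the value 0 from the kernel.
\<close>

definition singular_values :: "real mat \<Rightarrow> real set" where
  "singular_values A = {sqrt \<mu> | \<mu>. eigenvalue (transpose_mat A * A) \<mu>}"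

text \<open>
  Logarithms are bounded below by 1, as usual in asymptotic bounds. This matters only for \<open>d = 1\<close>
  and \<open>\<delta>\<close> near 1: there \<open>ln (d / \<delta>)\<close> tends to 0, and a literal bound on the order of independence
  would require no more than 1-wise independence. For \<open>d / \<delta> \<ge> 2\<close> it agrees with
  \<open>ln (d / \<delta>)\<close> up to a constant factor.
\<close>

definition log_factor :: "real \<Rightarrow> real" where
  "log_factor x = max 1 (ln x)"

end

theory Submission
  imports Defs
begin

text \<open>
  Condition on the positions of the nonzero entries, and let \<open>u\<^sub>i\<close> be the rows of \<open>U\<close>. Since every
  column has exactly \<open>s\<close> nonzero entries, \<open>Z = (\<Pi> U)\<^sup>T \<Pi> U - 1\<close> is a quadratic chaos in the signs without
  diagonal terms. Flipping one sign and comparing the traces of powers gives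
  \<open>E tr Z\<^sup>2\<^sup>q \<le> (2q - 1)/8 \<Sum>\<^sub>a E tr ((Z - Z\<^sub>a)\<^sup>2 Z\<^sup>2\<^sup>q\<^sup>-\<^sup>2)\<close>, where \<open>Z\<^sub>a\<close> is \<open>Z\<close> with the sign \<open>a\<close> flipped, and
  the arithmetic-geometric mean inequality absorbs the power of \<open>Z\<close> into the left-hand side. What
  remains is linear in the signs, and the same argument applied to a Hermitian dilation bounds it.
  No decoupling is needed. With \<open>b\<^sub>i = \<bar>u\<^sub>i\<bar>\<^sup>2\<close> the outcome is
  \<open>E tr Z\<^sup>2\<^sup>q \<le> (4 (2q - 1)\<^sup>2 / s\<^sup>2)\<^sup>q (\<Sum>\<^sub>i b\<^sub>i w\<^sub>i\<^sup>q + \<Sum>\<^sub>r Q\<^sub>r\<^sup>q)\<close>. Here \<open>w\<^sub>i\<close> is the total weight colliding with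
  column \<open>i\<close>, and \<open>Q\<^sub>r\<close> sums \<open>b\<^sub>i b\<^sub>j\<close> over the ordered pairs of distinct columns meeting in row \<open>r\<close>.

  The bound is a polynomial with nonnegative coefficients in the indicators, so by the moment
  condition its expectation grows when the positions become independent Bernoulli variables with
  mean \<open>s/m\<close>. There exponential moments bound it by a constant multiple of \<open>d (2q)\<^sup>2\<^sup>q\<close>. Taking \<open>q\<close> near
  \<open>log (d/\<delta>)\<close> and applying Markov's inequality finishes the proof. Only moments of order \<open>O(q)\<close> occur,
  hence limited independence suffices.
\<close>

subsection \<open>Inner products and matrices on a finite index set\<close>

text \<open>The OSNAP condition bounds mixed moments of the indicators from above only, so it
  applies only to polynomials with nonnegative coefficients. After averaging over the signs, the
  trace of a power of Z has products of entries of U as coefficients, and their signs are not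
  controlled. This is why the chaos is bounded for fixed positions, by an expression in the squared
  row norms \<open>b i\<close> alone, before the positions are compared. The exact column sparsity
  is spent before the comparison too, since Bernoulli columns lack it: it turns the diagonal part of
  the Gram matrix into the identity. Throughout q = r + 1. The trace has degree 4 (r + 1) in the
  signs and the collision polynomial degree 2 (r + 1) in the indicators, which fixes the order of
  independence. With p = s/m, a collision in a given row costs p^2, so the m rows together are paid
  for once m p^2 d \<le> 1, that is s^2 d \<le> m; the lower bound on m secures this. Divided by
  \<epsilon>^(2q), the moment bound is d times a geometric factor whose ratio is small once s
  \<epsilon> is large against q^2.\<close>

definition inner_on :: "'i set \<Rightarrow> ('i \<Rightarrow> real) \<Rightarrow> ('i \<Rightarrow> real) \<Rightarrow> real" where
  "inner_on I x y = (\<Sum>i\<in>I. x i * y i)"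

text \<open>Vectors and matrices are plain functions, meaningful only on an index set passed as a
  parameter. One spectral theory then serves the coordinates \<open>{..<d}\<close>, the set of
  nonzero entries and the disjoint sums on which dilations act.\<close>

definition apply_on :: "'i set \<Rightarrow> ('i \<Rightarrow> 'i \<Rightarrow> real) \<Rightarrow> ('i \<Rightarrow> real) \<Rightarrow> 'i \<Rightarrow> real" where
  "apply_on I A x = (\<lambda>i. \<Sum>j\<in>I. A i j * x j)"

definition symm_on :: "'i set \<Rightarrow> ('i \<Rightarrow> 'i \<Rightarrow> real) \<Rightarrow> bool" where
  "symm_on I A \<longleftrightarrow> (\<forall>i\<in>I. \<forall>j\<in>I. A i j = A j i)"

lemma inner_on_commute: "inner_on I x y = inner_on I y x"
  by (simp add: inner_on_def mult.commute)

lemma inner_on_add_left: "inner_on I (\<lambda>i. x i + y i) z = inner_on I x z + inner_on I y z"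
  and inner_on_add_right: "inner_on I z (\<lambda>i. x i + y i) = inner_on I z x + inner_on I z y"
  and inner_on_diff_left: "inner_on I (\<lambda>i. x i - y i) z = inner_on I x z - inner_on I y z"
  and inner_on_diff_right: "inner_on I z (\<lambda>i. x i - y i) = inner_on I z x - inner_on I z y"
  and inner_on_scale_left: "inner_on I (\<lambda>i. c * x i) z = c * inner_on I x z"
  and inner_on_scale_right: "inner_on I z (\<lambda>i. c * x i) = c * inner_on I z x"
  and inner_on_divide_left: "inner_on I (\<lambda>i. x i / c) z = inner_on I x z / c"
  by (simp_all add: inner_on_def algebra_simps sum.distrib sum_subtractf sum_distrib_left sum_divide_distrib)

lemma inner_on_sum_left: "inner_on I (\<lambda>i. \<Sum>b\<in>B. f b i) z = (\<Sum>b\<in>B. inner_on I (f b) z)"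
  unfolding inner_on_def sum_distrib_right by (rule sum.swap)

lemma inner_on_sum_right: "inner_on I z (\<lambda>i. \<Sum>b\<in>B. f b i) = (\<Sum>b\<in>B. inner_on I z (f b))"
  by (subst (1 2) inner_on_commute) (rule inner_on_sum_left)

lemma inner_on_self_nonneg [simp]: "0 \<le> inner_on I x x"
  by (simp add: inner_on_def sum_nonneg)

lemma inner_on_cong: "(\<And>i. i \<in> I \<Longrightarrow> x i = x' i) \<Longrightarrow> (\<And>i. i \<in> I \<Longrightarrow> y i = y' i) \<Longrightarrow> inner_on I x y = inner_on I x' y'"
  by (simp add: inner_on_def)

lemma inner_on_self_eq_0_iff: "finite I \<Longrightarrow> inner_on I x x = 0 \<longleftrightarrow> (\<forall>i\<in>I. x i = 0)"
  unfolding inner_on_def by (subst sum_nonneg_eq_0_iff) auto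

lemma inner_on_Cauchy_Schwarz: "(inner_on I x y)\<^sup>2 \<le> inner_on I x x * inner_on I y y"
  using Cauchy_Schwarz_ineq_sum[of x y I] by (simp add: inner_on_def power2_eq_square)

lemma symm_onD: "symm_on I A \<Longrightarrow> i \<in> I \<Longrightarrow> j \<in> I \<Longrightarrow> A i j = A j i"
  by (simp add: symm_on_def)

lemma apply_on_diff: "apply_on I (\<lambda>i j. X i j - Y i j) x = (\<lambda>i. apply_on I X x i - apply_on I Y x i)"
  by (simp add: apply_on_def left_diff_distrib sum_subtractf)

lemma inner_on_apply_symm: "symm_on I A \<Longrightarrow> inner_on I x (apply_on I A y) = inner_on I (apply_on I A x) y"
proof -
  assume A: "symm_on I A"
  have "inner_on I x (apply_on I A y) = (\<Sum>i\<in>I. \<Sum>j\<in>I. x i * A i j * y j)"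
    by (simp add: inner_on_def apply_on_def sum_distrib_left mult_ac)
  also have "\<dots> = (\<Sum>j\<in>I. \<Sum>i\<in>I. x i * A i j * y j)" by (rule sum.swap)
  also have "\<dots> = (\<Sum>j\<in>I. \<Sum>i\<in>I. A j i * x i * y j)"
    by (intro sum.cong refl) (metis A mult.commute symm_onD)
  also have "\<dots> = inner_on I (apply_on I A x) y"
    by (simp add: inner_on_def apply_on_def sum_distrib_right)
  finally show ?thesis .
qed

lemma inner_on_indicator: "finite I \<Longrightarrow> i \<in> I \<Longrightarrow> inner_on I (\<lambda>x. of_bool (x = i)) y = y i"
  unfolding inner_on_def
  by (subst sum.cong[OF refl, of _ _ "\<lambda>x. if x = i then y x else 0"]) (auto simp: sum.delta)

text \<open>The eigenvectors are indexed by \<open>I\<close> itself. Orthonormality and completeness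
  are both recorded: the first normalises single eigenvectors, the second yields Parseval's
  identity. All equations are claimed on \<open>I\<close> only, since values elsewhere are
  arbitrary.\<close>

definition eigensystem ::
    "'i set \<Rightarrow> ('i \<Rightarrow> 'i \<Rightarrow> real) \<Rightarrow> ('i \<Rightarrow> 'i \<Rightarrow> real) \<Rightarrow> ('i \<Rightarrow> real) \<Rightarrow> bool" where
  "eigensystem I A e l \<longleftrightarrow>
     (\<forall>k\<in>I. \<forall>k'\<in>I. inner_on I (e k) (e k') = of_bool (k = k')) \<and>
     (\<forall>x\<in>I. \<forall>y\<in>I. (\<Sum>k\<in>I. e k x * e k y) = of_bool (x = y)) \<and>
     (\<forall>k\<in>I. \<forall>x\<in>I. apply_on I A (e k) x = l k * e k x)"

subsection \<open>The spectral theorem\<close>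

text \<open>An orthonormal family has as many members as there are coordinates exactly when the
  squared distances of the standard basis vectors from its span add up to 0.\<close>

lemma orthonormal_residual:
  assumes "finite I" "finite B"
    and on: "\<And>k k'. k \<in> B \<Longrightarrow> k' \<in> B \<Longrightarrow> inner_on I (e k) (e k') = of_bool (k = k')"
  defines "R \<equiv> \<lambda>i x. of_bool (x = i) - (\<Sum>k\<in>B. e k i * e k x)"
  shows "(\<Sum>i\<in>I. inner_on I (R i) (R i)) = real (card I) - real (card B)"
    and "\<And>i k. i \<in> I \<Longrightarrow> k \<in> B \<Longrightarrow> inner_on I (e k) (R i) = 0"
proof -
  show orth: "inner_on I (e k) (R i) = 0" if "i \<in> I" "k \<in> B" for i k
  proof -
    have "inner_on I (e k) (R i) = e k i - (\<Sum>k'\<in>B. e k' i * inner_on I (e k) (e k'))"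
      unfolding R_def inner_on_diff_right inner_on_sum_right inner_on_scale_right
      using inner_on_indicator[OF assms(1) that(1), of "e k"] by (simp add: inner_on_commute)
    also have "(\<Sum>k'\<in>B. e k' i * inner_on I (e k) (e k')) = (\<Sum>k'\<in>B. if k' = k then e k' i else 0)"
      using on that by (intro sum.cong) auto
    also have "\<dots> = e k i" using that assms(2) by simp
    finally show ?thesis by simp
  qed
  have "inner_on I (R i) (R i) = 1 - (\<Sum>k\<in>B. e k i * e k i)" if "i \<in> I" for i
  proof -
    \<comment> \<open>\<open>R i\<close> is orthogonal to the span, so only the basis vector in the
      first factor survives and the squared distance is the diagonal entry
      \<open>R i i\<close>.\<close>
    have "inner_on I (R i) (R i) = inner_on I (\<lambda>x. of_bool (x = i)) (R i) - (\<Sum>k\<in>B. e k i * inner_on I (e k) (R i))"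
      by (subst (1) R_def) (simp add: inner_on_diff_left inner_on_sum_left inner_on_scale_left)
    also have "\<dots> = R i i" using orth that by (simp add: inner_on_indicator[OF assms(1)])
    finally show ?thesis by (simp add: R_def)
  qed
  hence "(\<Sum>i\<in>I. inner_on I (R i) (R i)) = real (card I) - (\<Sum>i\<in>I. \<Sum>k\<in>B. e k i * e k i)"
    by (simp add: sum_subtractf)
  also have "(\<Sum>i\<in>I. \<Sum>k\<in>B. e k i * e k i) = (\<Sum>k\<in>B. inner_on I (e k) (e k))"
    unfolding inner_on_def by (rule sum.swap)
  also have "\<dots> = real (card B)" using on by simp
  finally show "(\<Sum>i\<in>I. inner_on I (R i) (R i)) = real (card I) - real (card B)" .
qed

lemma continuous_on_inner_on [continuous_intros]:
  fixes x y :: "'a::topological_space \<Rightarrow> 'i \<Rightarrow> real"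
  assumes "\<And>i. continuous_on S (\<lambda>a. x a i)" "\<And>i. continuous_on S (\<lambda>a. y a i)"
  shows "continuous_on S (\<lambda>a. inner_on I (x a) (y a))"
  unfolding inner_on_def by (intro continuous_intros assms)

text \<open>The ambient space is the full function space, possibly of infinite dimension. Freezing
  the coordinates outside \<open>I\<close> at 0 makes the cube a product of compact sets, and
  Tychonoff's theorem applies.\<close>

lemma compact_unit_cube:
  fixes I :: "'i set"
  shows "compact {v :: 'i \<Rightarrow> real. \<forall>i. v i \<in> (if i \<in> I then {-1..1} else {0})}"
proof -
  have "compactin (product_topology (\<lambda>i. euclideanreal) (UNIV :: 'i set))
          (PiE UNIV (\<lambda>i. if i \<in> I then {-1..1} else {0}))"
    by (subst compactin_PiE) auto
  moreover have "PiE UNIV (\<lambda>i. if i \<in> I then {-1..1} else {0::real}) =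
      {v. \<forall>i. v i \<in> (if i \<in> I then {-1..1} else {0})}" by (simp add: PiE_def Pi_def)
  ultimately show ?thesis by (simp add: euclidean_product_topology)
qed

text \<open>The Rayleigh quotient is maximised over the unit vectors orthogonal to the eigenvectors
  already found. Symmetry of \<open>A\<close> keeps the residual \<open>A v - M v\<close> of a
  maximiser in that orthogonal complement, so optimality in its direction forces it to
  vanish.\<close>

lemma extend_eigenvectors:
  assumes I: "finite I" and B: "finite B" "card B < card I" and A: "symm_on I A"
    and on: "\<And>k k'. k \<in> B \<Longrightarrow> k' \<in> B \<Longrightarrow> inner_on I (e k) (e k') = of_bool (k = k')"
    and ev: "\<And>k x. k \<in> B \<Longrightarrow> x \<in> I \<Longrightarrow> apply_on I A (e k) x = l k * e k x"
  shows "\<exists>v M. inner_on I v v = 1 \<and> (\<forall>k\<in>B. inner_on I (e k) v = 0) \<and> (\<forall>x\<in>I. apply_on I A v x = M * v x)"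
proof -
  define C where "C = {v :: 'a \<Rightarrow> real. \<forall>i. v i \<in> (if i \<in> I then {-1..1} else {0})}"
  define K where "K = C \<inter> {v. inner_on I v v = 1} \<inter> (\<Inter>k\<in>B. {v. inner_on I (e k) v = 0})"
  have cont: "continuous_on UNIV (\<lambda>v::'a \<Rightarrow> real. v i)" for i
    by simp
  have "closed {v::'a \<Rightarrow> real. inner_on I v v = 1}"
    by (intro closed_Collect_eq continuous_intros cont)
  moreover have "closed {v::'a \<Rightarrow> real. inner_on I (e k) v = 0}" for k
    by (intro closed_Collect_eq continuous_intros cont)
  ultimately have compK: "compact K"
    unfolding K_def C_def
    by (intro compact_Int_closed compact_unit_cube closed_INT) auto
  have norm: "(\<lambda>i. if i \<in> I then w i / sqrt (inner_on I w w) else 0) \<in> K"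
    if w: "\<And>k. k \<in> B \<Longrightarrow> inner_on I (e k) w = 0" and pos: "inner_on I w w > 0" for w
  proof -
    let ?n = "sqrt (inner_on I w w)"
    have n2: "?n * ?n = inner_on I w w" by simp
    have 1: "\<bar>w i\<bar> \<le> ?n" if "i \<in> I" for i
    proof -
      have "w i * w i \<le> inner_on I w w" unfolding inner_on_def
        by (rule member_le_sum) (use I that in auto)
      thus ?thesis by (simp add: real_le_rsqrt power2_eq_square)
    qed
    have "-1 \<le> w i / ?n" "w i / ?n \<le> 1" if "i \<in> I" for i
      using 1[OF that] pos by (simp_all add: field_simps abs_le_iff)
    hence c: "(\<lambda>i. if i \<in> I then w i / ?n else 0) \<in> C"
      by (simp add: C_def)
    have "inner_on I (\<lambda>i. if i \<in> I then w i / ?n else 0) (\<lambda>i. if i \<in> I then w i / ?n else 0)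
        = inner_on I (\<lambda>i. w i / ?n) (\<lambda>i. w i / ?n)" by (rule inner_on_cong) auto
    also have "\<dots> = inner_on I w w / ?n / ?n"
      by (simp add: inner_on_divide_left inner_on_commute[of I w "\<lambda>i. w i / ?n"])
    also have "\<dots> = 1" using n2 pos by (simp add: divide_simps)
    finally have u: "inner_on I (\<lambda>i. if i \<in> I then w i / ?n else 0) (\<lambda>i. if i \<in> I then w i / ?n else 0) = 1" .
    have "inner_on I (e k) (\<lambda>i. if i \<in> I then w i / ?n else 0) = inner_on I (\<lambda>i. w i / ?n) (e k)" for k
      by (subst inner_on_commute) (rule inner_on_cong, auto)
    hence "inner_on I (e k) (\<lambda>i. if i \<in> I then w i / ?n else 0) = 0" if "k \<in> B" for k
      using w[OF that] by (simp add: inner_on_divide_left inner_on_commute)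
    thus ?thesis using c u by (simp add: K_def)
  qed
  define R where "R = (\<lambda>i x. of_bool (x = i) - (\<Sum>k\<in>B. e k i * e k x))"
  have res: "(\<Sum>i\<in>I. inner_on I (R i) (R i)) = real (card I) - real (card B)"
    "\<And>i k. i \<in> I \<Longrightarrow> k \<in> B \<Longrightarrow> inner_on I (e k) (R i) = 0"
    unfolding R_def by (rule orthonormal_residual[OF I B(1) on]; assumption)+
  \<comment> \<open>If every residual vanished, the family would have \<open>card I\<close> members.
    A nonzero residual, normalised, shows that the compact set \<open>K\<close> is nonempty.\<close>
  have "\<exists>i\<in>I. inner_on I (R i) (R i) > 0"
  proof (rule ccontr)
    assume "\<not> ?thesis"
    hence "(\<Sum>i\<in>I. inner_on I (R i) (R i)) \<le> 0" by (intro sum_nonpos) (auto simp: not_less)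
    thus False using res(1) B(2) by simp
  qed
  then obtain i where i: "i \<in> I" "inner_on I (R i) (R i) > 0" by auto
  have neK: "K \<noteq> {}" using norm[of "R i"] res(2)[OF i(1)] i(2) by auto
  have "continuous_on K (\<lambda>v. inner_on I v (apply_on I A v))"
    unfolding apply_on_def by (intro continuous_intros continuous_on_subset[OF cont]) auto
  then obtain v where v: "v \<in> K" and max: "\<And>w. w \<in> K \<Longrightarrow> inner_on I w (apply_on I A w) \<le> inner_on I v (apply_on I A v)"
    using continuous_attains_sup[OF compK neK] by blast
  define M where "M = inner_on I v (apply_on I A v)"
  have v1: "inner_on I v v = 1" and vo: "inner_on I (e k) v = 0" if "k \<in> B" for k
    using v that by (auto simp: K_def)
  have v1: "inner_on I v v = 1" using v by (auto simp: K_def)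
  have le: "inner_on I w (apply_on I A w) \<le> M * inner_on I w w" if w: "\<And>k. k \<in> B \<Longrightarrow> inner_on I (e k) w = 0" for w
  proof (cases "inner_on I w w > 0")
    case True
    let ?n = "sqrt (inner_on I w w)"
    let ?w = "\<lambda>i. if i \<in> I then w i / ?n else 0"
    have "inner_on I ?w (apply_on I A ?w) = inner_on I (\<lambda>i. w i / ?n) (\<lambda>i. apply_on I A w i / ?n)"
      by (rule inner_on_cong) (auto simp: apply_on_def sum_divide_distrib intro!: sum.cong)
    also have "\<dots> = inner_on I w (apply_on I A w) / ?n / ?n"
      by (simp add: inner_on_divide_left inner_on_commute[of I w "\<lambda>i. apply_on I A w i / ?n"] inner_on_commute[of I "apply_on I A w"])
    also have "\<dots> = inner_on I w (apply_on I A w) / inner_on I w w"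
      by simp
    finally have "inner_on I w (apply_on I A w) / inner_on I w w \<le> M"
      using max[OF norm[OF w True]] by (simp add: M_def)
    thus ?thesis using True by (simp add: field_simps)
  next
    case False
    hence "inner_on I w w = 0" using inner_on_self_nonneg[of I w] by linarith
    hence "\<forall>i\<in>I. w i = 0" by (simp add: inner_on_self_eq_0_iff I)
    thus ?thesis by (simp add: inner_on_def)
  qed
  define w where "w = (\<lambda>x. apply_on I A v x - M * v x)"
  have wo: "inner_on I (e k) w = 0" if "k \<in> B" for k
  proof -
    have "inner_on I (e k) (apply_on I A v) = inner_on I (apply_on I A (e k)) v" by (rule inner_on_apply_symm[OF A])
    also have "\<dots> = inner_on I (\<lambda>x. l k * e k x) v" by (rule inner_on_cong) (use ev that in auto)
    also have "\<dots> = 0" using vo that by (simp add: inner_on_scale_left)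
    finally show ?thesis using vo that by (simp add: w_def inner_on_diff_right inner_on_scale_right)
  qed
  text \<open>First-order optimality of \<open>v\<close> in the direction of its own residual.\<close>
  define a where "a = inner_on I w w"
  define b where "b = M * a - inner_on I w (apply_on I A w)"
  have quad: "2 * t * a \<le> t\<^sup>2 * b" for t
  proof -
    have "inner_on I (e k) (\<lambda>x. v x + t * w x) = 0" if "k \<in> B" for k
      using vo wo that by (simp add: inner_on_add_right inner_on_scale_right)
    note l = le[OF this]
    have apt: "apply_on I A (\<lambda>x. v x + t * w x) = (\<lambda>x. apply_on I A v x + t * apply_on I A w x)"
      by (auto simp: apply_on_def algebra_simps sum.distrib sum_distrib_left)
    have c: "inner_on I v (apply_on I A w) = inner_on I w (apply_on I A v)"
      using inner_on_apply_symm[OF A, of v w] by (simp add: inner_on_commute)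
    have "inner_on I w w = inner_on I w (apply_on I A v) - M * inner_on I w v"
      by (subst (2) w_def) (simp add: inner_on_diff_right inner_on_scale_right)
    hence "inner_on I w (apply_on I A v) = inner_on I w w + M * inner_on I w v" by simp
    moreover have "inner_on I v (apply_on I A v) = M * inner_on I v v" by (simp add: v1 M_def)
    ultimately show ?thesis
      using l unfolding apt b_def a_def
      by (simp add: inner_on_add_left inner_on_add_right inner_on_scale_left inner_on_scale_right c inner_on_commute[of I v w]
          algebra_simps power2_eq_square)
  qed
  have "a = 0"
  proof (rule ccontr)
    assume "a \<noteq> 0"
    hence apply_on: "a > 0" using inner_on_self_nonneg[of I w] unfolding a_def by linarith
    \<comment> \<open>A positive step so small that \<open>t * b\<close> is at most
      \<open>a\<close>, against \<open>2 * a \<le> t * b\<close>.\<close>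
    define t where "t = a / (\<bar>b\<bar> + 1)"
    have t: "t > 0" unfolding t_def by (intro divide_pos_pos apply_on) auto
    have "2 * a \<le> t * b" using quad[of t] t by (simp add: power2_eq_square mult.assoc)
    also have "\<dots> \<le> t * (\<bar>b\<bar> + 1)" using t by (intro mult_left_mono) auto
    also have "\<dots> = a" by (simp add: t_def)
    finally show False using apply_on by simp
  qed
  hence "\<forall>x\<in>I. apply_on I A v x = M * v x"
    unfolding a_def using inner_on_self_eq_0_iff[OF I, of w] by (auto simp: w_def)
  thus ?thesis using v1 vo by blast
qed

text \<open>Eigenvectors are added one index at a time. Once all indices are used, the total
  residual is \<open>card I - card I = 0\<close>, which is completeness.\<close>

theorem spectral_theorem:
  assumes I: "finite I" and A: "symm_on I A"
  obtains e l where "eigensystem I A e l"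
proof -
  have "\<exists>e l. (\<forall>k\<in>B. \<forall>k'\<in>B. inner_on I (e k) (e k') = of_bool (k = k')) \<and>
      (\<forall>k\<in>B. \<forall>x\<in>I. apply_on I A (e k) x = l k * e k x)" if "B \<subseteq> I" for B
    using finite_subset[OF that I] that
  proof (induction B)
    case empty
    show ?case by simp
  next
    case (insert b B)
    then obtain e l where on: "\<forall>k\<in>B. \<forall>k'\<in>B. inner_on I (e k) (e k') = of_bool (k = k')"
      and ev: "\<forall>k\<in>B. \<forall>x\<in>I. apply_on I A (e k) x = l k * e k x" by auto
    have "card B < card I" using insert.hyps insert.prems I
      by (metis card_mono card_insert_disjoint Suc_le_eq)
    have "\<exists>v M. inner_on I v v = 1 \<and> (\<forall>k\<in>B. inner_on I (e k) v = 0) \<and> (\<forall>x\<in>I. apply_on I A v x = M * v x)"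
      by (rule extend_eigenvectors[OF I insert.hyps(1) \<open>card B < card I\<close> A, of e l])
         (use on ev in auto)
    then obtain v M where v: "inner_on I v v = 1" "\<forall>k\<in>B. inner_on I (e k) v = 0" "\<forall>x\<in>I. apply_on I A v x = M * v x"
      by blast
    have v': "\<forall>k\<in>B. inner_on I v (e k) = 0" using v(2) by (subst inner_on_commute)
    show ?case
    proof (intro exI[of _ "e(b := v)"] exI[of _ "l(b := M)"] conjI ballI)
      fix k k' assume "k \<in> insert b B" "k' \<in> insert b B"
      thus "inner_on I ((e(b := v)) k) ((e(b := v)) k') = of_bool (k = k')"
        using on v(1,2) v' insert.hyps(2) by (cases "k = b"; cases "k' = b") auto
    next
      fix k x assume "k \<in> insert b B" "x \<in> I"
      thus "apply_on I A ((e(b := v)) k) x = (l(b := M)) k * (e(b := v)) k x"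
        using ev v(3) by auto
    qed
  qed
  from this[OF order_refl] obtain e l
    where on: "\<forall>k\<in>I. \<forall>k'\<in>I. inner_on I (e k) (e k') = of_bool (k = k')"
      and ev: "\<forall>k\<in>I. \<forall>x\<in>I. apply_on I A (e k) x = l k * e k x" by blast
  define R where "R = (\<lambda>i x. of_bool (x = i) - (\<Sum>k\<in>I. e k i * e k x))"
  have "(\<Sum>i\<in>I. inner_on I (R i) (R i)) = 0"
    using orthonormal_residual(1)[OF I I, of e] on by (simp add: R_def)
  hence "\<forall>i\<in>I. \<forall>x\<in>I. R i x = 0"
    using sum_nonneg_eq_0_iff[OF I, of "\<lambda>i. inner_on I (R i) (R i)"] by (simp add: inner_on_self_eq_0_iff I)
  hence "\<forall>x\<in>I. \<forall>y\<in>I. (\<Sum>k\<in>I. e k x * e k y) = of_bool (x = y)"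
    by (auto simp: R_def mult.commute)
  thus ?thesis using that on ev unfolding eigensystem_def by blast
qed

lemma eigensystem_orthonormal:
  "eigensystem I A e l \<Longrightarrow> k \<in> I \<Longrightarrow> k' \<in> I \<Longrightarrow> inner_on I (e k) (e k') = of_bool (k = k')"
  and eigensystem_eq:
  "eigensystem I A e l \<Longrightarrow> k \<in> I \<Longrightarrow> x \<in> I \<Longrightarrow> apply_on I A (e k) x = l k * e k x"
  by (auto simp: eigensystem_def)

lemma eigensystem_Parseval:
  assumes I: "finite I" and E: "eigensystem I A e l"
  shows "(\<Sum>k\<in>I. inner_on I (e k) x * inner_on I (e k) y) = inner_on I x y"
proof -
  have "(\<Sum>k\<in>I. inner_on I (e k) x * inner_on I (e k) y) =
      (\<Sum>k\<in>I. \<Sum>i\<in>I. \<Sum>j\<in>I. x i * y j * (e k i * e k j))"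
    unfolding inner_on_def sum_product by (simp add: mult_ac)
  also have "\<dots> = (\<Sum>i\<in>I. \<Sum>k\<in>I. \<Sum>j\<in>I. x i * y j * (e k i * e k j))"
    by (rule sum.swap)
  also have "\<dots> = (\<Sum>i\<in>I. \<Sum>j\<in>I. \<Sum>k\<in>I. x i * y j * (e k i * e k j))"
    by (rule sum.cong[OF refl], rule sum.swap)
  also have "\<dots> = (\<Sum>i\<in>I. \<Sum>j\<in>I. x i * y j * (\<Sum>k\<in>I. e k i * e k j))"
    by (simp only: sum_distrib_left)
  also have "\<dots> = (\<Sum>i\<in>I. \<Sum>j\<in>I. if j = i then x i * y j else 0)"
    by (intro sum.cong refl) (use E in \<open>auto simp: eigensystem_def\<close>)
  also have "\<dots> = inner_on I x y" by (simp add: I inner_on_def)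
  finally show ?thesis .
qed

lemma eigensystem_Parseval_square:
  assumes "finite I" "eigensystem I A e l"
  shows "(\<Sum>k\<in>I. (inner_on I (e k) x)\<^sup>2) = inner_on I x x"
  using eigensystem_Parseval[OF assms, of x x] by (simp add: power2_eq_square)

section \<open>Powers and traces read off from eigenvalues\<close>

fun mat_pow :: "'i set \<Rightarrow> ('i \<Rightarrow> 'i \<Rightarrow> real) \<Rightarrow> nat \<Rightarrow> 'i \<Rightarrow> 'i \<Rightarrow> real" where
  "mat_pow I A 0 = (\<lambda>x y. of_bool (x = y))"
| "mat_pow I A (Suc q) = (\<lambda>x y. \<Sum>z\<in>I. A x z * mat_pow I A q z y)"

definition tr_pow :: "'i set \<Rightarrow> ('i \<Rightarrow> 'i \<Rightarrow> real) \<Rightarrow> nat \<Rightarrow> real" where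
  "tr_pow I A q = (\<Sum>x\<in>I. mat_pow I A q x x)"

lemma mat_pow_eigensystem:
  assumes "finite I" "eigensystem I A e l" "x \<in> I" "y \<in> I"
  shows "mat_pow I A q x y = (\<Sum>k\<in>I. l k ^ q * e k x * e k y)"
  using assms(3,4)
proof (induction q arbitrary: x y)
  case 0
  thus ?case using assms(2) by (simp add: eigensystem_def)
next
  case (Suc q)
  have "mat_pow I A (Suc q) x y = (\<Sum>z\<in>I. \<Sum>k\<in>I. l k ^ q * (A x z * e k z) * e k y)"
    using Suc by (simp add: sum_distrib_left mult_ac)
  also have "\<dots> = (\<Sum>k\<in>I. l k ^ q * apply_on I A (e k) x * e k y)"
    by (subst sum.swap) (simp add: apply_on_def sum_distrib_left sum_distrib_right)
  also have "\<dots> = (\<Sum>k\<in>I. l k ^ Suc q * e k x * e k y)"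
    by (intro sum.cong refl) (simp add: eigensystem_eq[OF assms(2)] Suc.prems)
  finally show ?case .
qed

lemma tr_pow_eigensystem:
  assumes "finite I" "eigensystem I A e l"
  shows "tr_pow I A q = (\<Sum>k\<in>I. l k ^ q)"
proof -
  have "tr_pow I A q = (\<Sum>x\<in>I. \<Sum>k\<in>I. l k ^ q * (e k x * e k x))"
    unfolding tr_pow_def by (intro sum.cong refl) (simp add: mat_pow_eigensystem[OF assms] mult_ac)
  also have "\<dots> = (\<Sum>k\<in>I. l k ^ q * inner_on I (e k) (e k))"
    by (subst sum.swap) (simp add: inner_on_def sum_distrib_left)
  finally show ?thesis using eigensystem_orthonormal[OF assms(2)] by simp
qed

subsection \<open>Trace inequalities\<close>

text \<open>The difference of odd powers is \<open>a - b\<close> times a sum of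
  \<open>2 * r + 1\<close> monomials of degree \<open>2 * r\<close>. Pairing the monomial with
  exponent \<open>i\<close> with the one with exponent \<open>2 * r - i\<close> bounds each pair by
  the two pure powers. The even degree makes the bound insensitive to the signs of \<open>a\<close>
  and \<open>b\<close>.\<close>

lemma power_difference_bound:
  fixes a b :: real
  shows "(a ^ (2 * r + 1) - b ^ (2 * r + 1)) * (a - b)
    \<le> real (2 * r + 1) / 2 * ((a - b)\<^sup>2 * (a ^ (2 * r) + b ^ (2 * r)))"
proof -
  define T where "T = (\<Sum>i<2*r+1. a ^ (2 * r - i) * b ^ i)"
  have T2: "T = (\<Sum>i<2*r+1. a ^ i * b ^ (2 * r - i))"
    unfolding T_def by (subst sum.nat_diff_reindex[symmetric]) (auto intro!: sum.cong)
  with T_def have "2 * T = (\<Sum>i<2*r+1. a ^ (2 * r - i) * b ^ i + a ^ i * b ^ (2 * r - i))"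
    unfolding sum.distrib by simp
  also have "\<dots> \<le> (\<Sum>i<2*r+1. a ^ (2 * r) + b ^ (2 * r))"
  proof (rule sum_mono)
    fix i assume "i \<in> {..<2*r+1}"
    then obtain j where j: "2 * r = i + j" by (metis lessThan_iff less_Suc_eq_le Suc_eq_plus1 le_iff_add)
    \<comment> \<open>Rearrangement: both differences have the sign of
      \<open>\<bar>a\<bar> - \<bar>b\<bar>\<close>.\<close>
    have "0 \<le> (\<bar>a\<bar> ^ i - \<bar>b\<bar> ^ i) * (\<bar>a\<bar> ^ j - \<bar>b\<bar> ^ j)"
      by (cases "\<bar>a\<bar> \<le> \<bar>b\<bar>")
         (auto intro!: mult_nonneg_nonneg mult_nonpos_nonpos simp: power_mono)
    hence "\<bar>a\<bar> ^ j * \<bar>b\<bar> ^ i + \<bar>a\<bar> ^ i * \<bar>b\<bar> ^ j \<le> \<bar>a\<bar> ^ (2 * r) + \<bar>b\<bar> ^ (2 * r)"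
      unfolding j power_add by (simp add: algebra_simps)
    moreover have "a ^ j * b ^ i \<le> \<bar>a\<bar> ^ j * \<bar>b\<bar> ^ i" "a ^ i * b ^ j \<le> \<bar>a\<bar> ^ i * \<bar>b\<bar> ^ j"
      by (metis abs_ge_self abs_mult power_abs)+
    moreover have "\<bar>a\<bar> ^ (2 * r) = a ^ (2 * r)" "\<bar>b\<bar> ^ (2 * r) = b ^ (2 * r)"
      by (simp_all add: power_even_abs)
    moreover have "2 * r - i = j" using j by simp
    ultimately show "a ^ (2 * r - i) * b ^ i + a ^ i * b ^ (2 * r - i) \<le> a ^ (2 * r) + b ^ (2 * r)"
      by simp
  qed
  finally have T: "T \<le> real (2 * r + 1) / 2 * (a ^ (2 * r) + b ^ (2 * r))" by (simp add: field_simps)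
  have "a ^ Suc (2 * r) - b ^ Suc (2 * r) = (a - b) * T"
    unfolding T2 using power_diff_sumr2[of a "Suc (2 * r)" b] by (simp add: mult_ac)
  hence "(a ^ (2 * r + 1) - b ^ (2 * r + 1)) * (a - b) = (a - b)\<^sup>2 * T"
    by (simp add: power2_eq_square)
  also have "\<dots> \<le> (a - b)\<^sup>2 * (real (2 * r + 1) / 2 * (a ^ (2 * r) + b ^ (2 * r)))"
    using T by (rule mult_left_mono) simp
  finally show ?thesis by (simp add: mult_ac)
qed

text \<open>\<open>X\<close> and \<open>Y\<close> need not commute, so each is diagonalised in its
  own basis. Between the two bases the entries of \<open>X - Y\<close> are
  \<open>(l k - m k') * G k k'\<close>, where \<open>G\<close> is the overlap of the eigenvectors.
  Both sides become double sums weighted by the squares of \<open>G\<close>, and the scalar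
  inequality applies term by term.\<close>

lemma trace_power_difference:
  assumes I: "finite I" and X: "symm_on I X" "eigensystem I X e l"
    and Y: "symm_on I Y" "eigensystem I Y f m"
  defines "D \<equiv> (\<lambda>x y. X x y - Y x y)"
  shows "(\<Sum>k\<in>I. l k ^ (2*r+1) * inner_on I (e k) (apply_on I D (e k)))
       - (\<Sum>k\<in>I. m k ^ (2*r+1) * inner_on I (f k) (apply_on I D (f k)))
    \<le> real (2*r+1) / 2 * ((\<Sum>k\<in>I. l k ^ (2*r) * inner_on I (apply_on I D (e k)) (apply_on I D (e k)))
       + (\<Sum>k\<in>I. m k ^ (2*r) * inner_on I (apply_on I D (f k)) (apply_on I D (f k))))"
proof -
  define G where "G = (\<lambda>k k'. inner_on I (e k) (f k'))"
  have symD: "symm_on I D" using X(1) Y(1) by (auto simp: symm_on_def D_def)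
  have D1: "inner_on I (e k) (apply_on I D (f k')) = (l k - m k') * G k k'" if "k \<in> I" "k' \<in> I" for k k'
  proof -
    have "inner_on I (e k) (apply_on I X (f k')) = inner_on I (apply_on I X (e k)) (f k')" by (rule inner_on_apply_symm[OF X(1)])
    also have "\<dots> = inner_on I (\<lambda>x. l k * e k x) (f k')"
      by (rule inner_on_cong) (use eigensystem_eq[OF X(2)] that in auto)
    finally have 1: "inner_on I (e k) (apply_on I X (f k')) = l k * G k k'" by (simp add: G_def inner_on_scale_left)
    have "inner_on I (e k) (apply_on I Y (f k')) = inner_on I (e k) (\<lambda>x. m k' * f k' x)"
      by (rule inner_on_cong) (use eigensystem_eq[OF Y(2)] that in auto)
    hence "inner_on I (e k) (apply_on I Y (f k')) = m k' * G k k'" by (simp add: G_def inner_on_scale_right)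
    thus ?thesis using 1 unfolding D_def apply_on_diff inner_on_diff_right by (simp add: algebra_simps)
  qed
  hence D2: "inner_on I (f k') (apply_on I D (e k)) = (l k - m k') * G k k'" if "k \<in> I" "k' \<in> I" for k k'
    using that inner_on_apply_symm[OF symD, of "f k'" "e k"] inner_on_commute[of I "apply_on I D (f k')" "e k"] by simp
  have q1: "inner_on I (e k) (apply_on I D (e k)) = (\<Sum>k'\<in>I. (l k - m k') * (G k k')\<^sup>2)" if "k \<in> I" for k
    unfolding eigensystem_Parseval[OF I Y(2), of "e k" "apply_on I D (e k)", symmetric]
    by (intro sum.cong refl) (simp add: D2 that G_def inner_on_commute[of I "f _" "e k"] power2_eq_square)
  have q2: "inner_on I (f k') (apply_on I D (f k')) = (\<Sum>k\<in>I. (l k - m k') * (G k k')\<^sup>2)" if "k' \<in> I" for k'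
    unfolding eigensystem_Parseval[OF I X(2), of "f k'" "apply_on I D (f k')", symmetric]
    by (intro sum.cong refl) (simp add: D1 that G_def power2_eq_square)
  have n1: "inner_on I (apply_on I D (e k)) (apply_on I D (e k)) = (\<Sum>k'\<in>I. (l k - m k')\<^sup>2 * (G k k')\<^sup>2)" if "k \<in> I" for k
    unfolding eigensystem_Parseval_square[OF I Y(2), of "apply_on I D (e k)", symmetric]
    by (intro sum.cong refl) (simp add: D2 that power_mult_distrib)
  have n2: "inner_on I (apply_on I D (f k')) (apply_on I D (f k')) = (\<Sum>k\<in>I. (l k - m k')\<^sup>2 * (G k k')\<^sup>2)" if "k' \<in> I" for k'
    unfolding eigensystem_Parseval_square[OF I X(2), of "apply_on I D (f k')", symmetric]
    by (intro sum.cong refl) (simp add: D1 that power_mult_distrib)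
  have "(\<Sum>k\<in>I. l k ^ (2*r+1) * inner_on I (e k) (apply_on I D (e k)))
       - (\<Sum>k\<in>I. m k ^ (2*r+1) * inner_on I (f k) (apply_on I D (f k)))
     = (\<Sum>k\<in>I. \<Sum>k'\<in>I. l k ^ (2*r+1) * ((l k - m k') * (G k k')\<^sup>2))
       - (\<Sum>k'\<in>I. \<Sum>k\<in>I. m k' ^ (2*r+1) * ((l k - m k') * (G k k')\<^sup>2))"
    by (simp only: q1 q2 sum_distrib_left cong: sum.cong)
  also have "\<dots> = (\<Sum>k\<in>I. \<Sum>k'\<in>I. (l k ^ (2*r+1) - m k' ^ (2*r+1)) * (l k - m k') * (G k k')\<^sup>2)"
    unfolding sum.swap[of "\<lambda>k' k. m k' ^ (2*r+1) * ((l k - m k') * (G k k')\<^sup>2)"]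
    by (simp only: sum_subtractf[symmetric] left_diff_distrib mult.assoc)
  also have "\<dots> \<le> (\<Sum>k\<in>I. \<Sum>k'\<in>I. real (2 * r + 1) / 2 * ((l k - m k')\<^sup>2 * (l k ^ (2 * r) + m k' ^ (2 * r))) * (G k k')\<^sup>2)"
    by (intro sum_mono mult_right_mono power_difference_bound) simp
  also have "\<dots> = real (2*r+1) / 2 * ((\<Sum>k\<in>I. \<Sum>k'\<in>I. l k ^ (2*r) * ((l k - m k')\<^sup>2 * (G k k')\<^sup>2))
       + (\<Sum>k\<in>I. \<Sum>k'\<in>I. m k' ^ (2*r) * ((l k - m k')\<^sup>2 * (G k k')\<^sup>2)))"
    unfolding sum.distrib[symmetric] sum_distrib_left by (intro sum.cong refl) (simp add: algebra_simps)
  also have "(\<Sum>k\<in>I. \<Sum>k'\<in>I. m k' ^ (2*r) * ((l k - m k')\<^sup>2 * (G k k')\<^sup>2))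
     = (\<Sum>k'\<in>I. \<Sum>k\<in>I. m k' ^ (2*r) * ((l k - m k')\<^sup>2 * (G k k')\<^sup>2))" by (rule sum.swap)
  finally show ?thesis by (simp only: n1 n2 sum_distrib_left cong: sum.cong)
qed

text \<open>Young's inequality with exponents \<open>(r + 1) / r\<close> and \<open>r + 1\<close>,
  applied to the square of \<open>x\<close>. Its first term has coefficient below 1, which later
  allows the trace to be absorbed.\<close>

lemma weighted_power_AM_GM:
  fixes x c :: real
  assumes "c \<ge> 0"
  shows "x ^ (2*r) * c \<le> real r / real (r+1) * x ^ (2*(r+1)) + c ^ (r+1) / real (r+1)"
proof -
  define a where "a = x\<^sup>2"
  have a: "a \<ge> 0" by (simp add: a_def)
  have "real (r+1) * (a ^ r * c) \<le> real r * a ^ (r+1) + c ^ (r+1)"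
  proof (induction r)
    case (Suc r)
    \<comment> \<open>Expanded, this bounds the two mixed products left by the induction hypothesis
      by the pure powers of degree \<open>r + 2\<close>.\<close>
    have "0 \<le> (a ^ (r+1) - c ^ (r+1)) * (a - c)"
      by (cases "a \<le> c") (use a assms in \<open>auto intro!: mult_nonneg_nonneg mult_nonpos_nonpos power_mono simp: power_mono simp del: power_Suc\<close>)
    moreover have "a * (real (r+1) * (a ^ r * c)) \<le> a * (real r * a ^ (r+1) + c ^ (r+1))"
      using Suc a by (rule mult_left_mono)
    ultimately show ?case by (simp add: algebra_simps)
  qed simp
  moreover have "a ^ r = x ^ (2 * r)" "a ^ (r + 1) = x ^ (2 * (r + 1))"
    unfolding a_def power_mult by simp_all
  ultimately have "(x ^ (2*r) * c) * real (r+1) \<le> real r * x ^ (2*(r+1)) + c ^ (r+1)"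
    by (simp only: mult.commute)
  hence "x ^ (2*r) * c \<le> (real r * x ^ (2*(r+1)) + c ^ (r+1)) / real (r+1)"
    by (subst pos_le_divide_eq) auto
  thus ?thesis by (simp only: add_divide_distrib times_divide_eq_left)
qed

text \<open>Bessel families play the role of the trace Hoelder inequality: each \<open>\<langle>g, e\<rangle>\<^sup>2\<close> serves as a
  weight in the arithmetic-geometric mean inequality.\<close>

lemma Bessel_AM_GM:
  assumes I: "finite I" and E: "eigensystem I A e l"
    and c: "\<And>b. b \<in> B \<Longrightarrow> c b \<ge> 0"
    and bes: "\<And>x. (\<Sum>b\<in>B. (inner_on I (g b) x)\<^sup>2) \<le> inner_on I x x"
  shows "(\<Sum>k\<in>I. l k ^ (2*r) * (\<Sum>b\<in>B. c b * (inner_on I (g b) (e k))\<^sup>2))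
     \<le> real r / real (r+1) * tr_pow I A (2*(r+1)) + (\<Sum>b\<in>B. c b ^ (r+1) * inner_on I (g b) (g b)) / real (r+1)"
proof -
  have "(\<Sum>k\<in>I. l k ^ (2*r) * (\<Sum>b\<in>B. c b * (inner_on I (g b) (e k))\<^sup>2))
      = (\<Sum>k\<in>I. \<Sum>b\<in>B. l k ^ (2*r) * c b * (inner_on I (g b) (e k))\<^sup>2)"
    by (simp add: sum_distrib_left mult_ac)
  also have "\<dots> \<le> (\<Sum>k\<in>I. \<Sum>b\<in>B. (real r / real (r+1) * l k ^ (2*(r+1)) + c b ^ (r+1) / real (r+1))
      * (inner_on I (g b) (e k))\<^sup>2)"
    by (intro sum_mono mult_right_mono weighted_power_AM_GM c) auto
  also have "\<dots> = (\<Sum>k\<in>I. real r / real (r+1) * l k ^ (2*(r+1)) * (\<Sum>b\<in>B. (inner_on I (g b) (e k))\<^sup>2))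
      + (\<Sum>k\<in>I. \<Sum>b\<in>B. c b ^ (r+1) / real (r+1) * (inner_on I (g b) (e k))\<^sup>2)"
    by (simp add: sum.distrib distrib_right sum_distrib_left)
  also have "(\<Sum>k\<in>I. real r / real (r+1) * l k ^ (2*(r+1)) * (\<Sum>b\<in>B. (inner_on I (g b) (e k))\<^sup>2))
      \<le> (\<Sum>k\<in>I. real r / real (r+1) * l k ^ (2*(r+1)) * 1)"
  proof (intro sum_mono mult_left_mono)
    fix k assume "k \<in> I"
    thus "(\<Sum>b\<in>B. (inner_on I (g b) (e k))\<^sup>2) \<le> 1"
      using bes[of "e k"] eigensystem_orthonormal[OF E, of k k] by simp
    show "0 \<le> real r / real (r+1) * l k ^ (2*(r+1))"
      by (intro mult_nonneg_nonneg divide_nonneg_nonneg zero_le_even_power) auto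
  qed
  also have "\<dots> = real r / real (r+1) * tr_pow I A (2*(r+1))"
    by (simp add: tr_pow_eigensystem[OF I E] sum_distrib_left)
  \<comment> \<open>In this term the weights no longer depend on \<open>k\<close>, so Parseval in
    the eigenbasis collapses the sum over \<open>k\<close> to the squared norm of
    \<open>g b\<close>.\<close>
  also have "(\<Sum>k\<in>I. \<Sum>b\<in>B. c b ^ (r+1) / real (r+1) * (inner_on I (g b) (e k))\<^sup>2)
      = (\<Sum>b\<in>B. c b ^ (r+1) / real (r+1) * (\<Sum>k\<in>I. (inner_on I (e k) (g b))\<^sup>2))"
    by (subst sum.swap) (simp add: sum_distrib_left inner_on_commute)
  also have "\<dots> = (\<Sum>b\<in>B. c b ^ (r+1) * inner_on I (g b) (g b)) / real (r+1)"
    by (simp add: eigensystem_Parseval_square[OF I E] sum_divide_distrib)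
  finally show ?thesis by simp
qed

subsection \<open>The matrix Khintchine inequality\<close>

definition signs :: "'s set \<Rightarrow> ('s \<Rightarrow> real) set" where
  "signs S = PiE S (\<lambda>_. {-1, 1})"

text \<open>The expectation over fully independent uniform signs, as a finite sum so that flipping
  one sign is a reindexing. Signs of limited independence are reduced to it through the degree of
  the averaged polynomial.\<close>

definition sign_avg :: "'s set \<Rightarrow> (('s \<Rightarrow> real) \<Rightarrow> real) \<Rightarrow> real" where
  "sign_avg S f = (\<Sum>\<sigma>\<in>signs S. f \<sigma>) / 2 ^ card S"

definition flip :: "'s \<Rightarrow> ('s \<Rightarrow> real) \<Rightarrow> 's \<Rightarrow> real" where
  "flip a \<sigma> = \<sigma>(a := - \<sigma> a)"

lemma card_signs: "finite S \<Longrightarrow> card (signs S) = 2 ^ card S"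
  by (simp add: signs_def card_PiE numeral_2_eq_2)

lemma flip_in_signs: "a \<in> S \<Longrightarrow> \<sigma> \<in> signs S \<Longrightarrow> flip a \<sigma> \<in> signs S"
  by (auto simp: signs_def flip_def PiE_iff extensional_def)

lemma flip_flip [simp]: "flip a (flip a \<sigma>) = \<sigma>"
  by (simp add: flip_def)

lemma signs_square: "\<sigma> \<in> signs S \<Longrightarrow> a \<in> S \<Longrightarrow> \<sigma> a * \<sigma> a = 1"
  by (auto simp: signs_def PiE_iff)

lemma sign_avg_flip:
  assumes "a \<in> S"
  shows "sign_avg S (\<lambda>\<sigma>. f (flip a \<sigma>)) = sign_avg S f"
proof -
  have "(\<Sum>\<sigma>\<in>signs S. f (flip a \<sigma>)) = (\<Sum>\<sigma>\<in>signs S. f \<sigma>)"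
    by (rule sum.reindex_bij_witness[of _ "flip a" "flip a"]) (auto simp: flip_in_signs assms)
  thus ?thesis by (simp add: sign_avg_def)
qed

lemma sign_avg_mono: "(\<And>\<sigma>. \<sigma> \<in> signs S \<Longrightarrow> f \<sigma> \<le> g \<sigma>) \<Longrightarrow> sign_avg S f \<le> sign_avg S g"
  by (simp add: sign_avg_def divide_right_mono sum_mono)

lemma sign_avg_cong: "(\<And>\<sigma>. \<sigma> \<in> signs S \<Longrightarrow> f \<sigma> = g \<sigma>) \<Longrightarrow> sign_avg S f = sign_avg S g"
  by (simp add: sign_avg_def)

lemma sign_avg_add: "sign_avg S (\<lambda>\<sigma>. f \<sigma> + g \<sigma>) = sign_avg S f + sign_avg S g"
  by (simp add: sign_avg_def sum.distrib add_divide_distrib)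

lemma sign_avg_cmult: "sign_avg S (\<lambda>\<sigma>. c * f \<sigma>) = c * sign_avg S f"
  by (simp add: sign_avg_def sum_distrib_left[symmetric])

lemma sign_avg_sum: "sign_avg S (\<lambda>\<sigma>. \<Sum>b\<in>B. f b \<sigma>) = (\<Sum>b\<in>B. sign_avg S (f b))"
  unfolding sign_avg_def by (subst sum.swap) (simp add: sum_divide_distrib)

lemma sign_avg_const: "finite S \<Longrightarrow> sign_avg S (\<lambda>\<sigma>. c) = c"
  by (simp add: sign_avg_def card_signs)

text \<open>Pairing each sign pattern with the one where a single sign is flipped turns the trace into a
  difference of powers, to which the trace inequality applies.\<close>

lemma Khintchine_step:
  fixes Z :: "('s \<Rightarrow> real) \<Rightarrow> 'i \<Rightarrow> 'i \<Rightarrow> real"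
  defines "D \<equiv> \<lambda>\<sigma> a x y. Z \<sigma> x y - Z (flip a \<sigma>) x y"
  assumes I: "finite I"
    and sym: "\<And>\<sigma>. \<sigma> \<in> signs S \<Longrightarrow> symm_on I (Z \<sigma>)"
    and E: "\<And>\<sigma>. \<sigma> \<in> signs S \<Longrightarrow> eigensystem I (Z \<sigma>) (e \<sigma>) (l \<sigma>)"
    and h: "h > 0"
    and hom: "\<And>\<sigma> x y. \<sigma> \<in> signs S \<Longrightarrow> x \<in> I \<Longrightarrow> y \<in> I \<Longrightarrow> (\<Sum>a\<in>S. D \<sigma> a x y) = 2 * h * Z \<sigma> x y"
  shows "sign_avg S (\<lambda>\<sigma>. tr_pow I (Z \<sigma>) (2 * (r + 1))) \<le> real (2*r+1) / (4 * h) *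
     sign_avg S (\<lambda>\<sigma>. \<Sum>k\<in>I. l \<sigma> k ^ (2*r) * (\<Sum>a\<in>S. inner_on I (apply_on I (D \<sigma> a) (e \<sigma> k)) (apply_on I (D \<sigma> a) (e \<sigma> k))))"
proof -
  define P where "P = (\<lambda>\<sigma> a. \<Sum>k\<in>I. l \<sigma> k ^ (2*r+1) * inner_on I (e \<sigma> k) (apply_on I (D \<sigma> a) (e \<sigma> k)))"
  define W where "W = (\<lambda>\<sigma> a. \<Sum>k\<in>I. l \<sigma> k ^ (2*r) * inner_on I (apply_on I (D \<sigma> a) (e \<sigma> k)) (apply_on I (D \<sigma> a) (e \<sigma> k)))"
  \<comment> \<open>Euler's identity for a multilinear form of degree \<open>h\<close>: flipping
    sign \<open>a\<close> doubles and isolates the terms containing \<open>a\<close>, and summing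
    over \<open>a\<close> counts each term \<open>h\<close> times. One factor \<open>Z\<close> of
    the trace is replaced in this way.\<close>
  have T: "2 * h * tr_pow I (Z \<sigma>) (2 * (r + 1)) = (\<Sum>a\<in>S. P \<sigma> a)" if \<sigma>: "\<sigma> \<in> signs S" for \<sigma>
  proof -
    have s: "(\<Sum>a\<in>S. inner_on I (e \<sigma> k) (apply_on I (D \<sigma> a) (e \<sigma> k))) = 2 * h * l \<sigma> k" if k: "k \<in> I" for k
    proof -
      have "(\<Sum>a\<in>S. apply_on I (D \<sigma> a) (e \<sigma> k) x) = 2 * h * (l \<sigma> k * e \<sigma> k x)" if x: "x \<in> I" for x
      proof -
        have "(\<Sum>a\<in>S. apply_on I (D \<sigma> a) (e \<sigma> k) x) = (\<Sum>y\<in>I. \<Sum>a\<in>S. D \<sigma> a x y * e \<sigma> k y)"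
          unfolding apply_on_def by (rule sum.swap)
        also have "\<dots> = (\<Sum>y\<in>I. 2 * h * (Z \<sigma> x y * e \<sigma> k y))"
          by (intro sum.cong refl) (simp add: sum_distrib_right[symmetric] hom[OF \<sigma> x])
        also have "\<dots> = 2 * h * apply_on I (Z \<sigma>) (e \<sigma> k) x"
          by (simp add: apply_on_def sum_distrib_left)
        finally show ?thesis by (simp add: eigensystem_eq[OF E[OF \<sigma>] k x])
      qed
      hence "inner_on I (e \<sigma> k) (\<lambda>x. \<Sum>a\<in>S. apply_on I (D \<sigma> a) (e \<sigma> k) x)
          = inner_on I (e \<sigma> k) (\<lambda>x. (2 * h * l \<sigma> k) * e \<sigma> k x)"
        by (intro inner_on_cong) (auto simp: mult_ac)
      thus ?thesis
        using eigensystem_orthonormal[OF E[OF \<sigma>] k k] by (simp add: inner_on_sum_right inner_on_scale_right)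
    qed
    have "(\<Sum>a\<in>S. P \<sigma> a) = (\<Sum>k\<in>I. l \<sigma> k ^ (2*r+1) * (\<Sum>a\<in>S. inner_on I (e \<sigma> k) (apply_on I (D \<sigma> a) (e \<sigma> k))))"
      unfolding P_def by (subst sum.swap) (simp add: sum_distrib_left)
    also have "\<dots> = (\<Sum>k\<in>I. 2 * h * l \<sigma> k ^ (2 * (r+1)))"
      by (intro sum.cong refl) (simp add: s mult_ac)
    finally show ?thesis by (simp add: tr_pow_eigensystem[OF I E[OF \<sigma>]] sum_distrib_left)
  qed
  have PW: "P \<sigma> a + P (flip a \<sigma>) a \<le> real (2*r+1) / 2 * (W \<sigma> a + W (flip a \<sigma>) a)"
    if a: "a \<in> S" and \<sigma>: "\<sigma> \<in> signs S" for \<sigma> a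
  proof -
    let ?f = "flip a \<sigma>"
    have f: "?f \<in> signs S" by (rule flip_in_signs[OF a \<sigma>])
    \<comment> \<open>The increment changes its sign under the flip. The sum over the two sign
      patterns is therefore a difference of traces against one common increment.\<close>
    have neg: "apply_on I (D ?f a) v = (\<lambda>x. - apply_on I (D \<sigma> a) v x)" for v
      by (auto simp: D_def apply_on_def sum_negf[symmetric] algebra_simps)
    have P': "P ?f a = - (\<Sum>k\<in>I. l ?f k ^ (2*r+1) * inner_on I (e ?f k) (apply_on I (D \<sigma> a) (e ?f k)))"
      unfolding P_def neg by (simp add: inner_on_def sum_negf)
    have W': "W ?f a = (\<Sum>k\<in>I. l ?f k ^ (2*r) * inner_on I (apply_on I (D \<sigma> a) (e ?f k)) (apply_on I (D \<sigma> a) (e ?f k)))"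
      unfolding W_def neg by (simp add: inner_on_def)
    from trace_power_difference[OF I sym[OF \<sigma>] E[OF \<sigma>] sym[OF f] E[OF f], of r]
    show ?thesis unfolding P' W' unfolding P_def W_def D_def by simp
  qed
  have "2 * h * sign_avg S (\<lambda>\<sigma>. tr_pow I (Z \<sigma>) (2 * (r + 1))) = sign_avg S (\<lambda>\<sigma>. \<Sum>a\<in>S. P \<sigma> a)"
    unfolding sign_avg_cmult[symmetric] by (rule sign_avg_cong) (rule T)
  also have "\<dots> = (\<Sum>a\<in>S. sign_avg S (\<lambda>\<sigma>. P \<sigma> a))" by (rule sign_avg_sum)
  also have "\<dots> \<le> (\<Sum>a\<in>S. real (2*r+1) / 2 * sign_avg S (\<lambda>\<sigma>. W \<sigma> a))"
  proof (rule sum_mono)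
    fix a assume a: "a \<in> S"
    have "sign_avg S (\<lambda>\<sigma>. P \<sigma> a + P (flip a \<sigma>) a) \<le> sign_avg S (\<lambda>\<sigma>. real (2*r+1) / 2 * (W \<sigma> a + W (flip a \<sigma>) a))"
      by (rule sign_avg_mono) (rule PW[OF a])
    thus "sign_avg S (\<lambda>\<sigma>. P \<sigma> a) \<le> real (2*r+1) / 2 * sign_avg S (\<lambda>\<sigma>. W \<sigma> a)"
      using sign_avg_flip[OF a, of "\<lambda>\<sigma>. P \<sigma> a"] sign_avg_flip[OF a, of "\<lambda>\<sigma>. W \<sigma> a"]
      unfolding sign_avg_add sign_avg_cmult by (simp add: field_simps)
  qed
  also have "\<dots> = real (2*r+1) / 2 * sign_avg S (\<lambda>\<sigma>. \<Sum>a\<in>S. W \<sigma> a)"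
    unfolding sign_avg_sum sum_distrib_left ..
  also have "(\<lambda>\<sigma>. \<Sum>a\<in>S. W \<sigma> a) = (\<lambda>\<sigma>. \<Sum>k\<in>I. l \<sigma> k ^ (2*r) * (\<Sum>a\<in>S. inner_on I (apply_on I (D \<sigma> a) (e \<sigma> k)) (apply_on I (D \<sigma> a) (e \<sigma> k))))"
    unfolding W_def by (subst sum.swap) (simp add: sum_distrib_left)
  finally show ?thesis using h by (simp add: field_simps)
qed

text \<open>The increments of both applications split into two kinds of terms, hence two Bessel
  families. Each is given half of the absorption, which explains the factor 2 on the weights and the
  final division by 2.\<close>

lemma Bessel_Khintchine:
  fixes Z :: "('s \<Rightarrow> real) \<Rightarrow> 'i \<Rightarrow> 'i \<Rightarrow> real"
  defines "D \<equiv> \<lambda>\<sigma> a x y. Z \<sigma> x y - Z (flip a \<sigma>) x y"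
  assumes I: "finite I"
    and sym: "\<And>\<sigma>. \<sigma> \<in> signs S \<Longrightarrow> symm_on I (Z \<sigma>)"
    and h: "h > 0"
    and hom: "\<And>\<sigma> x y. \<sigma> \<in> signs S \<Longrightarrow> x \<in> I \<Longrightarrow> y \<in> I \<Longrightarrow> (\<Sum>a\<in>S. D \<sigma> a x y) = 2 * h * Z \<sigma> x y"
    and quad: "\<And>\<sigma> v. \<sigma> \<in> signs S \<Longrightarrow>
       real (2*r+1) / (4 * h) * (\<Sum>a\<in>S. inner_on I (apply_on I (D \<sigma> a) v) (apply_on I (D \<sigma> a) v))
       \<le> (\<Sum>b\<in>B1. c1 \<sigma> b * (inner_on I (g1 \<sigma> b) v)\<^sup>2) + (\<Sum>b\<in>B2. c2 \<sigma> b * (inner_on I (g2 \<sigma> b) v)\<^sup>2)"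
    and c: "\<And>\<sigma> b. \<sigma> \<in> signs S \<Longrightarrow> b \<in> B1 \<Longrightarrow> c1 \<sigma> b \<ge> 0"
           "\<And>\<sigma> b. \<sigma> \<in> signs S \<Longrightarrow> b \<in> B2 \<Longrightarrow> c2 \<sigma> b \<ge> 0"
    and bes: "\<And>\<sigma> v. \<sigma> \<in> signs S \<Longrightarrow> (\<Sum>b\<in>B1. (inner_on I (g1 \<sigma> b) v)\<^sup>2) \<le> inner_on I v v"
             "\<And>\<sigma> v. \<sigma> \<in> signs S \<Longrightarrow> (\<Sum>b\<in>B2. (inner_on I (g2 \<sigma> b) v)\<^sup>2) \<le> inner_on I v v"
  shows "sign_avg S (\<lambda>\<sigma>. tr_pow I (Z \<sigma>) (2 * (r + 1)))
     \<le> sign_avg S (\<lambda>\<sigma>. (\<Sum>b\<in>B1. (2 * c1 \<sigma> b) ^ (r+1) * inner_on I (g1 \<sigma> b) (g1 \<sigma> b))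
                + (\<Sum>b\<in>B2. (2 * c2 \<sigma> b) ^ (r+1) * inner_on I (g2 \<sigma> b) (g2 \<sigma> b))) / 2"
proof -
  have "\<exists>e l. eigensystem I (Z \<sigma>) e l" if "\<sigma> \<in> signs S" for \<sigma>
    by (rule spectral_theorem[OF I sym[OF that]]) blast
  then obtain e l where E: "\<And>\<sigma>. \<sigma> \<in> signs S \<Longrightarrow> eigensystem I (Z \<sigma>) (e \<sigma>) (l \<sigma>)"
    by metis
  let ?T = "\<lambda>\<sigma>. tr_pow I (Z \<sigma>) (2 * (r + 1))"
  let ?R1 = "\<lambda>\<sigma>. \<Sum>b\<in>B1. (2 * c1 \<sigma> b) ^ (r+1) * inner_on I (g1 \<sigma> b) (g1 \<sigma> b)"
  let ?R2 = "\<lambda>\<sigma>. \<Sum>b\<in>B2. (2 * c2 \<sigma> b) ^ (r+1) * inner_on I (g2 \<sigma> b) (g2 \<sigma> b)"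
  have pt: "real (2*r+1) / (4 * h) *
      (\<Sum>k\<in>I. l \<sigma> k ^ (2*r) * (\<Sum>a\<in>S. inner_on I (apply_on I (D \<sigma> a) (e \<sigma> k)) (apply_on I (D \<sigma> a) (e \<sigma> k))))
      \<le> real r / real (r+1) * ?T \<sigma> + 1 / real (r+1) * ((?R1 \<sigma> + ?R2 \<sigma>) / 2)" if \<sigma>: "\<sigma> \<in> signs S" for \<sigma>
  proof -
    let ?L = "\<lambda>c g B. \<Sum>k\<in>I. l \<sigma> k ^ (2*r) * (\<Sum>b\<in>B. 2 * c \<sigma> b * (inner_on I (g \<sigma> b) (e \<sigma> k))\<^sup>2)"
    have "real (2*r+1) / (4 * h) *
        (\<Sum>k\<in>I. l \<sigma> k ^ (2*r) * (\<Sum>a\<in>S. inner_on I (apply_on I (D \<sigma> a) (e \<sigma> k)) (apply_on I (D \<sigma> a) (e \<sigma> k))))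
      = (\<Sum>k\<in>I. l \<sigma> k ^ (2*r) * (real (2*r+1) / (4 * h) *
          (\<Sum>a\<in>S. inner_on I (apply_on I (D \<sigma> a) (e \<sigma> k)) (apply_on I (D \<sigma> a) (e \<sigma> k)))))"
      unfolding sum_distrib_left[of "real (2*r+1) / (4 * h)" _ I] by (simp only: mult.left_commute)
    also have "\<dots> \<le> (\<Sum>k\<in>I. l \<sigma> k ^ (2*r) * ((\<Sum>b\<in>B1. c1 \<sigma> b * (inner_on I (g1 \<sigma> b) (e \<sigma> k))\<^sup>2)
          + (\<Sum>b\<in>B2. c2 \<sigma> b * (inner_on I (g2 \<sigma> b) (e \<sigma> k))\<^sup>2)))"
      by (intro sum_mono mult_left_mono quad[OF \<sigma>]) (simp add: power_mult)
    also have "\<dots> = ?L c1 g1 B1 / 2 + ?L c2 g2 B2 / 2"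
      by (simp add: distrib_left sum.distrib sum_divide_distrib sum_distrib_left[symmetric] mult.assoc
          del: sum_divide_distrib[symmetric])
    finally have 1: "real (2*r+1) / (4 * h) *
        (\<Sum>k\<in>I. l \<sigma> k ^ (2*r) * (\<Sum>a\<in>S. inner_on I (apply_on I (D \<sigma> a) (e \<sigma> k)) (apply_on I (D \<sigma> a) (e \<sigma> k))))
        \<le> ?L c1 g1 B1 / 2 + ?L c2 g2 B2 / 2" .
    have 2: "?L c1 g1 B1 \<le> real r / real (r+1) * ?T \<sigma> + ?R1 \<sigma> / real (r+1)"
      by (rule Bessel_AM_GM[OF I E[OF \<sigma>]]) (use c bes \<sigma> in auto)
    have 3: "?L c2 g2 B2 \<le> real r / real (r+1) * ?T \<sigma> + ?R2 \<sigma> / real (r+1)"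
      by (rule Bessel_AM_GM[OF I E[OF \<sigma>]]) (use c bes \<sigma> in auto)
    have 4: "1 / n * ((x + y) / 2) = (x / n + y / n) / 2" for x y n :: real
      by (simp add: add_divide_distrib)
    have 5: "A \<le> x / 2 + y / 2 \<Longrightarrow> x \<le> t + p \<Longrightarrow> y \<le> t + q \<Longrightarrow> A \<le> t + (p + q) / 2"
      for A x y t p q :: real by argo
    show ?thesis unfolding 4 by (rule 5[OF 1 2 3])
  qed
  have "sign_avg S ?T \<le> real (2*r+1) / (4 * h) *
     sign_avg S (\<lambda>\<sigma>. \<Sum>k\<in>I. l \<sigma> k ^ (2*r) * (\<Sum>a\<in>S. inner_on I (apply_on I (D \<sigma> a) (e \<sigma> k)) (apply_on I (D \<sigma> a) (e \<sigma> k))))"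
    unfolding D_def by (rule Khintchine_step[OF I sym E h hom[unfolded D_def]])
  also have "\<dots> \<le> sign_avg S (\<lambda>\<sigma>. real r / real (r+1) * ?T \<sigma> + 1 / real (r+1) * ((?R1 \<sigma> + ?R2 \<sigma>) / 2))"
    unfolding sign_avg_cmult[symmetric] by (rule sign_avg_mono) (rule pt)
  also have "\<dots> = real r / real (r+1) * sign_avg S ?T + sign_avg S (\<lambda>\<sigma>. ?R1 \<sigma> + ?R2 \<sigma>) / 2 / real (r+1)"
    unfolding sign_avg_add sign_avg_cmult by (simp add: sign_avg_def add_divide_distrib sum_divide_distrib sum.distrib)
  finally have le: "sign_avg S ?T \<le> real r / real (r+1) * sign_avg S ?T + sign_avg S (\<lambda>\<sigma>. ?R1 \<sigma> + ?R2 \<sigma>) / 2 / real (r+1)" .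
  \<comment> \<open>The quantity to be bounded occurs on both sides, with coefficient
    \<open>r / (r + 1)\<close> on the right; solving for it leaves exactly \<open>R\<close>.\<close>
  define T R n where "T = sign_avg S ?T" and "R = sign_avg S (\<lambda>\<sigma>. ?R1 \<sigma> + ?R2 \<sigma>) / 2" and "n = real r"
  have "T \<le> n / (n+1) * T + R / (n+1)" using le by (simp add: T_def R_def n_def algebra_simps)
  hence "T * (n+1) \<le> (n / (n+1) * T + R / (n+1)) * (n+1)"
    by (rule mult_right_mono) (simp add: n_def)
  also have "\<dots> = n * T + R"
    using n_def by (simp add: distrib_right)
  finally have "T \<le> R" by (simp add: algebra_simps)
  thus ?thesis by (simp add: T_def R_def)
qed

subsection \<open>Rademacher sums of rectangular matrices\<close>

text \<open>The Hermitian dilation with off-diagonal blocks \<open>N\<close> and its transpose. It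
  makes a rectangular matrix symmetric, and its square is block diagonal with the two Gram matrices
  of \<open>N\<close>.\<close>

definition dilation :: "('j \<Rightarrow> 'i \<Rightarrow> real) \<Rightarrow> 'i + 'j \<Rightarrow> 'i + 'j \<Rightarrow> real" where
  "dilation N z w = (case z of
     Inl x \<Rightarrow> (case w of Inl _ \<Rightarrow> 0 | Inr y \<Rightarrow> N y x)
   | Inr y \<Rightarrow> (case w of Inl x \<Rightarrow> N y x | Inr _ \<Rightarrow> 0))"

lemma dilation_simps [simp]:
  "dilation N (Inl x) (Inl x') = 0" "dilation N (Inr y) (Inr y') = 0"
  "dilation N (Inl x) (Inr y) = N y x" "dilation N (Inr y) (Inl x) = N y x"
  by (simp_all add: dilation_def)

lemma symm_dilation: "symm_on K (dilation N)"
  by (auto simp: symm_on_def dilation_def split: sum.splits)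

lemma inner_on_Plus:
  assumes "finite I" "finite J"
  shows "inner_on (I <+> J) v w = inner_on I (\<lambda>x. v (Inl x)) (\<lambda>x. w (Inl x)) + inner_on J (\<lambda>y. v (Inr y)) (\<lambda>y. w (Inr y))"
  unfolding inner_on_def by (subst sum.Plus[OF assms]) simp

lemma apply_on_dilation:
  assumes "finite I" "finite J"
  shows "apply_on (I <+> J) (dilation N) v =
    case_sum (\<lambda>x. \<Sum>y\<in>J. N y x * v (Inr y)) (\<lambda>y. \<Sum>x\<in>I. N y x * v (Inl x))"
  by (rule ext, simp add: apply_on_def sum.Plus[OF assms] split: sum.split)

text \<open>The \<open>f\<^sub>a\<close> live on disjoint blocks of coordinates. Within a block, the sum of the rank-one
  operators \<open>\<bar>u\<^sub>a\<bar>\<^sup>2 f\<^sub>a f\<^sub>a\<^sup>T\<close> is bounded by its trace \<open>t\<close>.\<close>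

lemma rectangular_Khintchine:
  fixes u :: "'s \<Rightarrow> 'i \<Rightarrow> real" and f :: "'s \<Rightarrow> 'j \<Rightarrow> real"
    and \<rho> :: "'s \<Rightarrow> 'r" and \<pi> :: "'j \<Rightarrow> 'r"
  assumes S: "finite S" and I: "finite I" and J: "finite J" and R: "finite R" "\<rho> ` S \<subseteq> R"
    and fam: "\<And>v. (\<Sum>a\<in>S. inner_on J (f a) (f a) * (inner_on I (u a) v)\<^sup>2) \<le> (\<Sum>b\<in>B. c b * (inner_on I (g b) v)\<^sup>2)"
    and c: "\<And>b. b \<in> B \<Longrightarrow> c b \<ge> 0"
    and bes: "\<And>v. (\<Sum>b\<in>B. (inner_on I (g b) v)\<^sup>2) \<le> inner_on I v v"
    and supp: "\<And>a y. a \<in> S \<Longrightarrow> y \<in> J \<Longrightarrow> \<pi> y \<noteq> \<rho> a \<Longrightarrow> f a y = 0"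
  defines "N \<equiv> \<lambda>\<sigma> y x. \<Sum>a\<in>S. \<sigma> a * f a y * u a x"
    and "t \<equiv> \<lambda>\<rho>0. \<Sum>a\<in>{a\<in>S. \<rho> a = \<rho>0}. inner_on I (u a) (u a) * inner_on J (f a) (f a)"
  shows "sign_avg S (\<lambda>\<sigma>. tr_pow (I <+> J) (dilation (N \<sigma>)) (2 * (r + 1)))
     \<le> (2 * real (2*r+1)) ^ (r+1) * ((\<Sum>b\<in>B. c b ^ (r+1) * inner_on I (g b) (g b)) + (\<Sum>\<rho>0\<in>R. t \<rho>0 ^ (r+1))) / 2"
proof -
  let ?K = "I <+> J" and ?Z = "\<lambda>\<sigma>. dilation (N \<sigma>)" and ?k = "real (2*r+1)"
  define U where "U = (\<lambda>a. inner_on I (u a) (u a))"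
  define F where "F = (\<lambda>a. inner_on J (f a) (f a))"
  have UF: "U a \<ge> 0" "F a \<ge> 0" for a by (simp_all add: U_def F_def)
  have t0: "t \<rho>0 \<ge> 0" for \<rho>0 unfolding t_def by (intro sum_nonneg mult_nonneg_nonneg) auto
  have t_le: "U a * F a \<le> t (\<rho> a)" if "a \<in> S" for a
    unfolding t_def U_def F_def by (rule member_le_sum) (use that S in auto)
  define g1 where "g1 = (\<lambda>b. case_sum (g b) (\<lambda>_::'j. 0))"
  \<comment> \<open>The scaling divides by the trace \<open>t\<close> of the block of
    \<open>a\<close>, so that the family is Bessel within each block and hence on the disjoint union
    of the blocks.\<close>
  define g2 where "g2 = (\<lambda>a. case_sum (\<lambda>_::'i. 0) (\<lambda>y. sqrt (U a / t (\<rho> a)) * f a y))"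
  have ipg1: "inner_on ?K (g1 b) v = inner_on I (g b) (\<lambda>x. v (Inl x))" for b v
    by (simp add: inner_on_Plus[OF I J] g1_def) (simp add: inner_on_def)
  have ipg2: "(inner_on ?K (g2 a) v)\<^sup>2 = U a / t (\<rho> a) * (inner_on J (f a) (\<lambda>y. v (Inr y)))\<^sup>2" for a v
  proof -
    have "inner_on ?K (g2 a) v = sqrt (U a / t (\<rho> a)) * inner_on J (f a) (\<lambda>y. v (Inr y))"
      by (simp add: inner_on_Plus[OF I J] g2_def inner_on_scale_left) (simp add: inner_on_def)
    thus ?thesis using UF t0 by (simp add: power_mult_distrib)
  qed
  have D: "?Z \<sigma> z w - ?Z (flip a \<sigma>) z w = 2 * \<sigma> a * dilation (\<lambda>y x. f a y * u a x) z w"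
    if a: "a \<in> S" for \<sigma> a z w
  proof -
    have "N \<sigma> y x - N (flip a \<sigma>) y x = 2 * \<sigma> a * (f a y * u a x)" for y x
    proof -
      have "N \<sigma> y x - N (flip a \<sigma>) y x = (\<Sum>a'\<in>S. if a' = a then 2 * \<sigma> a * (f a y * u a x) else 0)"
        unfolding N_def sum_subtractf[symmetric] by (intro sum.cong refl) (auto simp: flip_def)
      thus ?thesis using a S by simp
    qed
    thus ?thesis by (auto simp: dilation_def split: sum.split)
  qed
  \<comment> \<open>Up to the factor \<open>2 * \<sigma> a\<close>, the increment is the dilation of
    a rank-one matrix. It sends the \<open>u a\<close> component of \<open>v\<close> to
    \<open>f a\<close> and vice versa, so the two halves contribute separately.\<close>
  have nD: "inner_on ?K (apply_on ?K (\<lambda>z w. ?Z \<sigma> z w - ?Z (flip a \<sigma>) z w) v)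
                  (apply_on ?K (\<lambda>z w. ?Z \<sigma> z w - ?Z (flip a \<sigma>) z w) v)
      = 4 * (F a * (inner_on I (u a) (\<lambda>x. v (Inl x)))\<^sup>2 + U a * (inner_on J (f a) (\<lambda>y. v (Inr y)))\<^sup>2)"
    if a: "a \<in> S" and \<sigma>: "\<sigma> \<in> signs S" for a \<sigma> v
  proof -
    let ?p = "inner_on I (u a) (\<lambda>x. v (Inl x))" and ?q = "inner_on J (f a) (\<lambda>y. v (Inr y))"
    have A1: "apply_on ?K (\<lambda>z w. ?Z \<sigma> z w - ?Z (flip a \<sigma>) z w) v
        = (\<lambda>z. 2 * \<sigma> a * apply_on ?K (dilation (\<lambda>y x. f a y * u a x)) v z)"
      unfolding apply_on_def D[OF a] by (simp add: sum_distrib_left mult.assoc)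
    have A2: "apply_on ?K (dilation (\<lambda>y x. f a y * u a x)) v = case_sum (\<lambda>x. ?q * u a x) (\<lambda>y. ?p * f a y)"
      unfolding apply_on_dilation[OF I J] by (simp add: inner_on_def sum_distrib_left sum_distrib_right mult_ac)
    have "inner_on ?K (apply_on ?K (\<lambda>z w. ?Z \<sigma> z w - ?Z (flip a \<sigma>) z w) v)
                  (apply_on ?K (\<lambda>z w. ?Z \<sigma> z w - ?Z (flip a \<sigma>) z w) v)
        = 4 * (\<sigma> a * \<sigma> a) * (?q\<^sup>2 * U a + ?p\<^sup>2 * F a)"
      unfolding A1 A2 inner_on_scale_left inner_on_scale_right inner_on_Plus[OF I J] sum.case U_def F_def
      by (simp add: power2_eq_square algebra_simps)
    thus ?thesis by (simp add: signs_square[OF \<sigma> a] algebra_simps)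
  qed
  \<comment> \<open>Division by 0 yields 0, so a block of trace 0 needs separate care: there the
    left-hand side vanishes by Cauchy-Schwarz.\<close>
  have fam2: "U a * (inner_on J (f a) v)\<^sup>2 = t (\<rho> a) * (U a / t (\<rho> a) * (inner_on J (f a) v)\<^sup>2)" if a: "a \<in> S" for a v
  proof (cases "t (\<rho> a) = 0")
    case True
    have "U a * (inner_on J (f a) v)\<^sup>2 \<le> U a * (F a * inner_on J v v)"
      unfolding F_def by (intro mult_left_mono inner_on_Cauchy_Schwarz UF)
    also have "\<dots> = U a * F a * inner_on J v v" by simp
    also have "U a * F a = 0" using t_le[OF a] UF[of a] True by (metis mult_nonneg_nonneg order_antisym)
    finally have "U a * (inner_on J (f a) v)\<^sup>2 \<le> 0" by simp
    moreover have "0 \<le> U a * (inner_on J (f a) v)\<^sup>2" by (intro mult_nonneg_nonneg UF) simp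
    ultimately have "U a * (inner_on J (f a) v)\<^sup>2 = 0" by linarith
    thus ?thesis using True by simp
  qed simp
  have bes2: "(\<Sum>a\<in>S. (inner_on ?K (g2 a) v)\<^sup>2) \<le> inner_on ?K v v" for v
  proof -
    define w where "w = (\<lambda>y. v (Inr y))"
    define nr where "nr = (\<lambda>\<rho>0. \<Sum>y\<in>{y\<in>J. \<pi> y = \<rho>0}. w y * w y)"
    have nr0: "nr \<rho>0 \<ge> 0" for \<rho>0 unfolding nr_def by (intro sum_nonneg) auto
    have loc: "(inner_on J (f a) w)\<^sup>2 \<le> F a * nr (\<rho> a)" if a: "a \<in> S" for a
    proof -
      have "inner_on J (f a) w = inner_on J (f a) (\<lambda>y. if \<pi> y = \<rho> a then w y else 0)"
        unfolding inner_on_def by (intro sum.cong refl) (use supp a in auto)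
      hence "(inner_on J (f a) w)\<^sup>2 \<le> F a * inner_on J (\<lambda>y. if \<pi> y = \<rho> a then w y else 0) (\<lambda>y. if \<pi> y = \<rho> a then w y else 0)"
        unfolding F_def by (simp only: inner_on_Cauchy_Schwarz)
      also have "inner_on J (\<lambda>y. if \<pi> y = \<rho> a then w y else 0) (\<lambda>y. if \<pi> y = \<rho> a then w y else 0) = nr (\<rho> a)"
        unfolding inner_on_def nr_def by (subst sum.inter_filter[OF J]) (auto intro!: sum.cong)
      finally show ?thesis .
    qed
    have "(\<Sum>a\<in>S. (inner_on ?K (g2 a) v)\<^sup>2) \<le> (\<Sum>a\<in>S. U a / t (\<rho> a) * (F a * nr (\<rho> a)))"
      unfolding ipg2 w_def[symmetric] by (intro sum_mono mult_left_mono loc) (auto intro!: divide_nonneg_nonneg UF t0)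
    also have "\<dots> = (\<Sum>\<rho>0\<in>R. \<Sum>a\<in>{a\<in>S. \<rho> a = \<rho>0}. U a / t (\<rho> a) * (F a * nr (\<rho> a)))"
      by (rule sum.group[symmetric, OF S R])
    also have "\<dots> = (\<Sum>\<rho>0\<in>R. t \<rho>0 / t \<rho>0 * nr \<rho>0)"
      unfolding t_def U_def F_def sum_divide_distrib sum_distrib_right
      by (intro sum.cong refl) auto
    \<comment> \<open>The quotient of \<open>t \<rho>0\<close> by itself is 1, or 0 for a block of
      trace 0.\<close>
    also have "\<dots> \<le> (\<Sum>\<rho>0\<in>R. nr \<rho>0)"
      by (intro sum_mono) (use nr0 in \<open>auto simp: divide_self_if\<close>)
    also have "\<dots> \<le> (\<Sum>\<rho>0\<in>R \<union> \<pi> ` J. nr \<rho>0)"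
      by (intro sum_mono2) (use R J nr0 in auto)
    also have "\<dots> = inner_on J w w"
      unfolding nr_def inner_on_def by (rule sum.group) (use R J in auto)
    also have "\<dots> \<le> inner_on ?K v v" by (simp add: inner_on_Plus[OF I J] w_def)
    finally show ?thesis .
  qed
  have pm: "(2 * (?k * x)) ^ (r+1) = (2 * ?k) ^ (r+1) * x ^ (r+1)" for x
    by (simp only: mult.assoc[symmetric] power_mult_distrib)
  have bes1: "(\<Sum>b\<in>B. (inner_on ?K (g1 b) v)\<^sup>2) \<le> inner_on ?K v v" for v
    unfolding ipg1 by (rule order_trans[OF bes]) (simp add: inner_on_Plus[OF I J])
  have "sign_avg S (\<lambda>\<sigma>. tr_pow ?K (?Z \<sigma>) (2 * (r + 1)))
      \<le> sign_avg S (\<lambda>\<sigma>. (\<Sum>b\<in>B. (2 * (?k * c b)) ^ (r+1) * inner_on ?K (g1 b) (g1 b))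
                + (\<Sum>a\<in>S. (2 * (?k * t (\<rho> a))) ^ (r+1) * inner_on ?K (g2 a) (g2 a))) / 2"
  proof (rule Bessel_Khintchine[where h = 1])
    fix \<sigma> :: "'s \<Rightarrow> real" and z w
    assume "\<sigma> \<in> signs S"
    have "(\<Sum>a\<in>S. ?Z \<sigma> z w - ?Z (flip a \<sigma>) z w) = (\<Sum>a\<in>S. 2 * \<sigma> a * dilation (\<lambda>y x. f a y * u a x) z w)"
      by (intro sum.cong refl D)
    also have "\<dots> = 2 * 1 * ?Z \<sigma> z w"
      by (auto simp: dilation_def N_def sum_distrib_left mult_ac split: sum.split)
    finally show "(\<Sum>a\<in>S. ?Z \<sigma> z w - ?Z (flip a \<sigma>) z w) = 2 * 1 * ?Z \<sigma> z w" .
  next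
    fix \<sigma> :: "'s \<Rightarrow> real" and v :: "'i + 'j \<Rightarrow> real"
    assume \<sigma>: "\<sigma> \<in> signs S"
    let ?v = "\<lambda>x. v (Inl x)" and ?w = "\<lambda>y. v (Inr y)"
    have "?k / (4 * 1) * (\<Sum>a\<in>S. inner_on ?K (apply_on ?K (\<lambda>z w. ?Z \<sigma> z w - ?Z (flip a \<sigma>) z w) v)
                  (apply_on ?K (\<lambda>z w. ?Z \<sigma> z w - ?Z (flip a \<sigma>) z w) v))
       = ?k * ((\<Sum>a\<in>S. F a * (inner_on I (u a) ?v)\<^sup>2) + (\<Sum>a\<in>S. U a * (inner_on J (f a) ?w)\<^sup>2))"
      by (simp only: nD[OF _ \<sigma>] sum_distrib_left[symmetric] sum.distrib cong: sum.cong)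
    also have "\<dots> \<le> ?k * ((\<Sum>b\<in>B. c b * (inner_on I (g b) ?v)\<^sup>2)
        + (\<Sum>a\<in>S. t (\<rho> a) * (U a / t (\<rho> a) * (inner_on J (f a) ?w)\<^sup>2)))"
      using fam[of ?v] fam2 unfolding F_def by (intro mult_left_mono add_mono) auto
    finally show "?k / (4 * 1) * (\<Sum>a\<in>S. inner_on ?K (apply_on ?K (\<lambda>z w. ?Z \<sigma> z w - ?Z (flip a \<sigma>) z w) v)
                  (apply_on ?K (\<lambda>z w. ?Z \<sigma> z w - ?Z (flip a \<sigma>) z w) v))
       \<le> (\<Sum>b\<in>B. (?k * c b) * (inner_on ?K (g1 b) v)\<^sup>2) + (\<Sum>a\<in>S. (?k * t (\<rho> a)) * (inner_on ?K (g2 a) v)\<^sup>2)"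
      unfolding ipg1 ipg2 by (simp only: distrib_left sum_distrib_left mult.assoc)
  qed (use I J c t0 bes1 bes2 in \<open>auto simp: symm_dilation\<close>)
  also have "\<dots> = ((\<Sum>b\<in>B. (2 * (?k * c b)) ^ (r+1) * inner_on ?K (g1 b) (g1 b))
                + (\<Sum>a\<in>S. (2 * (?k * t (\<rho> a))) ^ (r+1) * inner_on ?K (g2 a) (g2 a))) / 2"
    by (simp add: sign_avg_const S)
  also have "(\<Sum>b\<in>B. (2 * (?k * c b)) ^ (r+1) * inner_on ?K (g1 b) (g1 b))
      = (2 * ?k) ^ (r+1) * (\<Sum>b\<in>B. c b ^ (r+1) * inner_on I (g b) (g b))"
    unfolding ipg1 pm by (simp only: g1_def sum.case sum_distrib_left mult.assoc)
  also have "(\<Sum>a\<in>S. (2 * (?k * t (\<rho> a))) ^ (r+1) * inner_on ?K (g2 a) (g2 a))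
      = (2 * ?k) ^ (r+1) * (\<Sum>a\<in>S. t (\<rho> a) ^ (r+1) * (U a / t (\<rho> a) * F a))"
  proof -
    have "inner_on ?K (g2 a) (g2 a) = U a / t (\<rho> a) * F a" for a
      using UF t0 by (simp add: inner_on_Plus[OF I J] g2_def inner_on_scale_left inner_on_scale_right F_def
          mult.assoc[symmetric]) (simp add: inner_on_def)
    thus ?thesis unfolding pm by (simp only: sum_distrib_left mult.assoc)
  qed
  also have "(\<Sum>a\<in>S. t (\<rho> a) ^ (r+1) * (U a / t (\<rho> a) * F a))
      = (\<Sum>\<rho>0\<in>R. \<Sum>a\<in>{a\<in>S. \<rho> a = \<rho>0}. t (\<rho> a) ^ (r+1) * (U a / t (\<rho> a) * F a))"
    by (rule sum.group[symmetric, OF S R])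
  \<comment> \<open>Within a block the products \<open>U a * F a\<close> add up to
    \<open>t \<rho>0\<close>, cancelling the normalisation of \<open>g2\<close>. The size of the
    block does not enter.\<close>
  also have "\<dots> = (\<Sum>\<rho>0\<in>R. t \<rho>0 ^ (r+1))"
  proof (rule sum.cong[OF refl])
    fix \<rho>0
    have "(\<Sum>a\<in>{a\<in>S. \<rho> a = \<rho>0}. t (\<rho> a) ^ (r+1) * (U a / t (\<rho> a) * F a))
        = (\<Sum>a\<in>{a\<in>S. \<rho> a = \<rho>0}. t \<rho>0 ^ (r+1) / t \<rho>0 * (U a * F a))"
      by (intro sum.cong refl) auto
    also have "\<dots> = t \<rho>0 ^ (r+1) / t \<rho>0 * t \<rho>0"
      unfolding sum_distrib_left[symmetric] by (simp add: t_def U_def F_def)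
    also have "\<dots> = t \<rho>0 ^ (r+1)" by simp
    finally show "(\<Sum>a\<in>{a\<in>S. \<rho> a = \<rho>0}. t (\<rho> a) ^ (r+1) * (U a / t (\<rho> a) * F a)) = t \<rho>0 ^ (r+1)" .
  qed
  finally show ?thesis by (simp only: distrib_left)
qed

text \<open>For a single column \<open>x\<close>, the squared norm of \<open>x\<close> is an eigenvalue of the squared dilation.\<close>

lemma power_norm_le_tr_pow_dilation:
  fixes x :: "'j \<Rightarrow> real"
  assumes J: "finite J"
  shows "inner_on J x x ^ q \<le> tr_pow ({()} <+> J) (dilation (\<lambda>y _. x y)) (2 * q)"
proof -
  let ?K = "{()} <+> J" and ?H = "dilation (\<lambda>y (_::unit). x y)" and ?z = "Inl () :: unit + 'j"
  have K: "finite ?K" using J by simp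
  have z: "?z \<in> ?K" by auto
  obtain e l where E: "eigensystem ?K ?H e l"
    by (rule spectral_theorem[OF K symm_dilation])
  define d where "d = (\<lambda>w. of_bool (w = ?z) :: real)"
  \<comment> \<open>The dilation maps the single left coordinate to \<open>x\<close> and
    \<open>x\<close> back to its squared norm times that coordinate.\<close>
  have HH: "apply_on ?K ?H (apply_on ?K ?H d) w = inner_on J x x * d w" for w
    by (cases w) (auto simp: apply_on_dilation[OF _ J] d_def inner_on_def)
  have ev: "(l k)\<^sup>2 * e k ?z = inner_on J x x * e k ?z" if k: "k \<in> ?K" for k
  proof -
    have s: "inner_on ?K (e k) (apply_on ?K ?H w) = l k * inner_on ?K (e k) w" for w
    proof -
      have "inner_on ?K (e k) (apply_on ?K ?H w) = inner_on ?K (apply_on ?K ?H (e k)) w" by (rule inner_on_apply_symm[OF symm_dilation])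
      also have "\<dots> = inner_on ?K (\<lambda>x. l k * e k x) w"
        by (rule inner_on_cong) (use eigensystem_eq[OF E k] in auto)
      finally show ?thesis by (simp add: inner_on_scale_left)
    qed
    have d: "inner_on ?K (e k) d = e k ?z"
      by (subst inner_on_commute) (simp only: d_def inner_on_indicator[OF K z])
    have "(l k)\<^sup>2 * e k ?z = inner_on ?K (e k) (apply_on ?K ?H (apply_on ?K ?H d))"
      by (simp add: s d power2_eq_square)
    also have "\<dots> = inner_on J x x * e k ?z" unfolding HH inner_on_scale_right d ..
    finally show ?thesis .
  qed
  \<comment> \<open>Every eigenvector that is nonzero at \<open>?z\<close> has eigenvalue squared
    equal to the squared norm of \<open>x\<close>. Completeness at \<open>?z\<close> makes the
    weights add up to 1.\<close>
  have "(\<Sum>k\<in>?K. l k ^ (2 * q) * (e k ?z * e k ?z)) = (\<Sum>k\<in>?K. inner_on J x x ^ q * (e k ?z * e k ?z))"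
  proof (rule sum.cong[OF refl])
    fix k assume "k \<in> ?K"
    hence "e k ?z = 0 \<or> (l k)\<^sup>2 = inner_on J x x" using ev by auto
    thus "l k ^ (2 * q) * (e k ?z * e k ?z) = inner_on J x x ^ q * (e k ?z * e k ?z)"
      by (auto simp: power_mult)
  qed
  also have "\<dots> = inner_on J x x ^ q"
    using E z unfolding sum_distrib_left[symmetric] eigensystem_def by auto
  finally have "inner_on J x x ^ q = (\<Sum>k\<in>?K. l k ^ (2 * q) * (e k ?z * e k ?z))" by simp
  also have "\<dots> \<le> (\<Sum>k\<in>?K. l k ^ (2 * q) * 1)"
  proof (intro sum_mono mult_left_mono)
    fix k assume k: "k \<in> ?K"
    have "e k ?z * e k ?z \<le> inner_on ?K (e k) (e k)"
      unfolding inner_on_def by (rule member_le_sum) (use z K in auto)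
    thus "e k ?z * e k ?z \<le> 1" using eigensystem_orthonormal[OF E k k] by simp
  qed (simp add: power_mult)
  also have "\<dots> = tr_pow ?K ?H (2 * q)" by (simp add: tr_pow_eigensystem[OF K E])
  finally show ?thesis .
qed

subsection \<open>The quadratic sign chaos\<close>

definition row_vec :: "('r \<times> 'c) set \<Rightarrow> ('c \<Rightarrow> 'i \<Rightarrow> real) \<Rightarrow> ('r \<times> 'c \<Rightarrow> real) \<Rightarrow> 'r \<Rightarrow> 'i \<Rightarrow> real" where
  "row_vec S u \<sigma> \<rho> x = (\<Sum>a\<in>{a\<in>S. fst a = \<rho>}. \<sigma> a * u (snd a) x)"

text \<open>With row vectors scaled by \<open>sqrt s\<close>, the first sum is the Gram matrix of
  the sketch times \<open>s\<close>. The second is its diagonal part, since signs square to 1.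
  Subtracting it in this form makes the expression homogeneous of degree 2 for every set of
  positions; for \<open>s\<close> entries per column it is \<open>s\<close> times the
  identity.\<close>

definition chaos :: "('r \<times> 'c) set \<Rightarrow> ('c \<Rightarrow> 'i \<Rightarrow> real) \<Rightarrow> real \<Rightarrow> ('r \<times> 'c \<Rightarrow> real) \<Rightarrow> 'i \<Rightarrow> 'i \<Rightarrow> real" where
  "chaos S u s \<sigma> x y = ((\<Sum>\<rho>\<in>fst ` S. row_vec S u \<sigma> \<rho> x * row_vec S u \<sigma> \<rho> y)
     - (\<Sum>a\<in>S. u (snd a) x * u (snd a) y)) / s"

definition collide :: "('r \<times> 'c) set \<Rightarrow> ('c \<Rightarrow> real) \<Rightarrow> 'r \<times> 'c \<Rightarrow> real" where
  "collide S b a = (\<Sum>c\<in>{c\<in>S. fst c = fst a \<and> c \<noteq> a}. b (snd c))"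

text \<open>The weight w of a column in the bound for the trace; \<open>row_collide\<close> is the
  corresponding Q of a row.\<close>

definition col_collide :: "('r \<times> 'c) set \<Rightarrow> ('c \<Rightarrow> real) \<Rightarrow> 'c \<Rightarrow> real" where
  "col_collide S b i = (\<Sum>a\<in>{a\<in>S. snd a = i}. collide S b a)"

definition row_collide :: "('r \<times> 'c) set \<Rightarrow> ('c \<Rightarrow> real) \<Rightarrow> 'r \<Rightarrow> real" where
  "row_collide S b \<rho> = (\<Sum>a\<in>{a\<in>S. fst a = \<rho>}. b (snd a) * collide S b a)"

lemma inner_on_add_self_le: "inner_on I (\<lambda>x. v x + w x) (\<lambda>x. v x + w x) \<le> 2 * inner_on I v v + 2 * inner_on I w w"
proof -
  have "0 \<le> inner_on I (\<lambda>x. v x - w x) (\<lambda>x. v x - w x)" by simp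
  thus ?thesis
    by (simp add: inner_on_add_left inner_on_add_right inner_on_diff_left inner_on_diff_right inner_on_commute[of I w v])
qed

lemma sum_collide:
  fixes h :: "'r \<times> 'c \<Rightarrow> real"
  assumes "finite S"
  shows "(\<Sum>y\<in>S. of_bool (fst c = fst y \<and> c \<noteq> y) * h y) = (\<Sum>y\<in>{y\<in>S. fst y = fst c \<and> y \<noteq> c}. h y)"
  by (subst sum.inter_filter[OF assms]) (auto intro!: sum.cong)

context
  fixes S :: "('r \<times> 'c) set" and C :: "'c set" and I :: "'i set" and u :: "'c \<Rightarrow> 'i \<Rightarrow> real"
    and b :: "'c \<Rightarrow> real"
  assumes S: "finite S" and I: "finite I" and C: "finite C" "snd ` S \<subseteq> C"
    and b: "\<And>i. b i = inner_on I (u i) (u i)"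
begin

text \<open>The part of the row of \<open>a\<close> that does not contain the sign of
  \<open>a\<close>. Together with the vector of the column of \<open>a\<close> it determines the
  increment of the chaos when that sign is flipped.\<close>

definition others :: "('r \<times> 'c \<Rightarrow> real) \<Rightarrow> 'r \<times> 'c \<Rightarrow> 'i \<Rightarrow> real" where
  "others \<sigma> a x = (\<Sum>c\<in>{c\<in>S. fst c = fst a \<and> c \<noteq> a}. \<sigma> c * u (snd c) x)"

lemma b_nonneg: "0 \<le> b i"
  by (simp add: b)

lemma collide_nonneg: "0 \<le> collide S b a"
  unfolding collide_def by (intro sum_nonneg b_nonneg)

lemma row_vec_others: "a \<in> S \<Longrightarrow> row_vec S u \<sigma> (fst a) x = others \<sigma> a x + \<sigma> a * u (snd a) x"
proof -
  assume a: "a \<in> S"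
  have "{c \<in> S. fst c = fst a} = insert a {c\<in>S. fst c = fst a \<and> c \<noteq> a}" using a by auto
  thus ?thesis unfolding row_vec_def others_def using S by simp
qed

lemma others_flip: "others (flip a \<sigma>) a = others \<sigma> a"
  unfolding others_def by (intro ext sum.cong) (auto simp: flip_def)

lemma chaos_flip:
  assumes a: "a \<in> S" and \<sigma>: "\<sigma> \<in> signs S"
  shows "chaos S u s \<sigma> x y - chaos S u s (flip a \<sigma>) x y =
     2 * \<sigma> a / s * (others \<sigma> a x * u (snd a) y + u (snd a) x * others \<sigma> a y)"
proof -
  let ?G = "\<lambda>\<sigma> \<rho>. row_vec S u \<sigma> \<rho> x * row_vec S u \<sigma> \<rho> y"
  have "?G \<sigma> \<rho> - ?G (flip a \<sigma>) \<rho> = (if \<rho> = fst a then 2 * \<sigma> a *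
      (others \<sigma> a x * u (snd a) y + u (snd a) x * others \<sigma> a y) else 0)" for \<rho>
  proof (cases "\<rho> = fst a")
    case True
    have "flip a \<sigma> a = - \<sigma> a" by (simp add: flip_def)
    thus ?thesis using True by (simp add: row_vec_others[OF a] others_flip algebra_simps)
  next
    case False
    hence "row_vec S u (flip a \<sigma>) \<rho> = row_vec S u \<sigma> \<rho>"
      unfolding row_vec_def by (intro ext sum.cong) (auto simp: flip_def)
    thus ?thesis using False by simp
  qed
  hence "(\<Sum>\<rho>\<in>fst ` S. ?G \<sigma> \<rho>) - (\<Sum>\<rho>\<in>fst ` S. ?G (flip a \<sigma>) \<rho>)
      = 2 * \<sigma> a * (others \<sigma> a x * u (snd a) y + u (snd a) x * others \<sigma> a y)"
    unfolding sum_subtractf[symmetric] using a S by simp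
  thus ?thesis unfolding chaos_def by (simp add: diff_divide_distrib[symmetric])
qed

text \<open>Euler's identity in degree 2. Replacing \<open>others\<close> by the full row minus its
  term at \<open>a\<close> makes the sum over the entries of a row reproduce the outer product of
  that row with itself. The corrections are free of signs and add up to the diagonal part.\<close>

lemma chaos_homogeneous:
  assumes \<sigma>: "\<sigma> \<in> signs S"
  shows "(\<Sum>a\<in>S. chaos S u s \<sigma> x y - chaos S u s (flip a \<sigma>) x y) = 2 * 2 * chaos S u s \<sigma> x y"
proof -
  have row: "(\<Sum>a\<in>S. \<sigma> a * u (snd a) y * row_vec S u \<sigma> (fst a) x)
      = (\<Sum>\<rho>\<in>fst ` S. row_vec S u \<sigma> \<rho> x * row_vec S u \<sigma> \<rho> y)" for x y
  proof -
    have "(\<Sum>a\<in>S. \<sigma> a * u (snd a) y * row_vec S u \<sigma> (fst a) x)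
      = (\<Sum>\<rho>\<in>fst ` S. \<Sum>a\<in>{a\<in>S. fst a = \<rho>}. \<sigma> a * u (snd a) y * row_vec S u \<sigma> (fst a) x)"
      by (rule sum.group[symmetric]) (use S in auto)
    also have "\<dots> = (\<Sum>\<rho>\<in>fst ` S. row_vec S u \<sigma> \<rho> x * (\<Sum>a\<in>{a\<in>S. fst a = \<rho>}. \<sigma> a * u (snd a) y))"
      unfolding sum_distrib_left by (intro sum.cong refl) auto
    finally show ?thesis by (simp add: row_vec_def)
  qed
  have "(\<Sum>a\<in>S. chaos S u s \<sigma> x y - chaos S u s (flip a \<sigma>) x y)
      = (\<Sum>a\<in>S. 2 / s * (\<sigma> a * u (snd a) y * row_vec S u \<sigma> (fst a) x
          + \<sigma> a * u (snd a) x * row_vec S u \<sigma> (fst a) y - 2 * (u (snd a) x * u (snd a) y)))"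
  proof (rule sum.cong[OF refl])
    fix a assume a: "a \<in> S"
    have *: "\<sigma> a * (\<sigma> a * z) = z" for z
      unfolding mult.assoc[symmetric] signs_square[OF \<sigma> a] by simp
    show "chaos S u s \<sigma> x y - chaos S u s (flip a \<sigma>) x y = 2 / s * (\<sigma> a * u (snd a) y * row_vec S u \<sigma> (fst a) x
          + \<sigma> a * u (snd a) x * row_vec S u \<sigma> (fst a) y - 2 * (u (snd a) x * u (snd a) y))"
      unfolding chaos_flip[OF a \<sigma>] row_vec_others[OF a]
      by (simp add: algebra_simps *)
  qed
  also have "\<dots> = 2 / s * ((\<Sum>\<rho>\<in>fst ` S. row_vec S u \<sigma> \<rho> x * row_vec S u \<sigma> \<rho> y)
      + (\<Sum>\<rho>\<in>fst ` S. row_vec S u \<sigma> \<rho> y * row_vec S u \<sigma> \<rho> x) - 2 * (\<Sum>a\<in>S. u (snd a) x * u (snd a) y))"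
    unfolding sum_distrib_left[symmetric] sum.distrib sum_subtractf row ..
  also have "\<dots> = 2 * 2 * chaos S u s \<sigma> x y"
    unfolding chaos_def by (simp add: mult.commute[of "row_vec S u \<sigma> _ y"])
  finally show ?thesis .
qed

text \<open>The increment has rank at most two and sends \<open>v\<close> to a combination of
  \<open>others\<close> and the column vector; the squared norm of a sum is at most twice the sum of
  the squared norms. The constant \<open>8 = 4 * 2\<close> is cancelled by \<open>4 * h\<close> with
  degree \<open>h = 2\<close>.\<close>

lemma chaos_flip_quad:
  fixes s :: real
  assumes a: "a \<in> S" and \<sigma>: "\<sigma> \<in> signs S"
  defines "D \<equiv> \<lambda>x y. chaos S u s \<sigma> x y - chaos S u s (flip a \<sigma>) x y"
  shows "inner_on I (apply_on I D v) (apply_on I D v) \<le> 8 / s\<^sup>2 *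
     (inner_on I (others \<sigma> a) (others \<sigma> a) * (inner_on I (u (snd a)) v)\<^sup>2 + b (snd a) * (inner_on I (others \<sigma> a) v)\<^sup>2)"
proof -
  let ?V = "others \<sigma> a" and ?u = "u (snd a)"
  let ?p = "inner_on I ?u v" and ?q = "inner_on I ?V v"
  have A: "apply_on I D v = (\<lambda>x. 2 * \<sigma> a / s * (?p * ?V x + ?q * ?u x))"
    unfolding apply_on_def D_def chaos_flip[OF a \<sigma>]
    by (rule ext) (simp add: inner_on_def sum_distrib_left sum_distrib_right sum.distrib algebra_simps)
  have "inner_on I (apply_on I D v) (apply_on I D v)
      = 4 * (\<sigma> a * \<sigma> a) / s\<^sup>2 * inner_on I (\<lambda>x. ?p * ?V x + ?q * ?u x) (\<lambda>x. ?p * ?V x + ?q * ?u x)"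
    unfolding A inner_on_scale_left inner_on_scale_right by (simp add: power2_eq_square)
  also have "\<dots> = 4 / s\<^sup>2 * inner_on I (\<lambda>x. ?p * ?V x + ?q * ?u x) (\<lambda>x. ?p * ?V x + ?q * ?u x)"
    unfolding signs_square[OF \<sigma> a] by simp
  also have "\<dots> \<le> 4 / s\<^sup>2 * (2 * inner_on I (\<lambda>x. ?p * ?V x) (\<lambda>x. ?p * ?V x) + 2 * inner_on I (\<lambda>x. ?q * ?u x) (\<lambda>x. ?q * ?u x))"
    by (intro mult_left_mono inner_on_add_self_le) simp
  also have "\<dots> = 8 / s\<^sup>2 * (inner_on I ?V ?V * ?p\<^sup>2 + b (snd a) * ?q\<^sup>2)"
    unfolding inner_on_scale_left inner_on_scale_right b by (simp add: power2_eq_square)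
  finally show ?thesis .
qed

text \<open>The squared length of the coupling of column \<open>i\<close> to the rest of the matrix is itself a
  quadratic chaos. It is the squared norm of a Rademacher sum of vectors.\<close>

lemma others_moment:
  "sign_avg S (\<lambda>\<sigma>. (\<Sum>a\<in>{a\<in>S. snd a = i}. inner_on I (others \<sigma> a) (others \<sigma> a)) ^ (r+1))
     \<le> (2 * real (2*r+1)) ^ (r+1) * col_collide S b i ^ (r+1)"
proof -
  let ?J = "S \<times> I"
  \<comment> \<open>All vectors \<open>others \<sigma> a\<close> with \<open>a\<close> in column
    \<open>i\<close> are stacked into one vector indexed by \<open>S \<times> I\<close>. It is
    linear in the signs, and \<open>f c\<close> is the coefficient of the sign of
    \<open>c\<close>.\<close>
  define f :: "'r \<times> 'c \<Rightarrow> ('r \<times> 'c) \<times> 'i \<Rightarrow> real"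
    where "f = (\<lambda>c (a, x). of_bool (snd a = i) * (of_bool (fst c = fst a \<and> c \<noteq> a) * u (snd c) x))"
  define X where "X = (\<lambda>\<sigma> y. \<Sum>c\<in>S. \<sigma> c * f c y * 1)"
  define W where "W = col_collide S b i"
  have J: "finite ?J" using S I by simp
  have X: "X \<sigma> (a, x) = of_bool (snd a = i) * others \<sigma> a x" for \<sigma> a x
  proof -
    have "X \<sigma> (a, x) = of_bool (snd a = i) * (\<Sum>c\<in>S. of_bool (fst a = fst c \<and> a \<noteq> c) * (\<sigma> c * u (snd c) x))"
      unfolding X_def f_def sum_distrib_left by (intro sum.cong refl) auto
    thus ?thesis unfolding sum_collide[OF S] others_def by simp
  qed
  have XX: "inner_on ?J (X \<sigma>) (X \<sigma>) = (\<Sum>a\<in>{a\<in>S. snd a = i}. inner_on I (others \<sigma> a) (others \<sigma> a))" for \<sigma>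
  proof -
    have "inner_on ?J (X \<sigma>) (X \<sigma>) = (\<Sum>a\<in>S. \<Sum>x\<in>I. X \<sigma> (a, x) * X \<sigma> (a, x))"
      unfolding inner_on_def sum.cartesian_product by (simp add: case_prod_unfold)
    also have "\<dots> = (\<Sum>a\<in>S. if snd a = i then inner_on I (others \<sigma> a) (others \<sigma> a) else 0)"
      unfolding X by (intro sum.cong refl) (auto simp: inner_on_def)
    finally show ?thesis by (simp add: sum.inter_filter[OF S])
  qed
  have W: "(\<Sum>c\<in>S. inner_on ?J (f c) (f c)) = W"
  proof -
    have "inner_on ?J (f c) (f c) = (\<Sum>a\<in>S. of_bool (snd a = i) * (of_bool (fst c = fst a \<and> c \<noteq> a) * b (snd c)))" for c
    proof -
      have "inner_on ?J (f c) (f c) = (\<Sum>a\<in>S. \<Sum>x\<in>I. f c (a, x) * f c (a, x))"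
        unfolding inner_on_def sum.cartesian_product by (simp add: case_prod_unfold)
      also have "\<dots> = (\<Sum>a\<in>S. of_bool (snd a = i) * (of_bool (fst c = fst a \<and> c \<noteq> a) * b (snd c)))"
        by (intro sum.cong refl) (auto simp: f_def b inner_on_def)
      finally show ?thesis .
    qed
    hence "(\<Sum>c\<in>S. inner_on ?J (f c) (f c))
        = (\<Sum>c\<in>S. \<Sum>a\<in>S. of_bool (snd a = i) * (of_bool (fst c = fst a \<and> c \<noteq> a) * b (snd c)))" by simp
    also have "\<dots> = (\<Sum>a\<in>S. \<Sum>c\<in>S. of_bool (snd a = i) * (of_bool (fst c = fst a \<and> c \<noteq> a) * b (snd c)))"
      by (rule sum.swap)
    also have "\<dots> = (\<Sum>a\<in>S. of_bool (snd a = i) * (\<Sum>c\<in>S. of_bool (fst a = fst c \<and> a \<noteq> c) * b (snd c)))"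
      unfolding sum_distrib_left by (intro sum.cong refl) auto
    also have "\<dots> = (\<Sum>a\<in>S. if snd a = i then collide S b a else 0)"
      unfolding sum_collide[OF S] collide_def by (intro sum.cong refl) auto
    finally show ?thesis by (simp add: sum.inter_filter[OF S] W_def col_collide_def)
  qed
  have "sign_avg S (\<lambda>\<sigma>. (\<Sum>a\<in>{a\<in>S. snd a = i}. inner_on I (others \<sigma> a) (others \<sigma> a)) ^ (r+1))
      \<le> sign_avg S (\<lambda>\<sigma>. tr_pow ({()} <+> ?J) (dilation (\<lambda>y _. X \<sigma> y)) (2 * (r+1)))"
    unfolding XX[symmetric] by (intro sign_avg_mono power_norm_le_tr_pow_dilation J)
  \<comment> \<open>A vector is a matrix with one column, and all coordinates form one block. The
    two terms on the right then coincide, which uses up the division by 2.\<close>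
  also have "\<dots> \<le> (2 * real (2*r+1)) ^ (r+1) * ((\<Sum>_\<in>{()}. W ^ (r+1) * inner_on {()} (\<lambda>_. 1) (\<lambda>_. 1))
      + (\<Sum>\<rho>0\<in>{()}. (\<Sum>a\<in>{a\<in>S. () = \<rho>0}. inner_on {()} (\<lambda>_. 1) (\<lambda>_. 1) * inner_on ?J (f a) (f a)) ^ (r+1))) / 2"
    unfolding X_def
  proof (rule rectangular_Khintchine[OF S _ J, where \<pi> = "\<lambda>_. ()"])
    show "(\<Sum>a\<in>S. inner_on ?J (f a) (f a) * (inner_on {()} (\<lambda>_. 1) v)\<^sup>2)
        \<le> (\<Sum>_\<in>{()}. W * (inner_on {()} (\<lambda>_. 1) v)\<^sup>2)" for v
      unfolding W[symmetric] by (simp add: sum_distrib_right)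
    show "W \<ge> 0" unfolding W_def col_collide_def by (intro sum_nonneg collide_nonneg)
  qed (auto simp: inner_on_def power2_eq_square)
  also have "\<dots> = (2 * real (2*r+1)) ^ (r+1) * W ^ (r+1)"
    using W by (simp add: inner_on_def[of "{()}"])
  finally show ?thesis by (simp add: W_def)
qed

text \<open>A square root of the second half of the increment bound: the form of its Gram matrix at
  \<open>v\<close> is the sum over \<open>y\<close> of \<open>b (snd y)\<close> times the squared
  inner product of \<open>others \<sigma> y\<close> with \<open>v\<close>. Unlike that form, it is
  linear in the signs, with rank-one coefficients.\<close>

definition coupling :: "('r \<times> 'c \<Rightarrow> real) \<Rightarrow> 'r \<times> 'c \<Rightarrow> 'i \<Rightarrow> real" where
  "coupling \<sigma> y x = (\<Sum>c\<in>S. \<sigma> c * (of_bool (fst c = fst y \<and> c \<noteq> y) * sqrt (b (snd y))) * u (snd c) x)"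

lemma coupling_others: "coupling \<sigma> y x = sqrt (b (snd y)) * others \<sigma> y x"
proof -
  have "coupling \<sigma> y x = sqrt (b (snd y)) * (\<Sum>c\<in>S. of_bool (fst y = fst c \<and> y \<noteq> c) * (\<sigma> c * u (snd c) x))"
    unfolding coupling_def sum_distrib_left by (intro sum.cong refl) auto
  thus ?thesis unfolding sum_collide[OF S] others_def by simp
qed

text \<open>The coefficient vector of a sign lives on the entries of its own row, so rows are the
  blocks. Grouping the other factor by columns yields the weights \<open>col_collide\<close>, and
  the block traces are the values \<open>row_collide\<close>.\<close>

lemma coupling_moment:
  assumes bes: "\<And>v. (\<Sum>i\<in>C. (inner_on I (u i) v)\<^sup>2) \<le> inner_on I v v"
  shows "sign_avg S (\<lambda>\<sigma>. tr_pow (I <+> S) (dilation (coupling \<sigma>)) (2 * (r+1)))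
     \<le> (2 * real (2*r+1)) ^ (r+1) * ((\<Sum>i\<in>C. col_collide S b i ^ (r+1) * b i)
          + (\<Sum>\<rho>\<in>fst ` S. row_collide S b \<rho> ^ (r+1))) / 2"
proof -
  define f :: "'r \<times> 'c \<Rightarrow> 'r \<times> 'c \<Rightarrow> real"
    where "f = (\<lambda>c y. of_bool (fst c = fst y \<and> c \<noteq> y) * sqrt (b (snd y)))"
  have ff: "inner_on S (f c) (f c) = collide S b c" for c
  proof -
    have "inner_on S (f c) (f c) = (\<Sum>y\<in>S. of_bool (fst c = fst y \<and> c \<noteq> y) * b (snd y))"
      unfolding inner_on_def f_def by (intro sum.cong refl) (auto simp: b_nonneg)
    thus ?thesis unfolding sum_collide[OF S] collide_def .
  qed
  have "sign_avg S (\<lambda>\<sigma>. tr_pow (I <+> S) (dilation (coupling \<sigma>)) (2 * (r+1)))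
     \<le> (2 * real (2*r+1)) ^ (r+1) * ((\<Sum>i\<in>C. col_collide S b i ^ (r+1) * inner_on I (u i) (u i))
          + (\<Sum>\<rho>\<in>fst ` S. (\<Sum>a\<in>{a\<in>S. fst a = \<rho>}. inner_on I (u (snd a)) (u (snd a)) * inner_on S (f a) (f a)) ^ (r+1))) / 2"
    unfolding coupling_def f_def[THEN fun_cong, THEN fun_cong, symmetric]
  proof (rule rectangular_Khintchine[OF S I S, where \<pi> = fst])
    show "(\<Sum>a\<in>S. inner_on S (f a) (f a) * (inner_on I (u (snd a)) v)\<^sup>2)
        \<le> (\<Sum>i\<in>C. col_collide S b i * (inner_on I (u i) v)\<^sup>2)" for v
    proof -
      have "(\<Sum>a\<in>S. inner_on S (f a) (f a) * (inner_on I (u (snd a)) v)\<^sup>2)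
          = (\<Sum>i\<in>C. \<Sum>a\<in>{a\<in>S. snd a = i}. collide S b a * (inner_on I (u (snd a)) v)\<^sup>2)"
        unfolding ff by (rule sum.group[symmetric, OF S C])
      also have "\<dots> = (\<Sum>i\<in>C. col_collide S b i * (inner_on I (u i) v)\<^sup>2)"
        unfolding col_collide_def sum_distrib_right by (intro sum.cong refl) auto
      finally show ?thesis by simp
    qed
    show "col_collide S b i \<ge> 0" for i
      unfolding col_collide_def by (intro sum_nonneg collide_nonneg)
  qed (use S bes in \<open>auto simp: f_def\<close>)
  thus ?thesis unfolding ff row_collide_def by (simp add: b)
qed

text \<open>The first half of the increment bound is diagonal in the vectors \<open>u i\<close>,
  which form a Bessel family. The second half is diagonalised by the eigenvectors of the dilated
  \<open>coupling\<close>: their restrictions to the first summand form a Bessel family with the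
  squared eigenvalues as weights. What is left of it is the trace of a power of that
  dilation.\<close>

lemma chaos_moment:
  fixes s :: real
  assumes bes: "\<And>v. (\<Sum>i\<in>C. (inner_on I (u i) v)\<^sup>2) \<le> inner_on I v v"
    and s: "s > 0"
  shows "sign_avg S (\<lambda>\<sigma>. tr_pow I (chaos S u s \<sigma>) (2 * (r+1)))
     \<le> (4 * (real (2*r+1))\<^sup>2 / s\<^sup>2) ^ (r+1) * ((\<Sum>i\<in>C. col_collide S b i ^ (r+1) * b i)
          + (\<Sum>\<rho>\<in>fst ` S. row_collide S b \<rho> ^ (r+1)))"
proof -
  let ?K = "I <+> S" and ?k = "real (2*r+1)"
  \<comment> \<open>The product of \<open>(2 * r + 1) / (4 * 2)\<close> from the flipping argument
    and \<open>8 / s\<^sup>2\<close> from the increment bound.\<close>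
  define \<kappa> where "\<kappa> = ?k / s\<^sup>2"
  have \<kappa>: "\<kappa> \<ge> 0" by (simp add: \<kappa>_def)
  have K: "finite ?K" using I S by simp
  define H where "H = (\<lambda>\<sigma>. dilation (coupling \<sigma>))"
  have "\<exists>e l. eigensystem ?K (H \<sigma>) e l" for \<sigma>
    unfolding H_def by (rule spectral_theorem[OF K symm_dilation]) blast
  then obtain \<phi> \<mu> where E: "\<And>\<sigma>. eigensystem ?K (H \<sigma>) (\<phi> \<sigma>) (\<mu> \<sigma>)" by metis
  define w where "w = (\<lambda>\<sigma> i. \<Sum>a\<in>{a\<in>S. snd a = i}. inner_on I (others \<sigma> a) (others \<sigma> a))"
  define g where "g = (\<lambda>\<sigma> k x. \<phi> \<sigma> k (Inl x))"
  define emb where "emb = (\<lambda>v. case_sum v (\<lambda>_. 0) :: 'i + 'r \<times> 'c \<Rightarrow> real)"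
  have w0: "w \<sigma> i \<ge> 0" for \<sigma> i unfolding w_def by (intro sum_nonneg) auto
  have gemb: "inner_on ?K (\<phi> \<sigma> k) (emb v) = inner_on I (g \<sigma> k) v" for \<sigma> k v
    by (simp add: inner_on_Plus[OF I S] emb_def g_def) (simp add: inner_on_def)
  have embemb: "inner_on ?K (emb v) (emb v) = inner_on I v v" for v
    by (simp add: inner_on_Plus[OF I S] emb_def) (simp add: inner_on_def)
  have second: "(\<Sum>a\<in>S. b (snd a) * (inner_on I (others \<sigma> a) v)\<^sup>2) = (\<Sum>k\<in>?K. (\<mu> \<sigma> k)\<^sup>2 * (inner_on I (g \<sigma> k) v)\<^sup>2)" for \<sigma> v
  proof -
    have 1: "apply_on ?K (H \<sigma>) (emb v) = case_sum (\<lambda>_. 0) (\<lambda>y. sqrt (b (snd y)) * inner_on I (others \<sigma> y) v)"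
    proof
      fix z
      have "(\<Sum>x\<in>I. coupling \<sigma> y x * v x) = sqrt (b (snd y)) * inner_on I (others \<sigma> y) v" for y
        unfolding coupling_others inner_on_def sum_distrib_left mult.assoc ..
      thus "apply_on ?K (H \<sigma>) (emb v) z = case_sum (\<lambda>_. 0) (\<lambda>y. sqrt (b (snd y)) * inner_on I (others \<sigma> y) v) z"
        unfolding H_def apply_on_dilation[OF I S] emb_def by (cases z) simp_all
    qed
    have sq: "(sqrt t * q) * (sqrt t * q) = t * q\<^sup>2" if "t \<ge> 0" for t q :: real
    proof -
      have "(sqrt t * q) * (sqrt t * q) = (sqrt t * sqrt t) * (q * q)" by (simp only: mult_ac)
      thus ?thesis using that by (simp add: power2_eq_square)
    qed
    have "(\<Sum>a\<in>S. b (snd a) * (inner_on I (others \<sigma> a) v)\<^sup>2) = inner_on ?K (apply_on ?K (H \<sigma>) (emb v)) (apply_on ?K (H \<sigma>) (emb v))"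
      unfolding 1 inner_on_Plus[OF I S] sum.case inner_on_def[of S] sq[OF b_nonneg]
      by (simp add: inner_on_def[of I "\<lambda>_. 0"])
    also have "\<dots> = (\<Sum>k\<in>?K. (inner_on ?K (\<phi> \<sigma> k) (apply_on ?K (H \<sigma>) (emb v)))\<^sup>2)"
      by (rule eigensystem_Parseval_square[OF K E, symmetric])
    also have "\<dots> = (\<Sum>k\<in>?K. (\<mu> \<sigma> k)\<^sup>2 * (inner_on I (g \<sigma> k) v)\<^sup>2)"
    proof (rule sum.cong[OF refl])
      fix k assume k: "k \<in> ?K"
      have "inner_on ?K (\<phi> \<sigma> k) (apply_on ?K (H \<sigma>) (emb v)) = inner_on ?K (apply_on ?K (H \<sigma>) (\<phi> \<sigma> k)) (emb v)"
        unfolding H_def by (rule inner_on_apply_symm[OF symm_dilation])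
      also have "\<dots> = inner_on ?K (\<lambda>z. \<mu> \<sigma> k * \<phi> \<sigma> k z) (emb v)"
        by (rule inner_on_cong) (use eigensystem_eq[OF E k] in auto)
      also have "\<dots> = \<mu> \<sigma> k * inner_on I (g \<sigma> k) v" by (simp add: inner_on_scale_left gemb)
      finally show "(inner_on ?K (\<phi> \<sigma> k) (apply_on ?K (H \<sigma>) (emb v)))\<^sup>2 = (\<mu> \<sigma> k)\<^sup>2 * (inner_on I (g \<sigma> k) v)\<^sup>2"
        by (simp add: power_mult_distrib)
    qed
    finally show ?thesis .
  qed
  have "sign_avg S (\<lambda>\<sigma>. tr_pow I (chaos S u s \<sigma>) (2 * (r+1)))
     \<le> sign_avg S (\<lambda>\<sigma>. (\<Sum>i\<in>C. (2 * (\<kappa> * w \<sigma> i)) ^ (r+1) * inner_on I (u i) (u i))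
              + (\<Sum>k\<in>?K. (2 * (\<kappa> * (\<mu> \<sigma> k)\<^sup>2)) ^ (r+1) * inner_on I (g \<sigma> k) (g \<sigma> k))) / 2"
  proof (rule Bessel_Khintchine[where h = 2])
    fix \<sigma> :: "'r \<times> 'c \<Rightarrow> real" and v :: "'i \<Rightarrow> real"
    assume \<sigma>: "\<sigma> \<in> signs S"
    let ?D = "\<lambda>a x y. chaos S u s \<sigma> x y - chaos S u s (flip a \<sigma>) x y"
    have "?k / (4 * 2) * (\<Sum>a\<in>S. inner_on I (apply_on I (?D a) v) (apply_on I (?D a) v))
       \<le> ?k / (4 * 2) * (\<Sum>a\<in>S. 8 / s\<^sup>2 *
     (inner_on I (others \<sigma> a) (others \<sigma> a) * (inner_on I (u (snd a)) v)\<^sup>2 + b (snd a) * (inner_on I (others \<sigma> a) v)\<^sup>2))"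
      by (intro mult_left_mono sum_mono chaos_flip_quad \<sigma>) auto
    also have "\<dots> = \<kappa> * ((\<Sum>a\<in>S. inner_on I (others \<sigma> a) (others \<sigma> a) * (inner_on I (u (snd a)) v)\<^sup>2)
        + (\<Sum>a\<in>S. b (snd a) * (inner_on I (others \<sigma> a) v)\<^sup>2))"
    proof -
      have e: "?k / (4 * 2) * (8 / s\<^sup>2 * X) = \<kappa> * X" for X by (simp add: \<kappa>_def)
      show ?thesis unfolding sum_distrib_left[symmetric] sum.distrib e ..
    qed
    also have "(\<Sum>a\<in>S. inner_on I (others \<sigma> a) (others \<sigma> a) * (inner_on I (u (snd a)) v)\<^sup>2)
        = (\<Sum>i\<in>C. \<Sum>a\<in>{a\<in>S. snd a = i}. inner_on I (others \<sigma> a) (others \<sigma> a) * (inner_on I (u (snd a)) v)\<^sup>2)"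
      by (rule sum.group[symmetric, OF S C])
    also have "\<dots> = (\<Sum>i\<in>C. w \<sigma> i * (inner_on I (u i) v)\<^sup>2)"
      unfolding w_def sum_distrib_right by (intro sum.cong refl) auto
    finally show "?k / (4 * 2) * (\<Sum>a\<in>S. inner_on I (apply_on I (?D a) v) (apply_on I (?D a) v))
       \<le> (\<Sum>i\<in>C. \<kappa> * w \<sigma> i * (inner_on I (u i) v)\<^sup>2) + (\<Sum>k\<in>?K. \<kappa> * (\<mu> \<sigma> k)\<^sup>2 * (inner_on I (g \<sigma> k) v)\<^sup>2)"
      unfolding second by (simp add: distrib_left sum_distrib_left mult.assoc)
    show "(\<Sum>k\<in>?K. (inner_on I (g \<sigma> k) v)\<^sup>2) \<le> inner_on I v v"
      using eigensystem_Parseval_square[OF K E[of \<sigma>], of "emb v"] by (simp add: gemb embemb)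
  next
    fix \<sigma> :: "'r \<times> 'c \<Rightarrow> real"
    show "symm_on I (chaos S u s \<sigma>)"
      by (simp add: symm_on_def chaos_def mult.commute)
  qed (use I bes \<kappa> w0 chaos_homogeneous in auto)
  also have "\<dots> \<le> sign_avg S (\<lambda>\<sigma>. (2 * \<kappa>) ^ (r+1) * ((\<Sum>i\<in>C. b i * w \<sigma> i ^ (r+1))
              + tr_pow ?K (H \<sigma>) (2 * (r+1)))) / 2"
  proof (intro divide_right_mono sign_avg_mono)
    fix \<sigma> :: "'r \<times> 'c \<Rightarrow> real"
    have "(\<Sum>k\<in>?K. (2 * (\<kappa> * (\<mu> \<sigma> k)\<^sup>2)) ^ (r+1) * inner_on I (g \<sigma> k) (g \<sigma> k))
        \<le> (\<Sum>k\<in>?K. (2 * (\<kappa> * (\<mu> \<sigma> k)\<^sup>2)) ^ (r+1) * 1)"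
    proof (intro sum_mono mult_left_mono)
      fix k assume k: "k \<in> ?K"
      have "inner_on I (g \<sigma> k) (g \<sigma> k) \<le> inner_on ?K (\<phi> \<sigma> k) (\<phi> \<sigma> k)"
        by (simp add: inner_on_Plus[OF I S] g_def)
      thus "inner_on I (g \<sigma> k) (g \<sigma> k) \<le> 1" using eigensystem_orthonormal[OF E k k] by simp
    qed (use \<kappa> in simp)
    also have "\<dots> = (2 * \<kappa>) ^ (r+1) * tr_pow ?K (H \<sigma>) (2 * (r+1))"
      unfolding tr_pow_eigensystem[OF K E] sum_distrib_left
      by (simp only: mult.assoc[symmetric] power_mult_distrib power_mult mult_1_right)
    finally have "(\<Sum>k\<in>?K. (2 * (\<kappa> * (\<mu> \<sigma> k)\<^sup>2)) ^ (r+1) * inner_on I (g \<sigma> k) (g \<sigma> k))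
        \<le> (2 * \<kappa>) ^ (r+1) * tr_pow ?K (H \<sigma>) (2 * (r+1))" .
    moreover have "(\<Sum>i\<in>C. (2 * (\<kappa> * w \<sigma> i)) ^ (r+1) * inner_on I (u i) (u i)) = (2 * \<kappa>) ^ (r+1) * (\<Sum>i\<in>C. b i * w \<sigma> i ^ (r+1))"
      unfolding sum_distrib_left b by (simp only: power_mult_distrib mult_ac)
    ultimately show "(\<Sum>i\<in>C. (2 * (\<kappa> * w \<sigma> i)) ^ (r+1) * inner_on I (u i) (u i))
              + (\<Sum>k\<in>?K. (2 * (\<kappa> * (\<mu> \<sigma> k)\<^sup>2)) ^ (r+1) * inner_on I (g \<sigma> k) (g \<sigma> k))
        \<le> (2 * \<kappa>) ^ (r+1) * ((\<Sum>i\<in>C. b i * w \<sigma> i ^ (r+1)) + tr_pow ?K (H \<sigma>) (2 * (r+1)))"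
      by (simp only: distrib_left)
  qed simp
  also have "\<dots> = (2 * \<kappa>) ^ (r+1) * ((\<Sum>i\<in>C. b i * sign_avg S (\<lambda>\<sigma>. w \<sigma> i ^ (r+1)))
              + sign_avg S (\<lambda>\<sigma>. tr_pow ?K (H \<sigma>) (2 * (r+1)))) / 2"
    unfolding sign_avg_cmult sign_avg_add sign_avg_sum ..
  also have "\<dots> \<le> (2 * \<kappa>) ^ (r+1) * ((\<Sum>i\<in>C. b i * ((2 * ?k) ^ (r+1) * col_collide S b i ^ (r+1)))
              + (2 * ?k) ^ (r+1) * ((\<Sum>i\<in>C. col_collide S b i ^ (r+1) * b i)
          + (\<Sum>\<rho>\<in>fst ` S. row_collide S b \<rho> ^ (r+1))) / 2) / 2"
    unfolding w_def H_def using \<kappa>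
    by (intro divide_right_mono mult_left_mono add_mono sum_mono others_moment coupling_moment bes b_nonneg) auto
  \<comment> \<open>The column term enters once directly, with weight 1/2, and once through the
    coupling, with weight 1/4; the row term enters only through the coupling. Both weights are then
    rounded up to 1.\<close>
  also have "\<dots> = (2 * \<kappa> * (2 * ?k)) ^ (r+1) * (3 / 4 * (\<Sum>i\<in>C. col_collide S b i ^ (r+1) * b i)
          + 1 / 4 * (\<Sum>\<rho>\<in>fst ` S. row_collide S b \<rho> ^ (r+1)))"
  proof -
    have "(\<Sum>i\<in>C. b i * ((2 * ?k) ^ (r+1) * col_collide S b i ^ (r+1)))
        = (2 * ?k) ^ (r+1) * (\<Sum>i\<in>C. col_collide S b i ^ (r+1) * b i)"
      unfolding sum_distrib_left by (simp only: mult_ac)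
    moreover have "A * (B * x + B * (x + y) / 2) / 2 = A * B * (3 / 4 * x + 1 / 4 * y)" for A B x y :: real
      by (simp add: field_simps)
    ultimately show ?thesis by (simp only: power_mult_distrib[of "2 * \<kappa>" "2 * ?k"])
  qed
  also have "\<dots> \<le> (2 * \<kappa> * (2 * ?k)) ^ (r+1) * ((\<Sum>i\<in>C. col_collide S b i ^ (r+1) * b i)
          + (\<Sum>\<rho>\<in>fst ` S. row_collide S b \<rho> ^ (r+1)))"
  proof (intro mult_left_mono)
    have "0 \<le> (\<Sum>i\<in>C. col_collide S b i ^ (r+1) * b i)"
      unfolding col_collide_def by (intro sum_nonneg mult_nonneg_nonneg zero_le_power collide_nonneg b_nonneg)
    moreover have "0 \<le> (\<Sum>\<rho>\<in>fst ` S. row_collide S b \<rho> ^ (r+1))"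
      unfolding row_collide_def by (intro sum_nonneg mult_nonneg_nonneg zero_le_power collide_nonneg b_nonneg)
    ultimately show "3 / 4 * (\<Sum>i\<in>C. col_collide S b i ^ (r+1) * b i)
          + 1 / 4 * (\<Sum>\<rho>\<in>fst ` S. row_collide S b \<rho> ^ (r+1))
        \<le> (\<Sum>i\<in>C. col_collide S b i ^ (r+1) * b i) + (\<Sum>\<rho>\<in>fst ` S. row_collide S b \<rho> ^ (r+1))"
      by linarith
  qed (use \<kappa> in simp)
  also have "2 * \<kappa> * (2 * ?k) = 4 * ?k\<^sup>2 / s\<^sup>2"
    by (simp add: \<kappa>_def power2_eq_square algebra_simps)
  finally show ?thesis .
qed

end

subsection \<open>Polynomials in random signs and indicators\<close>

text \<open>Polynomial functions of degree at most \<open>q\<close> with coefficients in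
  \<open>K\<close>, as sums of monomials. Monomials are lists, so variables may repeat and
  multiplication is concatenation. The set \<open>K\<close> is \<open>UNIV\<close> for the trace and
  \<open>{0..}\<close> for the collision bound, where the sign of the coefficients matters.\<close>

inductive polyfun :: "'a set \<Rightarrow> real set \<Rightarrow> nat \<Rightarrow> (('a \<Rightarrow> real) \<Rightarrow> real) \<Rightarrow> bool"
  for E :: "'a set" and K :: "real set" and q :: nat where
  monom: "c \<in> K \<Longrightarrow> set xs \<subseteq> E \<Longrightarrow> length xs \<le> q \<Longrightarrow> polyfun E K q (\<lambda>x. c * prod_list (map x xs))"
| add: "polyfun E K q f \<Longrightarrow> polyfun E K q g \<Longrightarrow> polyfun E K q (\<lambda>x. f x + g x)"

lemma polyfun_const: "c \<in> K \<Longrightarrow> polyfun E K q (\<lambda>x. c)"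
  using polyfun.monom[of c K "[]" E q] by simp

lemma polyfun_var: "1 \<in> K \<Longrightarrow> a \<in> E \<Longrightarrow> polyfun E K 1 (\<lambda>x. x a)"
  using polyfun.monom[of 1 K "[a]" E 1] by simp

lemma polyfun_mono: "polyfun E K q f \<Longrightarrow> q \<le> q' \<Longrightarrow> polyfun E K q' f"
  by (induction rule: polyfun.induct) (auto intro: polyfun.intros)

lemma polyfun_sum:
  assumes "0 \<in> K" "\<And>b. b \<in> B \<Longrightarrow> polyfun E K q (f b)"
  shows "polyfun E K q (\<lambda>x. \<Sum>b\<in>B. f b x)"
  using assms(2)
  by (induction B rule: infinite_finite_induct) (auto intro: polyfun.add polyfun_const assms(1))

lemma polyfun_monom_mult:
  assumes K: "\<And>c c'. c \<in> K \<Longrightarrow> c' \<in> K \<Longrightarrow> c * c' \<in> K"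
    and c: "c \<in> K" "set xs \<subseteq> E" "length xs \<le> q" and g: "polyfun E K q' g"
  shows "polyfun E K (q + q') (\<lambda>x. c * prod_list (map x xs) * g x)"
  using g
proof (induction rule: polyfun.induct)
  case (monom c' ys)
  have "polyfun E K (q + q') (\<lambda>x. (c * c') * prod_list (map x (xs @ ys)))"
    by (rule polyfun.monom) (use monom c K in auto)
  thus ?case by (simp add: mult_ac)
next
  case (add g h)
  from polyfun.add[OF add.IH] show ?case by (simp add: distrib_left)
qed

lemma polyfun_mult:
  assumes K: "\<And>c c'. c \<in> K \<Longrightarrow> c' \<in> K \<Longrightarrow> c * c' \<in> K"
    and "polyfun E K q f" "polyfun E K q' g"
  shows "polyfun E K (q + q') (\<lambda>x. f x * g x)"
  using assms(2)
proof (induction rule: polyfun.induct)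
  case (monom c xs)
  show ?case by (rule polyfun_monom_mult[OF K monom assms(3)])
next
  case (add f h)
  from polyfun.add[OF add.IH] show ?case by (simp add: distrib_right)
qed

lemma polyfun_power:
  assumes K: "\<And>c c'. c \<in> K \<Longrightarrow> c' \<in> K \<Longrightarrow> c * c' \<in> K" "1 \<in> K"
    and f: "polyfun E K q f"
  shows "polyfun E K (q * r) (\<lambda>x. f x ^ r)"
proof (induction r)
  case 0
  show ?case by (simp add: polyfun_const K)
next
  case (Suc r)
  show ?case using polyfun_mult[OF K(1) f Suc] by simp
qed

lemma polyfun_cmult:
  assumes K: "\<And>c c'. c \<in> K \<Longrightarrow> c' \<in> K \<Longrightarrow> c * c' \<in> K" and "c \<in> K" "polyfun E K q f"
  shows "polyfun E K q (\<lambda>x. c * f x)"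
  using polyfun_mult[OF K polyfun_const[OF assms(2), of E 0] assms(3)] by simp

lemma abs_prod_list_le_1:
  fixes x :: "'a \<Rightarrow> real"
  shows "(\<And>a. a \<in> set xs \<Longrightarrow> \<bar>x a\<bar> \<le> 1) \<Longrightarrow> \<bar>prod_list (map x xs)\<bar> \<le> 1"
proof (induction xs)
  case (Cons a xs)
  have "\<bar>x a\<bar> * \<bar>prod_list (map x xs)\<bar> \<le> 1 * 1"
    by (rule mult_mono) (use Cons in auto)
  thus ?case by (simp add: abs_mult)
qed simp

lemma integrable_monomial:
  fixes X :: "'b \<Rightarrow> 'a \<Rightarrow> real"
  assumes bd: "AE \<omega> in measure_pmf M. \<forall>a\<in>E. \<bar>X \<omega> a\<bar> \<le> 1" and xs: "set xs \<subseteq> E"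
  shows "integrable (measure_pmf M) (\<lambda>\<omega>. c * prod_list (map (X \<omega>) xs))"
proof (rule measure_pmf.integrable_const_bound[where B = "\<bar>c\<bar>"])
  show "AE \<omega> in measure_pmf M. norm (c * prod_list (map (X \<omega>) xs)) \<le> \<bar>c\<bar>"
    using bd
  proof eventually_elim
    case (elim \<omega>)
    have "\<bar>prod_list (map (X \<omega>) xs)\<bar> \<le> 1" by (rule abs_prod_list_le_1) (use elim xs in auto)
    thus ?case by (simp add: abs_mult mult_left_le)
  qed
qed simp

lemma integrable_polyfun:
  assumes bd: "AE \<omega> in measure_pmf M. \<forall>a\<in>E. \<bar>X \<omega> a\<bar> \<le> 1" and f: "polyfun E K q f"
  shows "integrable (measure_pmf M) (\<lambda>\<omega>. f (X \<omega>))"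
  using f
proof (induction rule: polyfun.induct)
  case (monom c xs)
  show ?case by (rule integrable_monomial[OF bd monom(2)])
qed auto

lemma polyfun_expectation_eq:
  assumes bd: "AE \<omega> in measure_pmf M. \<forall>a\<in>E. \<bar>X \<omega> a\<bar> \<le> 1"
    and eq: "\<And>xs. set xs \<subseteq> E \<Longrightarrow> length xs \<le> q \<Longrightarrow>
      measure_pmf.expectation M (\<lambda>\<omega>. prod_list (map (X \<omega>) xs)) = sign_avg E (\<lambda>\<sigma>. prod_list (map \<sigma> xs))"
    and f: "polyfun E K q f"
  shows "measure_pmf.expectation M (\<lambda>\<omega>. f (X \<omega>)) = sign_avg E f"
  using f
proof (induction rule: polyfun.induct)
  case (monom c xs)
  thus ?case using eq[of xs] by (simp add: sign_avg_cmult)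
next
  case (add f g)
  thus ?case by (simp add: sign_avg_add integrable_polyfun[OF bd])
qed

text \<open>Moment conditions are one-sided. Nonnegative coefficients are what lets an inequality
  between monomials pass to the whole polynomial.\<close>

lemma polyfun_expectation_mono:
  assumes bd: "AE \<omega> in measure_pmf M. \<forall>a\<in>E. \<bar>X \<omega> a\<bar> \<le> 1"
    and bd': "AE \<omega> in measure_pmf M'. \<forall>a\<in>E. \<bar>X' \<omega> a\<bar> \<le> 1"
    and le: "\<And>xs. set xs \<subseteq> E \<Longrightarrow> length xs \<le> q \<Longrightarrow>
      measure_pmf.expectation M (\<lambda>\<omega>. prod_list (map (X \<omega>) xs))
      \<le> measure_pmf.expectation M' (\<lambda>\<omega>. prod_list (map (X' \<omega>) xs))"
    and f: "polyfun E {0..} q f"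
  shows "measure_pmf.expectation M (\<lambda>\<omega>. f (X \<omega>)) \<le> measure_pmf.expectation M' (\<lambda>\<omega>. f (X' \<omega>))"
  using f
proof (induction rule: polyfun.induct)
  case (monom c xs)
  thus ?case using le[of xs] by (simp add: mult_left_mono)
next
  case (add f g)
  have "integrable (measure_pmf M) (\<lambda>\<omega>. f (X \<omega>))" "integrable (measure_pmf M) (\<lambda>\<omega>. g (X \<omega>))"
    "integrable (measure_pmf M') (\<lambda>\<omega>. f (X' \<omega>))" "integrable (measure_pmf M') (\<lambda>\<omega>. g (X' \<omega>))"
    using add.hyps bd bd' by (auto intro: integrable_polyfun)
  thus ?case using add.IH by simp
qed

subsection \<open>Signs of limited independence\<close>

lemma prod_list_map_count:
  fixes x :: "'a \<Rightarrow> real"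
  shows "prod_list (map x xs) = (\<Prod>a\<in>set xs. x a ^ count_list xs a)"
proof (induction xs)
  case (Cons y xs)
  show ?case
  proof (cases "y \<in> set xs")
    case True
    have "(\<Prod>a\<in>set xs. x a ^ count_list (y # xs) a) = (\<Prod>a\<in>set xs. (if a = y then x y else 1) * x a ^ count_list xs a)"
      by (intro prod.cong) auto
    also have "\<dots> = x y * (\<Prod>a\<in>set xs. x a ^ count_list xs a)"
      using True by (simp add: prod.distrib)
    finally show ?thesis using True Cons by (simp add: insert_absorb)
  next
    case False
    have "(\<Prod>a\<in>set xs. x a ^ count_list (y # xs) a) = (\<Prod>a\<in>set xs. x a ^ count_list xs a)"
      by (intro prod.cong) (use False in auto)
    thus ?thesis using False Cons by (simp add: count_list_0_iff)
  qed
qed simp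

text \<open>Since signs square to 1, a monomial depends only on the variables of odd multiplicity,
  each taken once.\<close>

definition odd_part :: "'a list \<Rightarrow> 'a set" where
  "odd_part xs = {a\<in>set xs. odd (count_list xs a)}"

lemma prod_list_signs:
  fixes x :: "'a \<Rightarrow> real"
  assumes "\<And>a. a \<in> set xs \<Longrightarrow> x a \<in> {-1, 1}"
  shows "prod_list (map x xs) = (\<Prod>a\<in>odd_part xs. x a)"
proof -
  have "x a ^ count_list xs a = (if odd (count_list xs a) then x a else 1)" if "a \<in> set xs" for a
    using assms[OF that] by (auto simp: uminus_power_if)
  hence "prod_list (map x xs) = (\<Prod>a\<in>set xs. if odd (count_list xs a) then x a else 1)"
    unfolding prod_list_map_count by (intro prod.cong refl)
  also have "\<dots> = (\<Prod>a\<in>odd_part xs. x a)"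
    unfolding odd_part_def by (rule prod.inter_filter[symmetric]) simp
  finally show ?thesis .
qed

text \<open>Flipping a sign of odd multiplicity negates the monomial without changing its
  average.\<close>

lemma sign_avg_monomial:
  assumes S: "finite S" and xs: "set xs \<subseteq> S"
  shows "sign_avg S (\<lambda>\<sigma>. prod_list (map \<sigma> xs)) = of_bool (odd_part xs = {})"
proof -
  have O: "odd_part xs \<subseteq> S" "finite (odd_part xs)" using xs by (auto simp: odd_part_def)
  have "sign_avg S (\<lambda>\<sigma>. prod_list (map \<sigma> xs)) = sign_avg S (\<lambda>\<sigma>. \<Prod>a\<in>odd_part xs. \<sigma> a)"
    by (intro sign_avg_cong prod_list_signs) (use xs in \<open>auto simp: signs_def PiE_iff\<close>)
  also have "\<dots> = of_bool (odd_part xs = {})"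
  proof (cases "odd_part xs = {}")
    case True
    thus ?thesis by (simp add: sign_avg_const[OF S])
  next
    case False
    then obtain a where a: "a \<in> odd_part xs" by auto
    let ?f = "\<lambda>\<sigma> :: 'a \<Rightarrow> real. \<Prod>a\<in>odd_part xs. \<sigma> a"
    have "?f (flip a \<sigma>) = -1 * ?f \<sigma>" for \<sigma>
    proof -
      have "(\<Prod>c\<in>odd_part xs - {a}. flip a \<sigma> c) = (\<Prod>c\<in>odd_part xs - {a}. \<sigma> c)"
        by (intro prod.cong) (auto simp: flip_def)
      thus ?thesis using a O(2) by (simp add: prod.remove flip_def)
    qed
    hence "sign_avg S ?f = -1 * sign_avg S ?f"
      using sign_avg_flip[of a S ?f] a O(1) unfolding sign_avg_cmult[symmetric] by auto
    thus ?thesis using False by simp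
  qed
  finally show ?thesis .
qed

lemma kwise_sign_values:
  assumes "kwise_independent k A {-1, 1 :: real} Sg" "a \<in> A" "\<sigma> \<in> set_pmf Sg"
  shows "\<sigma> a \<in> {-1, 1}"
proof -
  have "set_pmf (map_pmf (\<lambda>h. h a) Sg) = {-1, 1}"
    using assms(1,2) by (simp add: kwise_independent_def)
  thus ?thesis using assms(3) by auto
qed

text \<open>The odd part has at most \<open>k\<close> elements, so the expectation factors into
  means of single signs, all of them 0.\<close>

lemma kwise_sign_monomial:
  assumes kw: "kwise_independent k A {-1, 1 :: real} Sg" and xs: "set xs \<subseteq> A" "length xs \<le> k"
  shows "measure_pmf.expectation Sg (\<lambda>\<sigma>. prod_list (map \<sigma> xs)) = of_bool (odd_part xs = {})"
proof -
  have O: "odd_part xs \<subseteq> A" "finite (odd_part xs)" "card (odd_part xs) \<le> k"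
  proof -
    show "odd_part xs \<subseteq> A" "finite (odd_part xs)" using xs by (auto simp: odd_part_def)
    have "card (odd_part xs) \<le> card (set xs)" by (intro card_mono) (auto simp: odd_part_def)
    thus "card (odd_part xs) \<le> k" using card_length[of xs] xs(2) by linarith
  qed
  have ind: "prob_space.indep_vars (measure_pmf Sg) (\<lambda>_. count_space UNIV) (\<lambda>a h. h a) (odd_part xs)"
    using kw O by (simp add: kwise_independent_def)
  have ind': "prob_space.indep_vars (measure_pmf Sg) (\<lambda>_. borel) (\<lambda>a h. h a) (odd_part xs)"
    using prob_space.indep_vars_compose2[OF prob_space_measure_pmf ind, of "\<lambda>_ x. x" "\<lambda>_. borel"] by simp
  have E0: "measure_pmf.expectation Sg (\<lambda>\<sigma>. \<sigma> a) = 0" if a: "a \<in> A" for a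
  proof -
    have "measure_pmf.expectation Sg (\<lambda>\<sigma>. \<sigma> a) = measure_pmf.expectation (map_pmf (\<lambda>h. h a) Sg) (\<lambda>x. x)"
      by simp
    also have "map_pmf (\<lambda>h. h a) Sg = pmf_of_set {-1, 1}"
      using kw a by (simp add: kwise_independent_def)
    also have "measure_pmf.expectation (pmf_of_set {-1, 1 :: real}) (\<lambda>x. x) = 0"
      by (subst integral_pmf_of_set) auto
    finally show ?thesis .
  qed
  have int: "integrable (measure_pmf Sg) (\<lambda>\<sigma>. \<sigma> a)" if a: "a \<in> A" for a
  proof (rule measure_pmf.integrable_const_bound[where B = 1])
    have "norm (\<sigma> a) \<le> 1" if "\<sigma> \<in> set_pmf Sg" for \<sigma>
      using kwise_sign_values[OF kw a that] by auto
    thus "AE \<sigma> in measure_pmf Sg. norm (\<sigma> a) \<le> 1" by (simp add: AE_measure_pmf_iff)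
  qed simp
  have "measure_pmf.expectation Sg (\<lambda>\<sigma>. prod_list (map \<sigma> xs)) = measure_pmf.expectation Sg (\<lambda>\<sigma>. \<Prod>a\<in>odd_part xs. \<sigma> a)"
    by (intro integral_cong_AE)
       (use kwise_sign_values[OF kw] xs(1) in \<open>auto simp: AE_measure_pmf_iff intro!: prod_list_signs\<close>)
  also have "\<dots> = (\<Prod>a\<in>odd_part xs. measure_pmf.expectation Sg (\<lambda>\<sigma>. \<sigma> a))"
    using prob_space.indep_vars_lebesgue_integral[OF prob_space_measure_pmf O(2) ind'] int O(1) by auto
  also have "\<dots> = (\<Prod>a\<in>odd_part xs. 0)" by (intro prod.cong refl E0) (use O in auto)
  also have "\<dots> = of_bool (odd_part xs = {})"
    using O(2) by (auto simp: card_gt_0_iff zero_power)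
  finally show ?thesis .
qed

lemma odd_part_map_eq_empty:
  assumes "inj_on g (set xs)"
  shows "odd_part (map g xs) = {} \<longleftrightarrow> odd_part xs = {}"
proof -
  have "count_list (map g xs) (g a) = count_list xs a" if "a \<in> set xs" for a
    by (rule count_list_inj_map[OF assms that])
  thus ?thesis by (auto simp: odd_part_def)
qed

text \<open>Entries read their signs through \<open>g\<close>. Injectivity on \<open>E\<close>
  preserves multiplicities, so a monomial has an empty odd part before the substitution exactly when
  it has one afterwards.\<close>

lemma kwise_sign_expectation:
  assumes kw: "kwise_independent k A {-1, 1 :: real} Sg"
    and E: "finite E" "inj_on g E" "g ` E \<subseteq> A" and f: "polyfun E K k f"
  shows "measure_pmf.expectation Sg (\<lambda>\<sigma>. f (\<lambda>a. \<sigma> (g a))) = sign_avg E f"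
    and "integrable (measure_pmf Sg) (\<lambda>\<sigma>. f (\<lambda>a. \<sigma> (g a)))"
proof -
  have bd: "AE \<sigma> in measure_pmf Sg. \<forall>a\<in>E. \<bar>\<sigma> (g a)\<bar> \<le> 1"
    using kwise_sign_values[OF kw] E(3) by (fastforce simp: AE_measure_pmf_iff)
  show "measure_pmf.expectation Sg (\<lambda>\<sigma>. f (\<lambda>a. \<sigma> (g a))) = sign_avg E f"
  proof (rule polyfun_expectation_eq[OF bd _ f])
    fix xs assume xs: "set xs \<subseteq> E" "length xs \<le> k"
    have "measure_pmf.expectation Sg (\<lambda>\<sigma>. prod_list (map \<sigma> (map g xs))) = of_bool (odd_part (map g xs) = {})"
      by (rule kwise_sign_monomial[OF kw]) (use xs E in auto)
    also have "\<dots> = of_bool (odd_part xs = {})"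
      using odd_part_map_eq_empty[of g xs] inj_on_subset[OF E(2) xs(1)] by simp
    also have "\<dots> = sign_avg E (\<lambda>\<sigma>. prod_list (map \<sigma> xs))"
      by (rule sign_avg_monomial[OF E(1) xs(1), symmetric])
    finally show "measure_pmf.expectation Sg (\<lambda>\<sigma>. prod_list (map (\<lambda>a. \<sigma> (g a)) xs)) = \<dots>"
      by (simp add: comp_def)
  qed
  show "integrable (measure_pmf Sg) (\<lambda>\<sigma>. f (\<lambda>a. \<sigma> (g a)))"
    by (rule integrable_polyfun[OF bd f])
qed

section \<open>Hash functions of limited independence\<close>

text \<open>A nonzero entry depends on one hash value, so a product of \<open>k\<close> indicators depends on at most
  \<open>k\<close> of them and cannot tell \<open>k\<close>-wise from full independence.\<close>

lemma kwise_hash_indicators: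
  assumes I: "finite I" and V: "finite V" "V \<noteq> {}"
    and kw: "kwise_independent k I V H" and T: "finite T" "card T \<le> k" "case_prod loc ` T \<subseteq> I"
  shows "measure_pmf.expectation H (\<lambda>h. \<Prod>(i, j)\<in>T. of_bool (hash_indicators loc hit h i j))
    = measure_pmf.expectation (Pi_pmf I 0 (\<lambda>_. pmf_of_set V))
        (\<lambda>h. \<Prod>(i, j)\<in>T. of_bool (hash_indicators loc hit h i j) :: real)"
proof -
  define A where "A = case_prod loc ` T"
  \<comment> \<open>Several entries may read the same hash value. Their tests are merged into one
    factor, so that the product runs over distinct inputs and independence applies.\<close>
  define G where "G = (\<lambda>a v. \<Prod>t\<in>{t\<in>T. case_prod loc t = a}. of_bool (hit (fst t) (snd t) v) :: real)"
  have A: "finite A" "A \<subseteq> I" "card A \<le> k"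
    using T card_image_le[OF T(1), of "case_prod loc"] by (auto simp: A_def)
  have G01: "0 \<le> G a v" "G a v \<le> 1" for a v
    unfolding G_def by (auto intro!: prod_nonneg prod_le_1)
  have eq: "(\<Prod>(i, j)\<in>T. of_bool (hash_indicators loc hit h i j)) = (\<Prod>a\<in>A. G a (h a))" for h
  proof -
    have "(\<Prod>(i, j)\<in>T. of_bool (hash_indicators loc hit h i j) :: real)
        = (\<Prod>t\<in>T. of_bool (hit (fst t) (snd t) (h (case_prod loc t))))"
      by (intro prod.cong refl) (auto simp: hash_indicators_def)
    also have "\<dots> = (\<Prod>a\<in>A. \<Prod>t\<in>{t\<in>T. case_prod loc t = a}. of_bool (hit (fst t) (snd t) (h (case_prod loc t))))"
      by (rule prod.group[symmetric]) (use A T in \<open>auto simp: A_def\<close>)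
    also have "\<dots> = (\<Prod>a\<in>A. G a (h a))"
      unfolding G_def by (intro prod.cong refl) auto
    finally show ?thesis .
  qed
  have ind: "prob_space.indep_vars (measure_pmf H) (\<lambda>_. count_space UNIV) (\<lambda>a h. h a) A"
    using kw A by (simp add: kwise_independent_def)
  have ind': "prob_space.indep_vars (measure_pmf H) (\<lambda>_. borel) (\<lambda>a h. G a (h a)) A"
    using prob_space.indep_vars_compose2[OF prob_space_measure_pmf ind, of G "\<lambda>_. borel"] by simp
  have int: "integrable (measure_pmf M) (\<lambda>h. G a (X h))" for M :: "'m pmf" and a X
    by (rule measure_pmf.integrable_const_bound[where B = 1]) (auto simp: G01)
  have int': "integrable (measure_pmf M) (G a)" for M a
    by (rule measure_pmf.integrable_const_bound[where B = 1]) (auto simp: G01)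
  have "measure_pmf.expectation H (\<lambda>h. \<Prod>a\<in>A. G a (h a)) = (\<Prod>a\<in>A. measure_pmf.expectation H (\<lambda>h. G a (h a)))"
    by (rule prob_space.indep_vars_lebesgue_integral[OF prob_space_measure_pmf A(1) ind' int])
  also have "\<dots> = (\<Prod>a\<in>A. measure_pmf.expectation (pmf_of_set V) (G a))"
  proof (rule prod.cong[OF refl])
    fix a assume "a \<in> A"
    hence "map_pmf (\<lambda>h. h a) H = pmf_of_set V" using kw A by (auto simp: kwise_independent_def)
    hence "measure_pmf.expectation (pmf_of_set V) (G a) = measure_pmf.expectation (map_pmf (\<lambda>h. h a) H) (G a)" by simp
    thus "measure_pmf.expectation H (\<lambda>h. G a (h a)) = measure_pmf.expectation (pmf_of_set V) (G a)" by simp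
  qed
  \<comment> \<open>Padding with factors 1 extends the product to all inputs, the form in which
    expectations under \<open>Pi_pmf\<close> factor.\<close>
  also have "\<dots> = (\<Prod>a\<in>I. measure_pmf.expectation (pmf_of_set V) (\<lambda>v. if a \<in> A then G a v else 1))"
    by (rule prod.mono_neutral_cong_left[OF I A(2)]) auto
  also have "\<dots> = measure_pmf.expectation (Pi_pmf I 0 (\<lambda>_. pmf_of_set V)) (\<lambda>h. \<Prod>a\<in>I. if a \<in> A then G a (h a) else 1)"
  proof (rule expectation_prod_Pi_pmf[OF I, symmetric])
    fix a
    show "integrable (measure_pmf (pmf_of_set V)) (\<lambda>v. if a \<in> A then G a v else 1)"
      by (cases "a \<in> A") (simp_all add: int')
  qed (use G01 in auto)
  also have "\<dots> = measure_pmf.expectation (Pi_pmf I 0 (\<lambda>_. pmf_of_set V)) (\<lambda>h. \<Prod>a\<in>A. G a (h a))"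
    by (intro Bochner_Integration.integral_cong refl prod.mono_neutral_cong_right[OF I A(2)]) auto
  finally show ?thesis unfolding eq .
qed

section \<open>Independent Bernoulli positions\<close>

definition bern_row :: "nat \<Rightarrow> real \<Rightarrow> (nat \<Rightarrow> bool) pmf" where
  "bern_row n p = Pi_pmf {..<n} False (\<lambda>_. bernoulli_pmf p)"

text \<open>The product is nested because the two collision terms use it differently: column moments
  factor over the rows, row moments look inside a single row.\<close>

definition bern_rows :: "nat \<Rightarrow> nat \<Rightarrow> real \<Rightarrow> (nat \<Rightarrow> nat \<Rightarrow> bool) pmf" where
  "bern_rows m n p = Pi_pmf {..<m} (\<lambda>_. False) (\<lambda>_. bern_row n p)"

lemma finite_set_Pi_pmf:
  assumes "finite A" "\<And>x. x \<in> A \<Longrightarrow> finite (set_pmf (p x))"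
  shows "finite (set_pmf (Pi_pmf A dflt p))"
  unfolding set_Pi_pmf[OF assms(1)] using assms by (intro finite_PiE_dflt) (auto simp: comp_def)

lemma finite_bern_row: "finite (set_pmf (bern_row n p))"
  unfolding bern_row_def by (rule finite_set_Pi_pmf) (auto intro: finite_subset[of _ UNIV])

lemma integrable_bern_row: "integrable (measure_pmf (bern_row n p)) (f :: _ \<Rightarrow> real)"
  by (rule integrable_measure_pmf_finite[OF finite_bern_row])

lemma integrable_bern_rows: "integrable (measure_pmf (bern_rows m n p)) (f :: _ \<Rightarrow> real)"
  unfolding bern_rows_def
  by (intro integrable_measure_pmf_finite finite_set_Pi_pmf finite_bern_row) auto

lemma expectation_bern_row_prod:
  assumes p: "0 \<le> p" "p \<le> 1" and f: "\<And>j v. j < n \<Longrightarrow> 0 \<le> f j v"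
  shows "measure_pmf.expectation (bern_row n p) (\<lambda>\<rho>. \<Prod>j<n. f j (\<rho> j))
     = (\<Prod>j<n. p * f j True + (1 - p) * f j False)"
proof -
  have "measure_pmf.expectation (bern_row n p) (\<lambda>\<rho>. \<Prod>j<n. f j (\<rho> j))
     = (\<Prod>j<n. measure_pmf.expectation (bernoulli_pmf p) (f j))"
    unfolding bern_row_def
    by (rule expectation_prod_Pi_pmf) (use f in \<open>auto intro!: integrable_measure_pmf_finite intro: finite_subset[of _ UNIV]\<close>)
  thus ?thesis using p by (simp add: mult.commute)
qed

lemma expectation_bern_rows_prod:
  fixes f :: "nat \<Rightarrow> (nat \<Rightarrow> bool) \<Rightarrow> real"
  assumes "\<And>i \<rho>. i < m \<Longrightarrow> 0 \<le> f i \<rho>"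
  shows "measure_pmf.expectation (bern_rows m n p) (\<lambda>\<delta>. \<Prod>i<m. f i (\<delta> i))
     = (\<Prod>i<m. measure_pmf.expectation (bern_row n p) (f i))"
  unfolding bern_rows_def
  by (rule expectation_prod_Pi_pmf) (use assms integrable_bern_row in auto)

lemma expectation_bern_rows_component:
  assumes "i < m"
  shows "measure_pmf.expectation (bern_rows m n p) (\<lambda>\<delta>. f (\<delta> i)) = measure_pmf.expectation (bern_row n p) (f :: _ \<Rightarrow> real)"
proof -
  have "map_pmf (\<lambda>\<delta>. \<delta> i) (bern_rows m n p) = bern_row n p"
    unfolding bern_rows_def using assms by (subst Pi_pmf_component) auto
  hence "measure_pmf.expectation (bern_row n p) f = measure_pmf.expectation (map_pmf (\<lambda>\<delta>. \<delta> i) (bern_rows m n p)) f"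
    by simp
  thus ?thesis by simp
qed

lemma prod_if_mem: "finite X \<Longrightarrow> T \<subseteq> X \<Longrightarrow> (\<Prod>t\<in>X. if t \<in> T then (f t :: real) else 1) = (\<Prod>t\<in>T. f t)"
  by (rule prod.mono_neutral_cong_right) auto

text \<open>For \<open>p = s / m\<close> this is the upper bound of the OSNAP condition with
  equality, so Bernoulli positions dominate in every mixed moment.\<close>

lemma bern_rows_monomial:
  assumes p: "0 \<le> p" "p \<le> 1" and T: "T \<subseteq> {..<m} \<times> {..<n}"
  shows "measure_pmf.expectation (bern_rows m n p) (\<lambda>\<delta>. \<Prod>(i, j)\<in>T. of_bool (\<delta> i j)) = p ^ card T"
proof -
  have eq: "(\<Prod>(i, j)\<in>T. of_bool (\<delta> i j) :: real) = (\<Prod>i<m. \<Prod>j<n. if (i, j) \<in> T then of_bool (\<delta> i j) else 1)" for \<delta>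
  proof -
    have "(\<Prod>(i, j)\<in>T. of_bool (\<delta> i j) :: real) = (\<Prod>t\<in>{..<m} \<times> {..<n}. if t \<in> T then (case t of (i, j) \<Rightarrow> of_bool (\<delta> i j)) else 1)"
      by (rule prod_if_mem[symmetric]) (use T in auto)
    also have "\<dots> = (\<Prod>(i, j)\<in>{..<m} \<times> {..<n}. if (i, j) \<in> T then of_bool (\<delta> i j) else 1)"
      by (intro prod.cong) auto
    finally show ?thesis by (simp add: prod.cartesian_product)
  qed
  have "measure_pmf.expectation (bern_rows m n p) (\<lambda>\<delta>. \<Prod>(i, j)\<in>T. of_bool (\<delta> i j) :: real)
     = measure_pmf.expectation (bern_rows m n p) (\<lambda>\<delta>. \<Prod>i<m. \<Prod>j<n. if (i, j) \<in> T then of_bool (\<delta> i j) else 1)"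
    by (simp only: eq)
  also have "\<dots> = (\<Prod>i<m. measure_pmf.expectation (bern_row n p) (\<lambda>\<rho>. \<Prod>j<n. if (i, j) \<in> T then of_bool (\<rho> j) else 1))"
    by (rule expectation_bern_rows_prod[of m "\<lambda>i \<rho>. \<Prod>j<n. if (i, j) \<in> T then of_bool (\<rho> j) else 1"]) (auto intro!: prod_nonneg)
  also have "\<dots> = (\<Prod>i<m. \<Prod>j<n. if (i, j) \<in> T then p else 1)"
  proof (rule prod.cong[OF refl])
    fix i
    have "measure_pmf.expectation (bern_row n p) (\<lambda>\<rho>. \<Prod>j<n. if (i, j) \<in> T then of_bool (\<rho> j) else 1)
       = (\<Prod>j<n. p * (if (i, j) \<in> T then of_bool True else 1) + (1 - p) * (if (i, j) \<in> T then of_bool False else 1))"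
      by (rule expectation_bern_row_prod[OF p, of n "\<lambda>j v. if (i, j) \<in> T then of_bool v else 1"]) auto
    also have "\<dots> = (\<Prod>j<n. if (i, j) \<in> T then p else 1)" by (intro prod.cong) auto
    finally show "measure_pmf.expectation (bern_row n p) (\<lambda>\<rho>. \<Prod>j<n. if (i, j) \<in> T then of_bool (\<rho> j) else 1) = \<dots>" .
  qed
  also have "\<dots> = (\<Prod>t\<in>{..<m} \<times> {..<n}. if t \<in> T then p else 1)"
    by (simp add: prod.cartesian_product case_prod_unfold)
  also have "\<dots> = p ^ card T" using T by (subst prod_if_mem) auto
  finally show ?thesis .
qed

subsection \<open>Collision moments for independent Bernoulli positions\<close>

text \<open>The power is one term of the exponential series, and the other terms are
  nonnegative.\<close>

lemma power_le_fact_exp: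
  fixes x :: real
  assumes "0 \<le> x"
  shows "x ^ q \<le> fact q * exp x"
proof -
  have s: "(\<lambda>k. x ^ k /\<^sub>R fact k) sums exp x" by (rule exp_converges)
  have "(\<Sum>k\<in>{q}. x ^ k /\<^sub>R fact k) \<le> exp x"
    unfolding sums_unique[OF s] by (rule sum_le_suminf) (use s assms in \<open>auto simp: sums_iff\<close>)
  thus ?thesis by (simp add: field_simps)
qed

text \<open>The indicators are a real-valued argument, so the same expression is a polynomial and
  can be evaluated at random positions.\<close>

definition row_weight :: "nat \<Rightarrow> (nat \<Rightarrow> real) \<Rightarrow> nat \<Rightarrow> (nat \<Rightarrow> real) \<Rightarrow> real" where
  "row_weight n b i y = (\<Sum>j\<in>{..<n} - {i}. b j * y j)"

definition row_pairs :: "nat \<Rightarrow> (nat \<Rightarrow> real) \<Rightarrow> (nat \<Rightarrow> real) \<Rightarrow> real" where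
  "row_pairs n b y = (\<Sum>i<n. b i * y i * row_weight n b i y)"

text \<open>In the application \<open>b i\<close> is the squared norm of row \<open>i\<close> of U
  and \<open>p = s / m\<close>. The bound on \<open>2 * p * d\<close> keeps the exponents in the
  range where the exponential function is bounded linearly.\<close>

context
  fixes n :: nat and b :: "nat \<Rightarrow> real" and p d :: real
  assumes b: "\<And>i. 0 \<le> b i" "\<And>i. i < n \<Longrightarrow> b i \<le> 1" and bd: "(\<Sum>i<n. b i) = d"
    and p: "0 \<le> p" "p \<le> 1" and pd: "2 * p * d \<le> 1"
begin

lemma exp_le_linear: "0 \<le> x \<Longrightarrow> x \<le> 1 \<Longrightarrow> exp x \<le> 1 + 2 * (x::real)"
  using exp_bound[of x] mult_left_mono[of x 1 x] by (simp add: power2_eq_square)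

text \<open>The factors are the exponential moments of the independent summands
  \<open>b j * y j\<close>; each is at most \<open>1 + 2 * p * b j\<close>, hence at most
  \<open>exp (2 * p * b j)\<close>, and the exponents add up.\<close>

lemma factor_bound:
  assumes "J \<subseteq> {..<n}"
  shows "(\<Prod>j\<in>J. p * exp (b j) + (1 - p)) \<le> exp (2 * p * d)"
proof -
  have "(\<Prod>j\<in>J. p * exp (b j) + (1 - p)) \<le> (\<Prod>j\<in>J. exp (2 * p * b j))"
  proof (rule prod_mono)
    fix j assume "j \<in> J"
    hence "p * exp (b j) \<le> p * (1 + 2 * b j)"
      using assms b p by (intro mult_left_mono exp_le_linear) auto
    moreover have "1 + 2 * p * b j \<le> exp (2 * p * b j)" by (rule exp_ge_add_one_self)
    moreover have "p * (1 + 2 * b j) = p + 2 * p * b j" by (simp add: algebra_simps)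
    moreover have "0 \<le> p * exp (b j) + (1 - p)" using p by (intro add_nonneg_nonneg mult_nonneg_nonneg) auto
    ultimately show "0 \<le> p * exp (b j) + (1 - p) \<and> p * exp (b j) + (1 - p) \<le> exp (2 * p * b j)"
      by linarith
  qed
  also have "\<dots> = exp (2 * p * (\<Sum>j\<in>J. b j))"
    using finite_subset[OF assms] by (simp add: exp_sum[symmetric] sum_distrib_left)
  also have "\<dots> \<le> exp (2 * p * d)"
    unfolding bd[symmetric] exp_le_cancel_iff using assms b p by (intro mult_left_mono sum_mono2) auto
  finally show ?thesis .
qed

lemma d_nonneg: "0 \<le> d"
  unfolding bd[symmetric] by (intro sum_nonneg b)

text \<open>For Boolean \<open>y\<close> one has \<open>exp (y * w) = 1 - y + y * exp w\<close>. The
  indicator at \<open>i\<close> is independent of the weight of the other columns, so the mean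
  exceeds 1 only by \<open>p * (exp (2 * p * d) - 1)\<close>, which is of order
  \<open>p\<^sup>2 * d\<close>.\<close>

lemma row_weight_exp:
  assumes i: "i < n"
  shows "measure_pmf.expectation (bern_row n p)
     (\<lambda>\<rho>. exp (of_bool (\<rho> i) * row_weight n b i (\<lambda>j. of_bool (\<rho> j)))) \<le> exp (4 * p\<^sup>2 * d)"
proof -
  let ?J = "{..<n} - {i}"
  have ins: "{..<n} = insert i ?J" using i by auto
  define F where "F = (\<lambda>j v. if j = i then of_bool v else exp (b j * of_bool v) :: real)"
  define G where "G = (\<lambda>j v. if j = i then of_bool v else (1::real))"
  have F: "(\<Prod>j<n. F j (\<rho> j)) = of_bool (\<rho> i) * exp (row_weight n b i (\<lambda>j. of_bool (\<rho> j)))" for \<rho>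
  proof -
    have "exp (row_weight n b i (\<lambda>j. of_bool (\<rho> j))) = (\<Prod>j\<in>?J. exp (b j * of_bool (\<rho> j)))"
      unfolding row_weight_def by (rule exp_sum) simp
    also have "\<dots> = (\<Prod>j\<in>?J. F j (\<rho> j))" by (intro prod.cong) (auto simp: F_def)
    finally show ?thesis by (subst ins, subst prod.insert) (simp_all add: F_def)
  qed
  have G: "(\<Prod>j<n. G j (\<rho> j)) = of_bool (\<rho> i)" for \<rho>
    by (subst ins, subst prod.insert) (auto simp: G_def)
  have "measure_pmf.expectation (bern_row n p)
     (\<lambda>\<rho>. exp (of_bool (\<rho> i) * row_weight n b i (\<lambda>j. of_bool (\<rho> j))))
     = measure_pmf.expectation (bern_row n p) (\<lambda>\<rho>. 1 - (\<Prod>j<n. G j (\<rho> j)) + (\<Prod>j<n. F j (\<rho> j)))"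
    by (intro Bochner_Integration.integral_cong refl) (auto simp: F G)
  also have "\<dots> = 1 - measure_pmf.expectation (bern_row n p) (\<lambda>\<rho>. \<Prod>j<n. G j (\<rho> j))
      + measure_pmf.expectation (bern_row n p) (\<lambda>\<rho>. \<Prod>j<n. F j (\<rho> j))"
    by (simp add: integrable_bern_row)
  also have "measure_pmf.expectation (bern_row n p) (\<lambda>\<rho>. \<Prod>j<n. G j (\<rho> j)) = (\<Prod>j<n. p * G j True + (1 - p) * G j False)"
    by (rule expectation_bern_row_prod[OF p]) (auto simp: G_def)
  also have "\<dots> = p"
    by (subst ins, subst prod.insert) (auto simp: G_def)
  also have "measure_pmf.expectation (bern_row n p) (\<lambda>\<rho>. \<Prod>j<n. F j (\<rho> j)) = (\<Prod>j<n. p * F j True + (1 - p) * F j False)"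
    by (rule expectation_bern_row_prod[OF p]) (auto simp: F_def)
  also have "\<dots> = p * (\<Prod>j\<in>?J. p * exp (b j) + (1 - p))"
    by (subst ins, subst prod.insert) (auto simp: F_def intro!: prod.cong)
  also have "1 - p + p * (\<Prod>j\<in>?J. p * exp (b j) + (1 - p)) \<le> 1 - p + p * exp (2 * p * d)"
    by (intro add_left_mono mult_left_mono factor_bound p) auto
  also have "\<dots> \<le> 1 - p + p * (1 + 2 * (2 * p * d))"
    using p d_nonneg pd by (intro add_left_mono mult_left_mono exp_le_linear) auto
  also have "\<dots> = 1 + 4 * p\<^sup>2 * d" by (simp add: algebra_simps power2_eq_square)
  also have "\<dots> \<le> exp (4 * p\<^sup>2 * d)" by (rule exp_ge_add_one_self)
  finally show ?thesis .
qed

lemma row_weight_nonneg: "0 \<le> row_weight n b i (\<lambda>j. of_bool (\<rho> j))"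
  unfolding row_weight_def by (intro sum_nonneg mult_nonneg_nonneg b) auto

text \<open>The rows are independent, so the exponential moment of the column sum is a product of
  \<open>m\<close> factors \<open>exp (4 * p\<^sup>2 * d)\<close>, bounded because
  \<open>m * p\<^sup>2 * d\<close> is at most 1.\<close>

lemma column_moment:
  assumes i: "i < n" and mpd: "real m * p\<^sup>2 * d \<le> 1"
  shows "measure_pmf.expectation (bern_rows m n p)
     (\<lambda>\<delta>. (\<Sum>\<rho><m. of_bool (\<delta> \<rho> i) * row_weight n b i (\<lambda>j. of_bool (\<delta> \<rho> j))) ^ q) \<le> fact q * exp 4"
proof -
  let ?c = "\<lambda>\<delta> \<rho>. of_bool (\<delta> \<rho> i) * row_weight n b i (\<lambda>j. of_bool (\<delta> \<rho> j))"
  let ?E = "\<lambda>y::nat \<Rightarrow> bool. exp (of_bool (y i) * row_weight n b i (\<lambda>j. of_bool (y j)))"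
  have "measure_pmf.expectation (bern_rows m n p) (\<lambda>\<delta>. (\<Sum>\<rho><m. ?c \<delta> \<rho>) ^ q)
      \<le> measure_pmf.expectation (bern_rows m n p) (\<lambda>\<delta>. fact q * exp (\<Sum>\<rho><m. ?c \<delta> \<rho>))"
    by (intro integral_mono integrable_bern_rows power_le_fact_exp sum_nonneg mult_nonneg_nonneg row_weight_nonneg) auto
  also have "\<dots> = fact q * measure_pmf.expectation (bern_rows m n p) (\<lambda>\<delta>. \<Prod>\<rho><m. ?E (\<delta> \<rho>))"
    by (simp only: exp_sum[OF finite_lessThan] integral_mult_right_zero)
  also have "measure_pmf.expectation (bern_rows m n p) (\<lambda>\<delta>. \<Prod>\<rho><m. ?E (\<delta> \<rho>))
      = (\<Prod>\<rho><m. measure_pmf.expectation (bern_row n p) ?E)"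
    by (rule expectation_bern_rows_prod[of m "\<lambda>_. ?E"]) simp
  also have "\<dots> \<le> (\<Prod>\<rho><m. exp (4 * p\<^sup>2 * d))"
    by (intro prod_mono conjI row_weight_exp i) (auto intro!: integral_nonneg)
  also have "\<dots> = exp (real m * (4 * p\<^sup>2 * d))" by (simp add: exp_of_nat_mult)
  also have "\<dots> \<le> exp 4" using mpd by (simp add: mult_ac)
  finally show ?thesis by simp
qed

text \<open>A nonzero \<open>row_pairs\<close> needs two nonzero entries in the row, whence the factor \<open>p\<^sup>2\<close>. It makes
  the sum over all \<open>m\<close> rows harmless.\<close>

lemma row_moment:
  "measure_pmf.expectation (bern_row n p) (\<lambda>\<rho>. row_pairs n b (\<lambda>j. of_bool (\<rho> j)) ^ Suc r)
     \<le> fact (2 * r) * exp 3 * (p\<^sup>2 * d\<^sup>2)"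
proof -
  let ?y = "\<lambda>\<rho> j. of_bool (\<rho> j) :: real"
  define Y where "Y = (\<lambda>\<rho>. \<Sum>j<n. b j * ?y \<rho> j)"
  have Y0: "Y \<rho> \<ge> 0" for \<rho> unfolding Y_def by (intro sum_nonneg mult_nonneg_nonneg b) auto
  have rw: "row_weight n b i (?y \<rho>) \<le> Y \<rho>" for i \<rho>
    unfolding row_weight_def Y_def by (intro sum_mono2) (auto intro: mult_nonneg_nonneg b)
  have rp0: "0 \<le> row_pairs n b (?y \<rho>)" for \<rho>
    unfolding row_pairs_def by (intro sum_nonneg mult_nonneg_nonneg b row_weight_nonneg) auto
  have "row_pairs n b (?y \<rho>) \<le> Y \<rho> ^ 2" for \<rho>
  proof -
    have "row_pairs n b (?y \<rho>) \<le> (\<Sum>i<n. b i * ?y \<rho> i * Y \<rho>)"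
      unfolding row_pairs_def by (intro sum_mono mult_left_mono rw mult_nonneg_nonneg b) auto
    also have "\<dots> = Y \<rho> ^ 2" by (simp add: Y_def sum_distrib_right[symmetric] power2_eq_square)
    finally show ?thesis .
  qed
  \<comment> \<open>Only \<open>r\<close> of the \<open>r + 1\<close> factors are given to the
    exponential bound. The remaining one is kept as a sum over pairs of distinct columns.\<close>
  hence "row_pairs n b (?y \<rho>) ^ r \<le> (Y \<rho> ^ 2) ^ r" for \<rho> by (intro power_mono rp0)
  also have "(Y \<rho> ^ 2) ^ r \<le> fact (2 * r) * exp (Y \<rho>)" for \<rho>
    unfolding power_mult[symmetric] by (rule power_le_fact_exp[OF Y0])
  finally have pw: "row_pairs n b (?y \<rho>) ^ r \<le> fact (2 * r) * exp (Y \<rho>)" for \<rho> .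
  define F where "F = (\<lambda>i j l v. (if l = i \<or> l = j then of_bool v else 1) * exp (b l * of_bool v) :: real)"
  have F: "?y \<rho> i * ?y \<rho> j * exp (Y \<rho>) = (\<Prod>l<n. F i j l (\<rho> l))" if "i < n" "j \<in> {..<n} - {i}" for i j \<rho>
  proof -
    have "(\<Prod>l<n. if l = i \<or> l = j then ?y \<rho> l else 1) = (\<Prod>l\<in>{i, j}. ?y \<rho> l)"
      by (rule prod.mono_neutral_cong_right) (use that in auto)
    hence "(\<Prod>l<n. if l = i \<or> l = j then ?y \<rho> l else 1) = ?y \<rho> i * ?y \<rho> j" using that by auto
    moreover have "exp (Y \<rho>) = (\<Prod>l<n. exp (b l * ?y \<rho> l))"
      unfolding Y_def by (rule exp_sum) simp
    ultimately show ?thesis by (simp only: F_def prod.distrib)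
  qed
  have EF: "measure_pmf.expectation (bern_row n p) (\<lambda>\<rho>. \<Prod>l<n. F i j l (\<rho> l)) \<le> p\<^sup>2 * exp 3"
    if ij: "i < n" "j \<in> {..<n} - {i}" for i j
  proof -
    let ?J = "{..<n} - {i, j}"
    have ins: "{..<n} = insert i (insert j ?J)" using ij by auto
    have "measure_pmf.expectation (bern_row n p) (\<lambda>\<rho>. \<Prod>l<n. F i j l (\<rho> l))
        = (\<Prod>l<n. p * F i j l True + (1 - p) * F i j l False)"
      by (rule expectation_bern_row_prod[OF p]) (auto simp: F_def)
    also have "\<dots> = (p * exp (b i)) * ((p * exp (b j)) * (\<Prod>l\<in>?J. p * exp (b l) + (1 - p)))"
      using ij by (subst ins, subst prod.insert, simp, simp, subst prod.insert)
        (auto simp: F_def intro!: prod.cong)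
    \<comment> \<open>Each of the two columns of the pair costs \<open>p\<close> and at most a
      factor e, and all other columns together at most one more e.\<close>
    also have "\<dots> \<le> (p * exp 1) * ((p * exp 1) * exp 1)"
    proof (intro mult_mono)
      show "(\<Prod>l\<in>?J. p * exp (b l) + (1 - p)) \<le> exp 1"
        by (rule order_trans[OF factor_bound]) (use pd in auto)
    qed (use p b ij in \<open>auto intro!: prod_nonneg mult_nonneg_nonneg add_nonneg_nonneg\<close>)
    also have "\<dots> = p\<^sup>2 * exp 3" by (simp add: power2_eq_square exp_add[symmetric] mult_exp_exp)
    finally show ?thesis .
  qed
  have "row_pairs n b (?y \<rho>) ^ Suc r \<le> (\<Sum>i<n. \<Sum>j\<in>{..<n} - {i}. fact (2 * r) * b i * b j * (\<Prod>l<n. F i j l (\<rho> l)))" for \<rho>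
  proof -
    have "row_pairs n b (?y \<rho>) ^ Suc r \<le> row_pairs n b (?y \<rho>) * (fact (2 * r) * exp (Y \<rho>))"
      using mult_left_mono[OF pw rp0] by simp
    also have "\<dots> = (\<Sum>i<n. \<Sum>j\<in>{..<n} - {i}. fact (2 * r) * b i * b j * (?y \<rho> i * ?y \<rho> j * exp (Y \<rho>)))"
      unfolding row_pairs_def row_weight_def sum_distrib_left sum_distrib_right
      by (intro sum.cong refl) (simp only: mult_ac)
    also have "\<dots> = (\<Sum>i<n. \<Sum>j\<in>{..<n} - {i}. fact (2 * r) * b i * b j * (\<Prod>l<n. F i j l (\<rho> l)))"
      by (intro sum.cong refl) (use F in auto)
    finally show ?thesis .
  qed
  hence "measure_pmf.expectation (bern_row n p) (\<lambda>\<rho>. row_pairs n b (?y \<rho>) ^ Suc r)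
     \<le> measure_pmf.expectation (bern_row n p) (\<lambda>\<rho>. \<Sum>i<n. \<Sum>j\<in>{..<n} - {i}. fact (2 * r) * b i * b j * (\<Prod>l<n. F i j l (\<rho> l)))"
    by (intro integral_mono integrable_bern_row)
  also have "\<dots> = (\<Sum>i<n. \<Sum>j\<in>{..<n} - {i}. fact (2 * r) * b i * b j * measure_pmf.expectation (bern_row n p) (\<lambda>\<rho>. \<Prod>l<n. F i j l (\<rho> l)))"
    by (simp add: integrable_bern_row)
  also have "\<dots> \<le> (\<Sum>i<n. \<Sum>j\<in>{..<n} - {i}. fact (2 * r) * b i * b j * (p\<^sup>2 * exp 3))"
    by (intro sum_mono mult_left_mono EF mult_nonneg_nonneg b) auto
  also have "\<dots> \<le> (\<Sum>i<n. \<Sum>j<n. fact (2 * r) * b i * b j * (p\<^sup>2 * exp 3))"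
    by (intro sum_mono sum_mono2) (auto intro!: mult_nonneg_nonneg b)
  also have "\<dots> = fact (2 * r) * exp 3 * (p\<^sup>2 * d\<^sup>2)"
    unfolding sum_distrib_right[symmetric] sum_distrib_left[symmetric] bd
    by (simp add: power2_eq_square mult_ac)
  finally show ?thesis .
qed

end

subsection \<open>The collision polynomial\<close>

definition supp :: "nat \<Rightarrow> nat \<Rightarrow> (nat \<Rightarrow> nat \<Rightarrow> bool) \<Rightarrow> (nat \<times> nat) set" where
  "supp m n \<delta> = {a\<in>entries m n. \<delta> (fst a) (snd a)}"

lemma finite_entries: "finite (entries m n)"
  by (simp add: entries_def)

lemma finite_supp: "finite (supp m n \<delta>)"
  by (simp add: supp_def finite_entries)

lemma sum_filter_of_bool: "finite A \<Longrightarrow> (\<Sum>x\<in>{x\<in>A. P x}. f x) = (\<Sum>x\<in>A. of_bool (P x) * (f x :: real))"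
  by (simp only: sum.inter_filter) (intro sum.cong, auto)

lemma sum_supp: "(\<Sum>a\<in>supp m n \<delta>. f a) = (\<Sum>\<rho><m. \<Sum>i<n. of_bool (\<delta> \<rho> i) * (f (\<rho>, i) :: real))"
  unfolding supp_def
  by (subst sum_filter_of_bool[OF finite_entries], unfold entries_def)
     (simp only: sum.cartesian_product case_prod_unfold fst_conv snd_conv prod.collapse)

lemma sum_supp_row:
  assumes "\<rho> < m"
  shows "(\<Sum>a\<in>{a\<in>supp m n \<delta>. fst a = \<rho>}. f a) = (\<Sum>i<n. of_bool (\<delta> \<rho> i) * (f (\<rho>, i) :: real))"
proof -
  have "{a\<in>supp m n \<delta>. fst a = \<rho>} = Pair \<rho> ` {i\<in>{..<n}. \<delta> \<rho> i}"
    using assms by (auto simp: supp_def entries_def)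
  hence "(\<Sum>a\<in>{a\<in>supp m n \<delta>. fst a = \<rho>}. f a) = (\<Sum>i\<in>{i\<in>{..<n}. \<delta> \<rho> i}. f (\<rho>, i))"
    by (simp add: sum.reindex inj_on_def)
  thus ?thesis by (simp only: sum_filter_of_bool[OF finite_lessThan])
qed

lemma sum_supp_col:
  assumes "i < n"
  shows "(\<Sum>a\<in>{a\<in>supp m n \<delta>. snd a = i}. f a) = (\<Sum>\<rho><m. of_bool (\<delta> \<rho> i) * (f (\<rho>, i) :: real))"
proof -
  have "{a\<in>supp m n \<delta>. snd a = i} = (\<lambda>\<rho>. (\<rho>, i)) ` {\<rho>\<in>{..<m}. \<delta> \<rho> i}"
    using assms by (auto simp: supp_def entries_def)
  hence "(\<Sum>a\<in>{a\<in>supp m n \<delta>. snd a = i}. f a) = (\<Sum>\<rho>\<in>{\<rho>\<in>{..<m}. \<delta> \<rho> i}. f (\<rho>, i))"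
    by (simp add: sum.reindex inj_on_def)
  thus ?thesis by (simp only: sum_filter_of_bool[OF finite_lessThan])
qed

lemma collide_supp:
  assumes "\<rho> < m"
  shows "collide (supp m n \<delta>) b (\<rho>, i) = row_weight n b i (\<lambda>j. of_bool (\<delta> \<rho> j))"
proof -
  have "{c\<in>supp m n \<delta>. fst c = fst (\<rho>, i) \<and> c \<noteq> (\<rho>, i)} = Pair \<rho> ` {j\<in>{..<n} - {i}. \<delta> \<rho> j}"
    using assms by (auto simp: supp_def entries_def)
  hence "collide (supp m n \<delta>) b (\<rho>, i) = (\<Sum>j\<in>{j\<in>{..<n} - {i}. \<delta> \<rho> j}. b j)"
    unfolding collide_def by (simp add: sum.reindex inj_on_def)
  also have "\<dots> = (\<Sum>j\<in>{..<n} - {i}. of_bool (\<delta> \<rho> j) * b j)"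
    by (rule sum_filter_of_bool) simp
  finally show ?thesis by (simp only: row_weight_def mult.commute)
qed

lemma col_collide_supp:
  assumes "i < n"
  shows "col_collide (supp m n \<delta>) b i = (\<Sum>\<rho><m. of_bool (\<delta> \<rho> i) * row_weight n b i (\<lambda>j. of_bool (\<delta> \<rho> j)))"
  unfolding col_collide_def sum_supp_col[OF assms] by (intro sum.cong refl) (simp only: collide_supp lessThan_iff)

lemma row_collide_supp:
  assumes "\<rho> < m"
  shows "row_collide (supp m n \<delta>) b \<rho> = row_pairs n b (\<lambda>j. of_bool (\<delta> \<rho> j))"
  unfolding row_collide_def sum_supp_row[OF assms] row_pairs_def
  by (intro sum.cong refl) (simp only: collide_supp[OF assms] snd_conv mult_ac)

text \<open>The bound of \<open>chaos_moment\<close>, as a polynomial in the indicators.\<close>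

definition collision_poly :: "nat \<Rightarrow> nat \<Rightarrow> (nat \<Rightarrow> real) \<Rightarrow> nat \<Rightarrow> (nat \<times> nat \<Rightarrow> real) \<Rightarrow> real" where
  "collision_poly m n b q x =
     (\<Sum>i<n. (\<Sum>\<rho><m. x (\<rho>, i) * row_weight n b i (\<lambda>j. x (\<rho>, j))) ^ q * b i)
     + (\<Sum>\<rho><m. row_pairs n b (\<lambda>j. x (\<rho>, j)) ^ q)"

abbreviation ind :: "(nat \<Rightarrow> nat \<Rightarrow> bool) \<Rightarrow> nat \<times> nat \<Rightarrow> real" where
  "ind \<delta> \<equiv> (\<lambda>a. of_bool (\<delta> (fst a) (snd a)))"

lemma polyfun_collision:
  assumes b: "\<And>i. 0 \<le> b i"
  shows "polyfun (entries m n) {0..} (2 * q) (collision_poly m n b q)"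
proof -
  let ?E = "entries m n" and ?K = "{0::real..}"
  have K: "c * c' \<in> ?K" if "c \<in> ?K" "c' \<in> ?K" for c c' using that by simp
  have v: "polyfun ?E ?K 1 (\<lambda>x. x (\<rho>, i))" if "\<rho> < m" "i < n" for \<rho> i
    by (rule polyfun_var) (use that in \<open>auto simp: entries_def\<close>)
  have w: "polyfun ?E ?K 1 (\<lambda>x. row_weight n b i (\<lambda>j. x (\<rho>, j)))" if "\<rho> < m" for \<rho> i
    unfolding row_weight_def
    by (intro polyfun_sum polyfun_cmult K v) (use b that in auto)
  have 1: "polyfun ?E ?K (1 + 1) (\<lambda>x. x (\<rho>, i) * row_weight n b i (\<lambda>j. x (\<rho>, j)))" if "\<rho> < m" "i < n" for \<rho> i
    by (rule polyfun_mult[OF K v[OF that] w[OF that(1)]])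
  have 2: "polyfun ?E ?K ((1 + 1) * q) (\<lambda>x. (\<Sum>\<rho><m. x (\<rho>, i) * row_weight n b i (\<lambda>j. x (\<rho>, j))) ^ q)" if "i < n" for i
    by (intro polyfun_power K polyfun_sum 1) (use that in auto)
  have 3: "polyfun ?E ?K ((1 + 1) * q) (\<lambda>x. (\<Sum>\<rho><m. x (\<rho>, i) * row_weight n b i (\<lambda>j. x (\<rho>, j))) ^ q * b i)" if "i < n" for i
    using polyfun_cmult[OF K _ 2[OF that], of "b i"] b by (simp add: mult.commute)
  have 4: "polyfun ?E ?K (1 + 1) (\<lambda>x. row_pairs n b (\<lambda>j. x (\<rho>, j)))" if "\<rho> < m" for \<rho>
  proof -
    have "polyfun ?E ?K (1 + 1) (\<lambda>x. \<Sum>i<n. b i * (x (\<rho>, i) * row_weight n b i (\<lambda>j. x (\<rho>, j))))"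
      by (intro polyfun_sum polyfun_cmult K 1) (use b that in auto)
    thus ?thesis by (simp only: row_pairs_def mult.assoc)
  qed
  have 5: "polyfun ?E ?K ((1 + 1) * q) (\<lambda>x. row_pairs n b (\<lambda>j. x (\<rho>, j)) ^ q)" if "\<rho> < m" for \<rho>
    by (intro polyfun_power K 4) (use that in auto)
  have "polyfun ?E ?K ((1 + 1) * q) (\<lambda>x. (\<Sum>i<n. (\<Sum>\<rho><m. x (\<rho>, i) * row_weight n b i (\<lambda>j. x (\<rho>, j))) ^ q * b i)
     + (\<Sum>\<rho><m. row_pairs n b (\<lambda>j. x (\<rho>, j)) ^ q))"
    by (intro polyfun.add polyfun_sum 3 5) auto
  thus ?thesis by (simp add: collision_poly_def[abs_def] mult_2)
qed

text \<open>Positions are replaced by Bernoulli ones, after which the column and row bounds apply.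
  Only sets of at most \<open>2 * (r + 1)\<close> entries are tested, which is what hashed positions
  of limited independence can satisfy.\<close>

lemma collision_expectation:
  assumes b: "\<And>i. 0 \<le> b i" "\<And>i. i < n \<Longrightarrow> b i \<le> 1" and bd: "(\<Sum>i<n. b i) = d"
    and p: "0 \<le> p" "p \<le> 1" "2 * p * d \<le> 1" "real m * p\<^sup>2 * d \<le> 1"
    and D: "\<And>T. T \<subseteq> entries m n \<Longrightarrow> card T \<le> 2 * (r + 1) \<Longrightarrow>
       measure_pmf.expectation D (\<lambda>\<delta>. \<Prod>(i, j)\<in>T. of_bool (\<delta> i j)) \<le> p ^ card T"
  shows "measure_pmf.expectation D (\<lambda>\<delta>. collision_poly m n b (r+1) (ind \<delta>))
     \<le> d * (fact (r+1) * exp 4 + fact (2*r) * exp 3)"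
    and "integrable (measure_pmf D) (\<lambda>\<delta>. collision_poly m n b (r+1) (ind \<delta>))"
proof -
  have bdd: "AE \<delta> in measure_pmf M. \<forall>a\<in>entries m n. \<bar>ind \<delta> a\<bar> \<le> 1" for M by simp
  note poly = polyfun_collision[OF b(1), of m n "r+1"]
  show "integrable (measure_pmf D) (\<lambda>\<delta>. collision_poly m n b (r+1) (ind \<delta>))"
    by (rule integrable_polyfun[OF bdd poly])
  let ?B = "bern_rows m n p"
  \<comment> \<open>Indicators are idempotent, so repeated variables collapse and the moment
    condition for the underlying set applies.\<close>
  have mon: "prod_list (map (ind \<delta>) xs) = (\<Prod>(i, j)\<in>set xs. of_bool (\<delta> i j))" for \<delta> xs
  proof (induction xs)
    case (Cons a xs)
    show ?case
    proof (cases "a \<in> set xs")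
      case True
      hence "(\<Prod>(i, j)\<in>set xs. of_bool (\<delta> i j) :: real) = of_bool (\<delta> (fst a) (snd a)) * (\<Prod>(i, j)\<in>set xs - {a}. of_bool (\<delta> i j))"
        by (subst prod.remove[of _ a]) (auto simp: case_prod_unfold)
      thus ?thesis using True Cons by (simp add: insert_absorb)
    next
      case False
      thus ?thesis using Cons by (simp add: case_prod_unfold)
    qed
  qed simp
  have "measure_pmf.expectation D (\<lambda>\<delta>. collision_poly m n b (r+1) (ind \<delta>))
      \<le> measure_pmf.expectation ?B (\<lambda>\<delta>. collision_poly m n b (r+1) (ind \<delta>))"
  proof (rule polyfun_expectation_mono[OF bdd bdd _ poly])
    fix xs :: "(nat \<times> nat) list"
    assume xs: "set xs \<subseteq> entries m n" "length xs \<le> 2 * (r + 1)"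
    have "card (set xs) \<le> 2 * (r + 1)" using card_length[of xs] xs(2) by linarith
    from D[OF xs(1) this] bern_rows_monomial[OF p(1,2), of "set xs" m n] xs(1)
    show "measure_pmf.expectation D (\<lambda>\<delta>. prod_list (map (ind \<delta>) xs)) \<le> measure_pmf.expectation ?B (\<lambda>\<delta>. prod_list (map (ind \<delta>) xs))"
      unfolding mon entries_def by simp
  qed
  also have "\<dots> = (\<Sum>i<n. measure_pmf.expectation ?B
        (\<lambda>\<delta>. (\<Sum>\<rho><m. of_bool (\<delta> \<rho> i) * row_weight n b i (\<lambda>j. of_bool (\<delta> \<rho> j))) ^ (r+1)) * b i)
      + (\<Sum>\<rho><m. measure_pmf.expectation ?B (\<lambda>\<delta>. row_pairs n b (\<lambda>j. of_bool (\<delta> \<rho> j)) ^ (r+1)))"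
    unfolding collision_poly_def fst_conv snd_conv
    by (subst Bochner_Integration.integral_add[OF integrable_bern_rows integrable_bern_rows],
        subst (1 2) Bochner_Integration.integral_sum[OF integrable_bern_rows]) simp
  also have "\<dots> \<le> (\<Sum>i<n. (fact (r+1) * exp 4) * b i) + (\<Sum>\<rho><m. fact (2 * r) * exp 3 * (p\<^sup>2 * d\<^sup>2))"
  proof (intro add_mono sum_mono mult_right_mono)
    fix i assume "i \<in> {..<n}"
    thus "measure_pmf.expectation ?B (\<lambda>\<delta>. (\<Sum>\<rho><m. of_bool (\<delta> \<rho> i) * row_weight n b i (\<lambda>j. of_bool (\<delta> \<rho> j))) ^ (r+1))
        \<le> fact (r+1) * exp 4"
      by (intro column_moment[OF b bd p(1,2,3) _ p(4)]) auto
  next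
    fix \<rho> assume "\<rho> \<in> {..<m}"
    hence "measure_pmf.expectation ?B (\<lambda>\<delta>. row_pairs n b (\<lambda>j. of_bool (\<delta> \<rho> j)) ^ (r+1))
        = measure_pmf.expectation (bern_row n p) (\<lambda>y. row_pairs n b (\<lambda>j. of_bool (y j)) ^ (r+1))"
      by (intro expectation_bern_rows_component[of \<rho> m n p "\<lambda>y. row_pairs n b (\<lambda>j. of_bool (y j)) ^ (r+1)"]) auto
    also have "\<dots> \<le> fact (2 * r) * exp 3 * (p\<^sup>2 * d\<^sup>2)"
      using row_moment[OF b bd p(1,2,3), of r] by simp
    finally show "measure_pmf.expectation ?B (\<lambda>\<delta>. row_pairs n b (\<lambda>j. of_bool (\<delta> \<rho> j)) ^ (r+1))
        \<le> fact (2 * r) * exp 3 * (p\<^sup>2 * d\<^sup>2)" .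
  qed (rule b)
  \<comment> \<open>The sum over all rows is regrouped so that \<open>m\<close> appears only in
    \<open>m * p\<^sup>2 * d\<close>, and a single factor \<open>d\<close> remains outside.\<close>
  also have "\<dots> = d * (fact (r+1) * exp 4) + (fact (2*r) * exp 3 * d) * (real m * p\<^sup>2 * d)"
    unfolding sum_distrib_left[symmetric] bd by (simp add: power2_eq_square mult_ac)
  also have "\<dots> \<le> d * (fact (r+1) * exp 4) + (fact (2*r) * exp 3 * d) * 1"
  proof (intro add_left_mono mult_left_mono p(4) mult_nonneg_nonneg)
    show "0 \<le> d" unfolding bd[symmetric] by (intro sum_nonneg b)
  qed auto
  finally show "measure_pmf.expectation D (\<lambda>\<delta>. collision_poly m n b (r+1) (ind \<delta>))
     \<le> d * (fact (r+1) * exp 4 + fact (2*r) * exp 3)" by (simp only: distrib_left mult_1_right mult_ac)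
qed

subsection \<open>The sketched matrix\<close>

lemma polyfun_mat_pow:
  assumes "\<And>x y. polyfun E UNIV g (\<lambda>\<sigma>. Z \<sigma> x y)"
  shows "polyfun E UNIV (g * q) (\<lambda>\<sigma>. mat_pow I (Z \<sigma>) q x y)"
proof (induction q arbitrary: x y)
  case 0
  show ?case by (simp add: polyfun_const)
next
  case (Suc q)
  have "polyfun E UNIV (g + g * q) (\<lambda>\<sigma>. \<Sum>z\<in>I. Z \<sigma> x z * mat_pow I (Z \<sigma>) q z y)"
    by (intro polyfun_sum polyfun_mult assms Suc) auto
  thus ?case by simp
qed

lemma polyfun_chaos: "polyfun S UNIV 2 (\<lambda>\<sigma>. chaos S u s \<sigma> x y)"
proof -
  have row: "polyfun S UNIV 1 (\<lambda>\<sigma>. row_vec S u \<sigma> \<rho> x)" for \<rho> x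
  proof -
    have "polyfun S UNIV 1 (\<lambda>\<sigma>. \<Sum>a\<in>{a\<in>S. fst a = \<rho>}. u (snd a) x * \<sigma> a)"
      by (intro polyfun_sum polyfun_cmult polyfun_var) auto
    thus ?thesis by (simp only: row_vec_def mult.commute)
  qed
  have "polyfun S UNIV (1 + 1) (\<lambda>\<sigma>. 1 / s * ((\<Sum>\<rho>\<in>fst ` S. row_vec S u \<sigma> \<rho> x * row_vec S u \<sigma> \<rho> y)
     + - (\<Sum>a\<in>S. u (snd a) x * u (snd a) y)))"
    by (intro polyfun_cmult polyfun.add polyfun_sum polyfun_mult row polyfun_const) auto
  thus ?thesis by (simp add: chaos_def[abs_def] numeral_2_eq_2)
qed

lemma polyfun_tr_pow_chaos: "polyfun S UNIV (2 * q) (\<lambda>\<sigma>. tr_pow I (chaos S u s \<sigma>) q)"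
  unfolding tr_pow_def by (intro polyfun_sum polyfun_mat_pow polyfun_chaos) auto

text \<open>An eigenvector of \<open>M\<close> has a nonzero coefficient at some eigenvector of
  \<open>B\<close>, so \<mu> - 1 is an eigenvalue of \<open>B\<close>. Its even power is one of the
  nonnegative terms of the trace.\<close>

lemma eigenvalue_tr_pow:
  assumes M: "M \<in> carrier_mat d d" and B: "symm_on {..<d} B"
    and eq: "\<And>x y. x < d \<Longrightarrow> y < d \<Longrightarrow> M $$ (x, y) = of_bool (x = y) + B x y"
    and ev: "eigenvalue M \<mu>"
  shows "(\<mu> - 1) ^ (2 * q) \<le> tr_pow {..<d} B (2 * q)"
proof -
  let ?I = "{..<d}"
  from ev M obtain w where w: "w \<in> carrier_vec d" "w \<noteq> 0\<^sub>v d" "M *\<^sub>v w = \<mu> \<cdot>\<^sub>v w"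
    unfolding eigenvalue_def eigenvector_def by auto
  define v where "v = (\<lambda>x. w $ x)"
  have Bv: "apply_on ?I B v x = (\<mu> - 1) * v x" if x: "x \<in> ?I" for x
  proof -
    have "\<mu> * v x = (M *\<^sub>v w) $ x" using w x by (simp add: v_def)
    also have "\<dots> = (\<Sum>y\<in>?I. M $$ (x, y) * v y)"
      using w(1) M x by (simp add: mult_mat_vec_def scalar_prod_def v_def lessThan_atLeast0)
    also have "\<dots> = (\<Sum>y\<in>?I. (if y = x then v y else 0) + B x y * v y)"
      by (intro sum.cong refl) (use x eq in \<open>auto simp: algebra_simps\<close>)
    also have "\<dots> = v x + apply_on ?I B v x"
      using x by (simp add: sum.distrib apply_on_def)
    finally show ?thesis by (simp add: algebra_simps)
  qed
  obtain e l where E: "eigensystem ?I B e l" by (rule spectral_theorem[OF _ B]) auto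
  have "\<exists>k\<in>?I. inner_on ?I (e k) v \<noteq> 0"
  proof (rule ccontr)
    assume "\<not> ?thesis"
    hence "inner_on ?I v v = 0" using eigensystem_Parseval_square[OF _ E, of v] by simp
    hence "\<forall>x\<in>?I. v x = 0" by (simp add: inner_on_self_eq_0_iff)
    hence "w = 0\<^sub>v d" using w(1) by (intro eq_vecI) (auto simp: v_def)
    thus False using w(2) by simp
  qed
  then obtain k where k: "k \<in> ?I" "inner_on ?I (e k) v \<noteq> 0" by auto
  have "(\<mu> - 1) * inner_on ?I (e k) v = inner_on ?I (e k) (apply_on ?I B v)"
    unfolding inner_on_scale_right[symmetric] by (rule inner_on_cong) (use Bv in auto)
  also have "\<dots> = inner_on ?I (apply_on ?I B (e k)) v" by (rule inner_on_apply_symm[OF B])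
  also have "\<dots> = l k * inner_on ?I (e k) v"
    unfolding inner_on_scale_left[symmetric] by (rule inner_on_cong) (use eigensystem_eq[OF E k(1)] in auto)
  finally have "\<mu> - 1 = l k" using k(2) by simp
  moreover have "l k ^ (2 * q) \<le> (\<Sum>k\<in>?I. l k ^ (2 * q))"
    by (rule member_le_sum) (use k in \<open>auto simp: power_mult\<close>)
  ultimately show ?thesis by (simp add: tr_pow_eigensystem[OF _ E])
qed

context
  fixes m n d s :: nat and U :: "real mat" and \<delta> :: "nat \<Rightarrow> nat \<Rightarrow> bool"
    and u :: "nat \<Rightarrow> nat \<Rightarrow> real"
  assumes U: "U \<in> carrier_mat n d" "transpose_mat U * U = 1\<^sub>m d"
    and u: "\<And>i x. u i x = U $$ (i, x)"
begin

lemma orthonormal_columns: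
  assumes "x < d" "y < d"
  shows "(\<Sum>i<n. u i x * u i y) = of_bool (x = y)"
proof -
  have "(\<Sum>i<n. u i x * u i y) = (transpose_mat U * U) $$ (x, y)"
    using U(1) assms by (simp add: scalar_prod_def u lessThan_atLeast0)
  also have "\<dots> = of_bool (x = y)" unfolding U(2) using assms by simp
  finally show ?thesis .
qed

text \<open>Orthonormal columns make the rows a Parseval frame; this is the Bessel condition on the
  vectors \<open>u i\<close>.\<close>

lemma rows_Parseval: "(\<Sum>i<n. (inner_on {..<d} (u i) v)\<^sup>2) = inner_on {..<d} v v"
proof -
  have "(\<Sum>i<n. (inner_on {..<d} (u i) v)\<^sup>2) = (\<Sum>i<n. \<Sum>x<d. \<Sum>y<d. v x * v y * (u i x * u i y))"
    unfolding inner_on_def power2_eq_square sum_product by (simp add: mult_ac)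
  also have "\<dots> = (\<Sum>x<d. \<Sum>i<n. \<Sum>y<d. v x * v y * (u i x * u i y))" by (rule sum.swap)
  also have "\<dots> = (\<Sum>x<d. \<Sum>y<d. \<Sum>i<n. v x * v y * (u i x * u i y))"
    by (rule sum.cong[OF refl], rule sum.swap)
  also have "\<dots> = (\<Sum>x<d. \<Sum>y<d. if y = x then v x * v y else 0)"
    unfolding sum_distrib_left[symmetric] by (intro sum.cong refl) (simp add: orthonormal_columns)
  also have "\<dots> = inner_on {..<d} v v" by (simp add: inner_on_def)
  finally show ?thesis .
qed

lemma sum_row_norms: "(\<Sum>i<n. inner_on {..<d} (u i) (u i)) = real d"
proof -
  have "(\<Sum>i<n. inner_on {..<d} (u i) (u i)) = (\<Sum>x<d. \<Sum>i<n. u i x * u i x)"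
    unfolding inner_on_def by (rule sum.swap)
  thus ?thesis by (simp add: orthonormal_columns)
qed

text \<open>Parseval tested on the row itself: its squared norm \<open>b\<close> satisfies
  \<open>b\<^sup>2 \<le> b\<close>.\<close>

lemma row_norm_le_1:
  assumes "i < n"
  shows "inner_on {..<d} (u i) (u i) \<le> 1"
proof -
  let ?b = "inner_on {..<d} (u i) (u i)"
  have "?b\<^sup>2 \<le> (\<Sum>j<n. (inner_on {..<d} (u j) (u i))\<^sup>2)"
    by (rule member_le_sum) (use assms in auto)
  hence "?b\<^sup>2 \<le> ?b" by (simp only: rows_Parseval)
  hence "?b * ?b \<le> 1 * ?b" by (simp add: power2_eq_square)
  thus ?thesis using inner_on_self_nonneg[of "{..<d}" "u i"] by (cases "?b = 0") (auto simp: mult_le_cancel_right)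
qed

text \<open>The diagonal terms of the Gram matrix do not depend on the signs. With exactly
  \<open>s\<close> entries in each column they add up to \<open>s\<close> times the Gram matrix of
  U, which is the identity; everything else is the chaos.\<close>

lemma sketch_gram:
  fixes \<tau> :: "nat \<times> nat \<Rightarrow> real"
  assumes s: "s > 0" and col: "\<And>j. j < n \<Longrightarrow> (\<Sum>i<m. of_bool (\<delta> i j)) = s"
    and x: "x < d" and y: "y < d"
  defines "A \<equiv> sketch_matrix m n s \<delta> (\<lambda>i j. \<tau> (i, j))"
  shows "(transpose_mat (A * U) * (A * U)) $$ (x, y) = of_bool (x = y) + chaos (supp m n \<delta>) u (real s) \<tau> x y"
proof -
  let ?S = "supp m n \<delta>"
  have A: "A \<in> carrier_mat m n" by (simp add: A_def sketch_matrix_def)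
  have AU: "(A * U) $$ (\<rho>, x) = row_vec ?S u \<tau> \<rho> x / sqrt (real s)" if "\<rho> < m" "x < d" for \<rho> x
  proof -
    have "(A * U) $$ (\<rho>, x) = (\<Sum>i<n. A $$ (\<rho>, i) * u i x)"
      using A U(1) that by (simp add: scalar_prod_def u lessThan_atLeast0)
    also have "\<dots> = (\<Sum>i<n. of_bool (\<delta> \<rho> i) * (\<tau> (\<rho>, i) * u i x) / sqrt (real s))"
      by (intro sum.cong refl) (use that in \<open>auto simp: A_def sketch_matrix_def\<close>)
    also have "\<dots> = row_vec ?S u \<tau> \<rho> x / sqrt (real s)"
      unfolding row_vec_def sum_supp_row[OF that(1)] by (simp only: sum_divide_distrib snd_conv)
    finally show ?thesis .
  qed
  have "(transpose_mat (A * U) * (A * U)) $$ (x, y) = (\<Sum>\<rho><m. (A * U) $$ (\<rho>, x) * (A * U) $$ (\<rho>, y))"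
    using A U(1) x y by (simp add: scalar_prod_def lessThan_atLeast0)
  also have "\<dots> = (\<Sum>\<rho><m. row_vec ?S u \<tau> \<rho> x * row_vec ?S u \<tau> \<rho> y / real s)"
    by (intro sum.cong refl) (use x y in \<open>simp add: AU\<close>)
  also have "\<dots> = (\<Sum>\<rho><m. row_vec ?S u \<tau> \<rho> x * row_vec ?S u \<tau> \<rho> y) / real s"
    by (simp add: sum_divide_distrib)
  \<comment> \<open>Rows without nonzero entries contribute 0, so the sum may be restricted to the
    occupied rows used by \<open>chaos\<close>.\<close>
  also have "(\<Sum>\<rho><m. row_vec ?S u \<tau> \<rho> x * row_vec ?S u \<tau> \<rho> y)
      = (\<Sum>\<rho>\<in>fst ` ?S. row_vec ?S u \<tau> \<rho> x * row_vec ?S u \<tau> \<rho> y)"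
  proof (rule sum.mono_neutral_right)
    show "\<forall>\<rho>\<in>{..<m} - fst ` ?S. row_vec ?S u \<tau> \<rho> x * row_vec ?S u \<tau> \<rho> y = 0"
    proof
      fix \<rho> assume "\<rho> \<in> {..<m} - fst ` ?S"
      hence "{a\<in>?S. fst a = \<rho>} = {}" using imageI[of _ ?S fst] by blast
      thus "row_vec ?S u \<tau> \<rho> x * row_vec ?S u \<tau> \<rho> y = 0" by (simp only: row_vec_def sum.empty)
    qed
  qed (auto simp: supp_def entries_def)
  finally have 1: "(transpose_mat (A * U) * (A * U)) $$ (x, y) =
      (\<Sum>\<rho>\<in>fst ` ?S. row_vec ?S u \<tau> \<rho> x * row_vec ?S u \<tau> \<rho> y) / real s" .
  have "(\<Sum>a\<in>?S. u (snd a) x * u (snd a) y) = (\<Sum>\<rho><m. \<Sum>i<n. of_bool (\<delta> \<rho> i) * (u i x * u i y))"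
    unfolding sum_supp snd_conv ..
  also have "\<dots> = (\<Sum>i<n. \<Sum>\<rho><m. of_bool (\<delta> \<rho> i) * (u i x * u i y))" by (rule sum.swap)
  also have "\<dots> = (\<Sum>i<n. real s * (u i x * u i y))"
  proof (rule sum.cong[OF refl])
    fix i assume "i \<in> {..<n}"
    hence "real s = real (\<Sum>\<rho><m. of_bool (\<delta> \<rho> i))" using col[of i] by simp
    also have "\<dots> = (\<Sum>\<rho><m. of_bool (\<delta> \<rho> i))" by (simp only: of_nat_sum of_nat_of_bool)
    finally show "(\<Sum>\<rho><m. of_bool (\<delta> \<rho> i) * (u i x * u i y)) = real s * (u i x * u i y)"
      by (simp only: sum_distrib_right)
  qed
  also have "\<dots> = real s * of_bool (x = y)"
    unfolding sum_distrib_left[symmetric] orthonormal_columns[OF x y] ..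
  finally show ?thesis
    unfolding 1 chaos_def using s by (simp add: diff_divide_distrib)
qed

text \<open>If \<mu> is within \<epsilon> of 1, so is its square root, because
  \<open>(1 - \<epsilon>)\<^sup>2 \<le> 1 - \<epsilon>\<close> and
  \<open>1 + \<epsilon> \<le> (1 + \<epsilon>)\<^sup>2\<close>. A bad singular value thus comes from
  an eigenvalue of the chaos exceeding \<epsilon> in absolute value.\<close>

lemma sketch_failure:
  assumes s: "s > 0" and col: "\<And>j. j < n \<Longrightarrow> (\<Sum>i<m. of_bool (\<delta> i j)) = s"
    and \<epsilon>: "0 < \<epsilon>" "\<epsilon> < 1" and q: "q > 0"
    and bad: "\<not> singular_values (sketch_matrix m n s \<delta> (\<lambda>i j. \<tau> (i, j)) * U) \<subseteq> {1 - \<epsilon>..1 + \<epsilon>}"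
  shows "\<epsilon> ^ (2 * q) \<le> tr_pow {..<d} (chaos (supp m n \<delta>) u (real s) \<tau>) (2 * q)"
proof -
  let ?A = "sketch_matrix m n s \<delta> (\<lambda>i j. \<tau> (i, j))" and ?Z = "chaos (supp m n \<delta>) u (real s) \<tau>"
  from bad obtain \<mu> where ev: "eigenvalue (transpose_mat (?A * U) * (?A * U)) \<mu>"
    and out: "sqrt \<mu> \<notin> {1 - \<epsilon>..1 + \<epsilon>}" unfolding singular_values_def by blast
  have "\<bar>\<mu> - 1\<bar> > \<epsilon>"
  proof (rule ccontr)
    assume "\<not> ?thesis"
    hence \<mu>: "1 - \<epsilon> \<le> \<mu>" "\<mu> \<le> 1 + \<epsilon>" by (auto simp: abs_if split: if_splits)
    have "(1 - \<epsilon>)\<^sup>2 \<le> 1 - \<epsilon>" using \<epsilon> by (simp add: power2_eq_square mult_left_le)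
    hence "1 - \<epsilon> \<le> sqrt \<mu>" using \<mu>(1) by (intro real_le_rsqrt) linarith
    moreover have "1 + \<epsilon> \<le> (1 + \<epsilon>)\<^sup>2" using \<epsilon> by (simp add: power2_eq_square algebra_simps)
    hence "sqrt \<mu> \<le> 1 + \<epsilon>" using \<mu>(2) \<epsilon> by (intro real_le_lsqrt) linarith+
    ultimately show False using out by simp
  qed
  hence "\<epsilon> ^ (2 * q) \<le> \<bar>\<mu> - 1\<bar> ^ (2 * q)" using \<epsilon> by (intro power_mono) auto
  also have "\<dots> = (\<mu> - 1) ^ (2 * q)" by (simp add: power_even_abs)
  also have "\<dots> \<le> tr_pow {..<d} ?Z (2 * q)"
  proof (rule eigenvalue_tr_pow[OF _ _ _ ev])
    show "transpose_mat (?A * U) * (?A * U) \<in> carrier_mat d d"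
      using U(1) by auto
    show "symm_on {..<d} ?Z" by (simp add: symm_on_def chaos_def mult.commute)
  qed (rule sketch_gram[OF s col])
  finally show ?thesis .
qed

lemma sketch_moment:
  assumes s: "s > 0"
  defines "b \<equiv> \<lambda>i. inner_on {..<d} (u i) (u i)"
  shows "sign_avg (supp m n \<delta>) (\<lambda>\<tau>. tr_pow {..<d} (chaos (supp m n \<delta>) u (real s) \<tau>) (2 * (r+1)))
    \<le> (4 * (real (2*r+1))\<^sup>2 / (real s)\<^sup>2) ^ (r+1) * collision_poly m n b (r+1) (ind \<delta>)"
proof -
  let ?S = "supp m n \<delta>"
  have b0: "0 \<le> b i" for i by (simp add: b_def)
  have "sign_avg ?S (\<lambda>\<tau>. tr_pow {..<d} (chaos ?S u (real s) \<tau>) (2 * (r+1)))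
     \<le> (4 * (real (2*r+1))\<^sup>2 / (real s)\<^sup>2) ^ (r+1) * ((\<Sum>i<n. col_collide ?S b i ^ (r+1) * b i)
          + (\<Sum>\<rho>\<in>fst ` ?S. row_collide ?S b \<rho> ^ (r+1)))"
    by (rule chaos_moment) (use s in \<open>auto simp: finite_supp supp_def entries_def b_def rows_Parseval\<close>)
  also have "\<dots> \<le> (4 * (real (2*r+1))\<^sup>2 / (real s)\<^sup>2) ^ (r+1) * collision_poly m n b (r+1) (ind \<delta>)"
  proof (intro mult_left_mono)
    have "(\<Sum>\<rho>\<in>fst ` ?S. row_collide ?S b \<rho> ^ (r+1)) \<le> (\<Sum>\<rho><m. row_collide ?S b \<rho> ^ (r+1))"
    proof (intro sum_mono2)
      show "0 \<le> row_collide ?S b \<rho> ^ (r+1)" for \<rho>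
        unfolding row_collide_def collide_def by (intro zero_le_power sum_nonneg mult_nonneg_nonneg b0)
    qed (auto simp: supp_def entries_def)
    also have "\<dots> = (\<Sum>\<rho><m. row_pairs n b (\<lambda>j. of_bool (\<delta> \<rho> j)) ^ (r+1))"
      by (intro sum.cong refl) (simp only: row_collide_supp lessThan_iff)
    also have "(\<Sum>i<n. col_collide ?S b i ^ (r+1) * b i)
        = (\<Sum>i<n. (\<Sum>\<rho><m. of_bool (\<delta> \<rho> i) * row_weight n b i (\<lambda>j. of_bool (\<delta> \<rho> j))) ^ (r+1) * b i)"
      by (intro sum.cong refl) (simp only: col_collide_supp lessThan_iff)
    ultimately show "(\<Sum>i<n. col_collide ?S b i ^ (r+1) * b i) + (\<Sum>\<rho>\<in>fst ` ?S. row_collide ?S b \<rho> ^ (r+1))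
        \<le> collision_poly m n b (r+1) (ind \<delta>)"
      unfolding collision_poly_def fst_conv snd_conv by linarith
  qed (use s in auto)
  finally show ?thesis .
qed

end

section \<open>Failure probability and choice of constants\<close>

lemma tr_pow_even_nonneg:
  assumes "finite I" "symm_on I A"
  shows "0 \<le> tr_pow I A (2 * q)"
proof -
  obtain e l where "eigensystem I A e l" by (rule spectral_theorem[OF assms])
  from tr_pow_eigensystem[OF assms(1) this] show ?thesis
    by (simp add: power_mult sum_nonneg)
qed

text \<open>Markov's inequality for the trace at fixed positions. The chaos has degree 2 in the
  signs, so its power \<open>2 * (r + 1)\<close> has degree \<open>4 * (r + 1)\<close>, and
  independence of that order reproduces the average over independent signs. Injectivity of
  \<open>sloc\<close> on the support gives distinct nonzero entries distinct signs.\<close>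

lemma conditional_failure:
  fixes Sg :: "(nat \<times> nat \<Rightarrow> real) pmf"
  assumes U: "U \<in> carrier_mat n d" "transpose_mat U * U = 1\<^sub>m d"
    and s: "s > 0" and col: "\<And>j. j < n \<Longrightarrow> (\<Sum>i<m. of_bool (\<delta> i j)) = s"
    and \<epsilon>: "0 < \<epsilon>" "\<epsilon> < 1" and k: "4 * (r + 1) \<le> k"
    and inj: "inj_on (case_prod sloc) (supp m n \<delta>)"
    and kw: "kwise_independent k (case_prod sloc ` entries m n) {-1, 1} Sg"
  defines "b \<equiv> \<lambda>i. inner_on {..<d} (\<lambda>x. U $$ (i, x)) (\<lambda>x. U $$ (i, x))"
  shows "measure_pmf.prob Sg
      {\<sigma>. \<not> singular_values (sketch_matrix m n s \<delta> (\<lambda>i j. \<sigma> (sloc i j)) * U) \<subseteq> {1 - \<epsilon>..1 + \<epsilon>}}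
    \<le> (4 * (real (2*r+1))\<^sup>2 / (real s)\<^sup>2) ^ (r+1) * collision_poly m n b (r+1) (ind \<delta>) / \<epsilon> ^ (2 * (r + 1))"
    (is "measure_pmf.prob Sg ?Bad \<le> _")
proof -
  let ?S = "supp m n \<delta>" and ?u = "\<lambda>i x. U $$ (i, x)" and ?g = "case_prod sloc"
  define T where "T = (\<lambda>\<tau>. tr_pow {..<d} (chaos ?S ?u (real s) \<tau>) (2 * (r + 1)))"
  have poly: "polyfun ?S UNIV k T"
    unfolding T_def by (rule polyfun_mono[OF polyfun_tr_pow_chaos]) (use k in auto)
  have g: "?g ` ?S \<subseteq> ?g ` entries m n" by (intro image_mono) (auto simp: supp_def)
  note E = kwise_sign_expectation[OF kw finite_supp inj g poly]
  have T0: "0 \<le> T \<tau>" for \<tau>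
    unfolding T_def by (rule tr_pow_even_nonneg) (auto simp: symm_on_def chaos_def mult.commute)
  have ind: "indicator ?Bad \<sigma> \<le> T (\<lambda>a. \<sigma> (?g a)) / \<epsilon> ^ (2 * (r + 1))" for \<sigma>
  proof (cases "\<sigma> \<in> ?Bad")
    case True
    have "\<epsilon> ^ (2 * (r+1)) \<le> T (\<lambda>a. \<sigma> (?g a))"
      unfolding T_def
      by (rule sketch_failure[OF U refl s col \<epsilon>, where \<tau> = "\<lambda>a. \<sigma> (?g a)"]) (use True in auto)
    thus ?thesis using True \<epsilon> by (simp add: le_divide_eq)
  next
    case False
    thus ?thesis using T0 \<epsilon> by simp
  qed
  have "measure_pmf.prob Sg ?Bad = measure_pmf.expectation Sg (indicator ?Bad)" by simp
  also have "\<dots> \<le> measure_pmf.expectation Sg (\<lambda>\<sigma>. T (\<lambda>a. \<sigma> (?g a)) / \<epsilon> ^ (2 * (r + 1)))"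
    using ind E(2) by (intro integral_mono) (auto intro: measure_pmf.integrable_const_bound[where B = 1])
  also have "\<dots> = sign_avg ?S T / \<epsilon> ^ (2 * (r + 1))" using E(1) by simp
  also have "\<dots> \<le> (4 * (real (2*r+1))\<^sup>2 / (real s)\<^sup>2) ^ (r+1) * collision_poly m n b (r+1) (ind \<delta>) / \<epsilon> ^ (2 * (r + 1))"
    unfolding T_def b_def
    by (intro divide_right_mono sketch_moment[OF U refl s]) (use \<epsilon> in simp)
  finally show ?thesis .
qed

text \<open>Positions and signs are independent, so the failure probability is the average over the
  positions of the conditional one. The hypotheses on \<open>D\<close> are those shared by general
  and hashed positions: almost sure statements and moments up to order \<open>k\<close>.\<close>

lemma sketch_failure_probability:
  fixes Sg :: "(nat \<times> nat \<Rightarrow> real) pmf"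
  assumes U: "U \<in> carrier_mat n d" "transpose_mat U * U = 1\<^sub>m d"
    and s: "s > 0" and \<epsilon>: "0 < \<epsilon>" "\<epsilon> < 1" and k: "4 * (r + 1) \<le> k"
    and p: "s \<le> m" "2 * (real s / real m) * real d \<le> 1" "real m * (real s / real m)\<^sup>2 * real d \<le> 1"
    and col: "\<And>j. j < n \<Longrightarrow> AE \<delta> in measure_pmf D. (\<Sum>i<m. of_bool (\<delta> i j)) = s"
    and mom: "\<And>T. T \<subseteq> entries m n \<Longrightarrow> card T \<le> k \<Longrightarrow>
       measure_pmf.expectation D (\<lambda>\<delta>. \<Prod>(i, j)\<in>T. of_bool (\<delta> i j)) \<le> (real s / real m) ^ card T"
    and inj: "AE \<delta> in measure_pmf D. inj_on (case_prod sloc) (supp m n \<delta>)"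
    and kw: "kwise_independent k (case_prod sloc ` entries m n) {-1, 1} Sg"
  shows "measure_pmf.prob
      (map_pmf (\<lambda>(\<delta>, \<sigma>). sketch_matrix m n s \<delta> (\<lambda>i j. \<sigma> (sloc i j))) (pair_pmf D Sg))
      {A. \<not> singular_values (A * U) \<subseteq> {1 - \<epsilon>..1 + \<epsilon>}}
    \<le> (4 * (real (2*r+1))\<^sup>2 / (real s)\<^sup>2) ^ (r+1)
        * (real d * (fact (r+1) * exp 4 + fact (2*r) * exp 3)) / \<epsilon> ^ (2 * (r + 1))"
    (is "measure_pmf.prob ?P ?Bad \<le> ?R")
proof -
  define b where "b = (\<lambda>i. inner_on {..<d} (\<lambda>x. U $$ (i, x)) (\<lambda>x. U $$ (i, x)))"
  define K where "K = (4 * (real (2*r+1))\<^sup>2 / (real s)\<^sup>2) ^ (r+1) / \<epsilon> ^ (2 * (r + 1))"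
  define F where "F = (\<lambda>\<delta>. collision_poly m n b (r+1) (ind \<delta>))"
  have K0: "0 \<le> K" using \<epsilon> by (simp add: K_def)
  have b0: "0 \<le> b i" for i by (simp add: b_def)
  have b1: "b i \<le> 1" if "i < n" for i
    unfolding b_def by (rule row_norm_le_1[OF U refl that])
  have bd: "(\<Sum>i<n. b i) = real d"
    unfolding b_def by (rule sum_row_norms[OF U refl])
  have F0: "0 \<le> F \<delta>" for \<delta>
    unfolding F_def collision_poly_def row_pairs_def row_weight_def
    by (intro add_nonneg_nonneg sum_nonneg mult_nonneg_nonneg zero_le_power b0) auto
  have EF: "measure_pmf.expectation D F \<le> real d * (fact (r+1) * exp 4 + fact (2*r) * exp 3)"
    "integrable (measure_pmf D) F"
    unfolding F_def
    by (rule collision_expectation[OF b0 b1 bd, of "real s / real m"];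
        use s p mom k in \<open>simp add: divide_le_eq_1\<close>)+
  have "AE \<delta> in measure_pmf D. \<forall>j\<in>{..<n}. (\<Sum>i<m. of_bool (\<delta> i j)) = s"
    by (rule AE_finite_allI) (use col in auto)
  hence good: "AE \<delta> in measure_pmf D. measure_pmf.prob Sg
      {\<sigma>. \<not> singular_values (sketch_matrix m n s \<delta> (\<lambda>i j. \<sigma> (sloc i j)) * U) \<subseteq> {1 - \<epsilon>..1 + \<epsilon>}} \<le> K * F \<delta>"
    using inj
  proof eventually_elim
    case (elim \<delta>)
    show ?case
      using conditional_failure[OF U s _ \<epsilon> k elim(2) kw] elim(1)
      by (simp add: K_def F_def b_def)
  qed
  have P: "?P = bind_pmf D (\<lambda>\<delta>. map_pmf (\<lambda>\<sigma>. sketch_matrix m n s \<delta> (\<lambda>i j. \<sigma> (sloc i j))) Sg)"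
    by (simp add: pair_pmf_def map_bind_pmf map_pmf_def bind_assoc_pmf bind_return_pmf)
  have "ennreal (measure_pmf.prob ?P ?Bad) = (\<integral>\<^sup>+\<delta>. ennreal (measure_pmf.prob Sg
      {\<sigma>. \<not> singular_values (sketch_matrix m n s \<delta> (\<lambda>i j. \<sigma> (sloc i j)) * U) \<subseteq> {1 - \<epsilon>..1 + \<epsilon>}}) \<partial>measure_pmf D)"
    unfolding P measure_pmf.emeasure_eq_measure[symmetric]
    by (simp add: emeasure_bind_pmf vimage_def)
  also have "\<dots> \<le> (\<integral>\<^sup>+\<delta>. ennreal (K * F \<delta>) \<partial>measure_pmf D)"
    by (rule nn_integral_mono_AE) (use good in \<open>auto intro: ennreal_leI elim!: eventually_mono\<close>)
  also have "\<dots> = ennreal (measure_pmf.expectation D (\<lambda>\<delta>. K * F \<delta>))"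
    by (rule nn_integral_eq_integral) (use EF(2) K0 F0 in auto)
  finally have "measure_pmf.prob ?P ?Bad \<le> measure_pmf.expectation D (\<lambda>\<delta>. K * F \<delta>)"
    using K0 F0 by (subst (asm) ennreal_le_iff) (auto intro!: integral_nonneg)
  also have "\<dots> \<le> K * (real d * (fact (r+1) * exp 4 + fact (2*r) * exp 3))"
    using EF(1) K0 by (simp add: mult_left_mono)
  finally show ?thesis by (simp add: K_def)
qed

text \<open>Both factorials are at most \<open>(4 * q\<^sup>2) ^ q\<close> for
  \<open>q = r + 1\<close>, so the bound is a power \<open>q\<close> of one ratio times
  \<open>2 * exp 4 * d\<close>. The lower bound on \<open>s\<close> makes the ratio at most
  \<open>exp (-6)\<close>. Since \<open>6 * q - 5 \<ge> q \<ge> L\<close>, this absorbs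
  \<open>2 * exp 4\<close> and leaves \<open>exp (- L)\<close> against
  \<open>d \<le> \<delta> * exp L\<close>.\<close>

lemma failure_bound_le:
  fixes L \<epsilon> \<delta> d s :: real
  assumes L: "1 \<le> L" "d / \<delta> \<le> exp L" and r: "L \<le> real (r + 1)" "real (r + 1) \<le> 2 * L"
    and pos: "0 < \<epsilon>" "0 < \<delta>" "0 \<le> d" and s: "32 * exp 3 * L ^ 3 / \<epsilon> \<le> s"
  shows "(4 * (real (2*r+1))\<^sup>2 / s\<^sup>2) ^ (r+1) * (d * (fact (r+1) * exp 4 + fact (2*r) * exp 3)) / \<epsilon> ^ (2 * (r + 1)) \<le> \<delta>"
proof -
  define q where "q = r + 1"
  have q: "1 \<le> real q" "L \<le> real q" "real q \<le> 2 * L" using r by (auto simp: q_def)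
  have s0: "0 < s"
  proof -
    have "0 < 32 * exp 3 * L ^ 3 / \<epsilon>" using L pos by auto
    thus ?thesis using s by linarith
  qed
  have f1: "fact q \<le> (4 * (real q)\<^sup>2) ^ q"
  proof -
    have "fact q \<le> real (q ^ q)" by (rule fact_le_power)
    also have "\<dots> = real q ^ q" by simp
    also have "\<dots> \<le> (4 * (real q)\<^sup>2) ^ q"
    proof (rule power_mono)
      have "real q * 1 \<le> real q * (4 * real q)" using q by (intro mult_left_mono) auto
      thus "real q \<le> 4 * (real q)\<^sup>2" by (simp add: power2_eq_square)
    qed simp
    finally show ?thesis .
  qed
  have f2: "fact (2 * r) \<le> (4 * (real q)\<^sup>2) ^ q"
  proof -
    have "fact (2 * r) \<le> (fact (2 * q) :: real)" by (rule fact_mono) (simp add: q_def)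
    also have "\<dots> \<le> real ((2 * q) ^ (2 * q))" by (rule fact_le_power)
    also have "\<dots> = (2 * real q) ^ (2 * q)" by simp
    also have "\<dots> = ((2 * real q)\<^sup>2) ^ q" by (rule power_mult)
    finally show ?thesis by (simp add: power_mult_distrib)
  qed
  have e34: "exp 3 \<le> (exp 4 :: real)" by simp
  have "fact q * exp 4 + fact (2*r) * exp 3 \<le> (4 * (real q)\<^sup>2) ^ q * exp 4 + (4 * (real q)\<^sup>2) ^ q * exp (4::real)"
    by (intro add_mono mult_mono f1 f2 e34) auto
  hence f: "fact q * exp 4 + fact (2*r) * exp 3 \<le> (4 * (real q)\<^sup>2) ^ q * (2 * exp (4::real))"
    by (simp add: mult_ac)
  have base: "4 * (real (2*r+1))\<^sup>2 / s\<^sup>2 * (4 * (real q)\<^sup>2) / \<epsilon>\<^sup>2 \<le> exp (- 6)"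
  proof -
    have "(real (2*r+1))\<^sup>2 \<le> (2 * real q)\<^sup>2" by (intro power_mono) (auto simp: q_def)
    hence "4 * (real (2*r+1))\<^sup>2 * (4 * (real q)\<^sup>2) \<le> 4 * (2 * real q)\<^sup>2 * (4 * (real q)\<^sup>2)"
      by (intro mult_right_mono mult_left_mono) auto
    also have "\<dots> = 64 * real q ^ 4" by (simp add: power2_eq_square power4_eq_xxxx)
    also have "\<dots> \<le> 64 * (2 * L) ^ 4" using q by (intro mult_left_mono power_mono) auto
    also have "\<dots> = 1024 * L ^ 4" by (simp add: power_mult_distrib)
    \<comment> \<open>The exponent is raised to match the square of the lower bound
      \<open>32 * exp 3 * L ^ 3\<close> for \<open>s * \<epsilon>\<close>; the constant 32 is the
      square root of 1024.\<close>
    also have "\<dots> \<le> 1024 * L ^ 6" using L by (intro mult_left_mono power_increasing) auto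
    also have "\<dots> = exp (-6) * (32 * exp 3 * L ^ 3)\<^sup>2"
    proof -
      have "exp (-6) * (exp 3 * exp 3) = (1::real)" by (simp add: exp_add[symmetric])
      hence "exp (-6) * (32 * exp 3 * L ^ 3)\<^sup>2 = 1 * (1024 * (L ^ 3 * L ^ 3))"
        by (simp add: power2_eq_square mult_ac)
      thus ?thesis by (simp add: power_add[symmetric])
    qed
    also have "\<dots> \<le> exp (-6) * (s * \<epsilon>)\<^sup>2"
      using s pos L by (intro mult_left_mono power_mono) (auto simp: field_simps)
    finally have "4 * (real (2*r+1))\<^sup>2 * (4 * (real q)\<^sup>2) \<le> exp (-6) * (s\<^sup>2 * \<epsilon>\<^sup>2)"
      by (simp only: power_mult_distrib)
    hence "4 * (real (2*r+1))\<^sup>2 * (4 * (real q)\<^sup>2) / (s\<^sup>2 * \<epsilon>\<^sup>2) \<le> exp (-6)"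
      using s0 pos by (subst pos_divide_le_eq) auto
    thus ?thesis by simp
  qed
  have "(4 * (real (2*r+1))\<^sup>2 / s\<^sup>2) ^ q * (d * (fact q * exp 4 + fact (2*r) * exp 3)) / \<epsilon> ^ (2 * q)
     \<le> (4 * (real (2*r+1))\<^sup>2 / s\<^sup>2) ^ q * (d * ((4 * (real q)\<^sup>2) ^ q * (2 * exp 4))) / \<epsilon> ^ (2 * q)"
    using pos by (intro divide_right_mono mult_left_mono f) auto
  also have "\<dots> = (4 * (real (2*r+1))\<^sup>2 / s\<^sup>2 * (4 * (real q)\<^sup>2) / \<epsilon>\<^sup>2) ^ q * (2 * exp 4 * d)"
    unfolding power_divide power_mult_distrib power_mult by (simp only: mult_ac times_divide_eq_left times_divide_eq_right)
  also have "\<dots> \<le> exp (-6) ^ q * (2 * exp 4 * d)"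
    using base pos s0 by (intro mult_right_mono power_mono) auto
  also have "\<dots> \<le> exp (- L) * d"
  proof -
    have "exp (-6) ^ q * (2 * exp 4) \<le> exp (-6) ^ q * (exp 1 * exp (4::real))"
      using exp_ge_add_one_self[of "1::real"] by (intro mult_left_mono mult_right_mono) auto
    also have "\<dots> = exp (5 - 6 * real q)"
      by (simp add: exp_of_nat_mult[symmetric] exp_add[symmetric])
    also have "\<dots> \<le> exp (- L)" using q by simp
    finally have "exp (-6) ^ q * (2 * exp 4) \<le> exp (- L)" .
    from mult_right_mono[OF this pos(3)] show ?thesis by (simp only: mult.assoc)
  qed
  also have "\<dots> \<le> exp (- L) * (\<delta> * exp L)"
    using L(2) pos by (intro mult_left_mono) (auto simp: field_simps)
  also have "\<dots> = \<delta>" by (simp add: exp_minus)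
  finally show ?thesis by (simp only: q_def)
qed

text \<open>For hashed positions the OSNAP conditions speak of an independent hash function. Moments
  of order at most \<open>k\<close> carry over to the one in use by limited independence. Column
  counts and injectivity carry over because they hold for every function with values in
  \<open>V\<close> on the inputs.\<close>

lemma osnap_sketch_failure:
  fixes P :: "real mat pmf"
  assumes P: "osnap_sketch k m n s P"
    and U: "U \<in> carrier_mat n d" "transpose_mat U * U = 1\<^sub>m d"
    and s: "s > 0" and \<epsilon>: "0 < \<epsilon>" "\<epsilon> < 1" and k: "4 * (r + 1) \<le> k"
    and p: "s \<le> m" "2 * (real s / real m) * real d \<le> 1" "real m * (real s / real m)\<^sup>2 * real d \<le> 1"
  shows "measure_pmf.prob P {A. \<not> singular_values (A * U) \<subseteq> {1 - \<epsilon>..1 + \<epsilon>}}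
    \<le> (4 * (real (2*r+1))\<^sup>2 / (real s)\<^sup>2) ^ (r+1)
        * (real d * (fact (r+1) * exp 4 + fact (2*r) * exp 3)) / \<epsilon> ^ (2 * (r + 1))"
  using P
proof cases
  case (general D Sg)
  have id: "case_prod Pair = (\<lambda>a::nat \<times> nat. a)" by auto
  show ?thesis
    unfolding general(1)
    by (rule sketch_failure_probability[OF U s \<epsilon> k p, where sloc = Pair])
       (use general in \<open>auto simp: osnap_indicators_def id\<close>)
next
  case (hashed V I loc hit sloc H Sg)
  define D where "D = map_pmf (hash_indicators loc hit) H"
  have I: "finite I" unfolding hashed(4) by (simp add: finite_entries)
  have HV: "h a \<in> V" if "h \<in> set_pmf H" "a \<in> I" for h a
  proof -
    have "set_pmf (map_pmf (\<lambda>h. h a) H) = V"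
      using hashed(2,3,7) that(2) by (simp add: kwise_independent_def)
    thus ?thesis using that(1) by auto
  qed
  have PD: "P = map_pmf (\<lambda>(\<delta>, \<sigma>). sketch_matrix m n s \<delta> (\<lambda>i j. \<sigma> (sloc i j))) (pair_pmf D Sg)"
    unfolding hashed(1) D_def pair_map_pmf1 map_pmf_comp
    by (intro map_pmf_cong refl) (auto simp: apfst_def map_prod_def)
  show ?thesis
    unfolding PD
  proof (rule sketch_failure_probability[OF U s \<epsilon> k p])
    fix j assume j: "j < n"
    have "(\<Sum>i<m. of_bool (hash_indicators loc hit h i j)) = s" if h: "h \<in> set_pmf H" for h
    proof -
      \<comment> \<open>The default value 0 of the \<open>Pi_pmf\<close> off the inputs has to be
        imposed before \<open>h\<close> can belong to its support. The indicators read
        \<open>h\<close> only at inputs in \<open>I\<close>.\<close>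
      define h' where "h' = (\<lambda>a. if a \<in> I then h a else 0)"
      have "h' \<in> set_pmf (Pi_pmf I 0 (\<lambda>_. pmf_of_set V))"
        using hashed(2,3) HV[OF h] by (auto simp: set_Pi_pmf[OF I] PiE_dflt_def h'_def)
      hence "(\<Sum>i<m. of_bool (hash_indicators loc hit h' i j)) = s"
        using hashed(5) j by (auto simp: osnap_indicators_def AE_measure_pmf_iff)
      moreover have "hash_indicators loc hit h' i j = hash_indicators loc hit h i j" if "i < m" for i
      proof -
        have "loc i j \<in> I" unfolding hashed(4) using that j by (force simp: entries_def)
        thus ?thesis by (simp add: hash_indicators_def h'_def)
      qed
      ultimately show ?thesis by simp
    qed
    thus "AE \<delta> in measure_pmf D. (\<Sum>i<m. of_bool (\<delta> i j)) = s"
      by (auto simp: D_def AE_measure_pmf_iff)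
  next
    fix T assume T: "T \<subseteq> entries m n" "card T \<le> k"
    have "measure_pmf.expectation D (\<lambda>\<delta>. \<Prod>(i, j)\<in>T. of_bool (\<delta> i j))
        = measure_pmf.expectation H (\<lambda>h. \<Prod>(i, j)\<in>T. of_bool (hash_indicators loc hit h i j) :: real)"
      by (simp add: D_def)
    also have "\<dots> = measure_pmf.expectation (Pi_pmf I 0 (\<lambda>_. pmf_of_set V))
        (\<lambda>h. \<Prod>(i, j)\<in>T. of_bool (hash_indicators loc hit h i j) :: real)"
      by (rule kwise_hash_indicators[OF I hashed(2,3,7) finite_subset[OF T(1) finite_entries] T(2)])
         (unfold hashed(4), rule image_mono[OF T(1)])
    also have "\<dots> \<le> (real s / real m) ^ card T"
      using hashed(5) T(1) by (simp add: osnap_indicators_def)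
    finally show "measure_pmf.expectation D (\<lambda>\<delta>. \<Prod>(i, j)\<in>T. of_bool (\<delta> i j)) \<le> (real s / real m) ^ card T" .
  next
    have "inj_on (case_prod sloc) (supp m n (hash_indicators loc hit h))" if h: "h \<in> set_pmf H" for h
    proof -
      have "{(i, j) \<in> entries m n. hash_indicators loc hit h i j} = supp m n (hash_indicators loc hit h)"
        by (auto simp: supp_def)
      thus ?thesis using hashed(6)[of h] HV[OF h] by auto
    qed
    thus "AE \<delta> in measure_pmf D. inj_on (case_prod sloc) (supp m n \<delta>)"
      by (auto simp: D_def AE_measure_pmf_iff)
  qed (rule hashed(8))
qed

text \<open>The order of the constants expresses the two-sided bound on the sparsity: collisions
  grow with \<open>s\<close>, so the constant for \<open>m\<close> has to depend on the upper
  constant \<open>C\<close>.\<close>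

theorem theorem9:
  shows "\<exists>c>0. \<forall>C\<ge>c. \<exists>Cm>0. \<exists>Ck>0.
    \<forall>(n::nat) (d::nat) (m::nat) (s::nat) (k::nat) (U::real mat) (\<epsilon>::real) (\<delta>::real) (P::real mat pmf).
      1 \<le> d \<and> d \<le> n \<and>
      U \<in> carrier_mat n d \<and> transpose_mat U * U = 1\<^sub>m d \<and>
      0 < \<epsilon> \<and> \<epsilon> < 1 \<and> 0 < \<delta> \<and> \<delta> < 1 \<and>
      c * log_factor (real d / \<delta>) ^ 3 / \<epsilon> \<le> real s \<and>
      real s \<le> C * log_factor (real d / \<delta>) ^ 3 / \<epsilon> \<and>
      real m \<ge> Cm * real d * log_factor (real d / \<delta>) ^ 8 / \<epsilon>\<^sup>2 \<and>
      real k \<ge> Ck * log_factor (real d / \<delta>) \<and>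
      osnap_sketch k m n s P
      \<longrightarrow> measure_pmf.prob P {A. singular_values (A * U) \<subseteq> {1 - \<epsilon>..1 + \<epsilon>}} \<ge> 1 - \<delta>"
proof -
  \<comment> \<open>The lower constant demanded by \<open>failure_bound_le\<close>.\<close>
  define c :: real where "c = 32 * exp 3"
  have c: "32 \<le> c" by (simp add: c_def)
  show ?thesis
  proof (rule exI[of _ c], intro conjI allI impI)
    show "c > 0" using c by simp
    fix C :: real
    assume "c \<le> C"
    hence C: "32 \<le> C" using c by linarith
    show "\<exists>Cm>0. \<exists>Ck>0.
    \<forall>(n::nat) (d::nat) (m::nat) (s::nat) (k::nat) (U::real mat) (\<epsilon>::real) (\<delta>::real) (P::real mat pmf).
      1 \<le> d \<and> d \<le> n \<and>
      U \<in> carrier_mat n d \<and> transpose_mat U * U = 1\<^sub>m d \<and>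
      0 < \<epsilon> \<and> \<epsilon> < 1 \<and> 0 < \<delta> \<and> \<delta> < 1 \<and>
      c * log_factor (real d / \<delta>) ^ 3 / \<epsilon> \<le> real s \<and>
      real s \<le> C * log_factor (real d / \<delta>) ^ 3 / \<epsilon> \<and>
      real m \<ge> Cm * real d * log_factor (real d / \<delta>) ^ 8 / \<epsilon>\<^sup>2 \<and>
      real k \<ge> Ck * log_factor (real d / \<delta>) \<and>
      osnap_sketch k m n s P
      \<longrightarrow> measure_pmf.prob P {A. singular_values (A * U) \<subseteq> {1 - \<epsilon>..1 + \<epsilon>}} \<ge> 1 - \<delta>"
    \<comment> \<open>The square of \<open>C\<close> makes \<open>m\<close> dominate the square of
      the largest admissible \<open>s\<close> times \<open>d\<close>. The constant 8 covers
      \<open>4 * (r + 1)\<close> with \<open>r + 1 \<le> 2 * L\<close>.\<close>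
    proof (rule exI[of _ "C\<^sup>2"], rule conjI, use C in simp, rule exI[of _ 8], rule conjI, simp, intro allI impI, elim conjE)
      fix n d m s k :: nat and U :: "real mat" and \<epsilon> \<delta> :: real and P :: "real mat pmf"
      assume d: "1 \<le> d" "d \<le> n" and U: "U \<in> carrier_mat n d" "transpose_mat U * U = 1\<^sub>m d"
        and \<epsilon>: "0 < \<epsilon>" "\<epsilon> < 1" and \<delta>: "0 < \<delta>" "\<delta> < 1"
        and s1: "c * log_factor (real d / \<delta>) ^ 3 / \<epsilon> \<le> real s"
        and s2: "real s \<le> C * log_factor (real d / \<delta>) ^ 3 / \<epsilon>"
        and m: "C\<^sup>2 * real d * log_factor (real d / \<delta>) ^ 8 / \<epsilon>\<^sup>2 \<le> real m"
        and k: "8 * log_factor (real d / \<delta>) \<le> real k"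
        and P: "osnap_sketch k m n s P"
      define L where "L = log_factor (real d / \<delta>)"
      have L1: "1 \<le> L" by (simp add: L_def log_factor_def)
      have "ln (real d / \<delta>) \<le> L" by (simp add: L_def log_factor_def)
      hence Le: "real d / \<delta> \<le> exp L" using d \<delta> by (subst ln_le_cancel_iff[symmetric]) auto
      \<comment> \<open>The order of the moment is \<open>r + 1 = \<lceil>L\<rceil>\<close>, which
        lies between \<open>L\<close> and \<open>2 * L\<close> because
        \<open>L \<ge> 1\<close>.\<close>
      define r where "r = nat \<lceil>L\<rceil> - 1"
      have "1 \<le> \<lceil>L\<rceil>" using L1 by linarith
      hence "real (r + 1) = of_int \<lceil>L\<rceil>" by (simp add: r_def)
      hence r: "L \<le> real (r + 1)" "real (r + 1) \<le> 2 * L" using L1 by linarith+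
      have s0: "0 < s"
      proof -
        have "0 < c * L ^ 3 / \<epsilon>" using c L1 \<epsilon> by auto
        thus ?thesis using s1 by (simp add: L_def)
      qed
      have "real (4 * (r + 1)) = 4 * real (r + 1)" by simp
      also have "\<dots> \<le> 4 * (2 * L)" by (rule mult_left_mono[OF r(2)]) simp
      also have "\<dots> \<le> real k" using k by (simp add: L_def)
      finally have rk: "4 * (r + 1) \<le> k" by (simp only: of_nat_le_iff)
      have d1: "1 \<le> real d" using d by simp
      define s' where "s' = C * L ^ 3 / \<epsilon>"
      define m' where "m' = C\<^sup>2 * real d * L ^ 8 / \<epsilon>\<^sup>2"
      have ss: "real s \<le> s'" and mm: "m' \<le> real m" using s2 m by (simp_all add: s'_def m'_def L_def)
      have s'0: "0 \<le> s'" using C L1 \<epsilon> by (simp add: s'_def)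
      have sq: "s'\<^sup>2 * real d \<le> m'"
      proof -
        have "s'\<^sup>2 * real d = C\<^sup>2 * real d * L ^ 6 / \<epsilon>\<^sup>2"
          by (simp add: s'_def power_divide power_mult_distrib power_mult[symmetric])
        also have "\<dots> \<le> m'" unfolding m'_def using L1
          by (intro divide_right_mono mult_left_mono power_increasing) auto
        finally show ?thesis .
      qed
      have s'32: "32 \<le> s'"
      proof -
        have "32 * 1 * \<epsilon> \<le> C * L ^ 3 * 1"
          using C L1 \<epsilon> by (intro mult_mono) (auto intro: one_le_power)
        thus ?thesis using \<epsilon> by (simp add: s'_def le_divide_eq)
      qed
      \<comment> \<open>Since \<open>s'\<close> is at least 2, the linear requirement on
        \<open>m\<close> follows from the quadratic one.\<close>
      have lin: "2 * s' * real d \<le> m'"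
      proof -
        have "2 * s' * real d \<le> s' * s' * real d"
          using s'32 by (intro mult_right_mono) auto
        thus ?thesis using sq by (simp add: power2_eq_square)
      qed
      have sm: "real s \<le> real m"
      proof -
        have "s' * 1 \<le> (2 * s') * real d" using s'0 d1 by (intro mult_mono) auto
        thus ?thesis using lin ss mm by linarith
      qed
      have m0: "0 < real m" using sm s0 by linarith
      have p2: "2 * (real s / real m) * real d \<le> 1"
      proof -
        have "2 * real s * real d \<le> 2 * s' * real d" using ss by (intro mult_right_mono mult_left_mono) auto
        hence "2 * real s * real d \<le> real m" using lin mm by linarith
        thus ?thesis using m0 by (simp add: divide_le_eq)
      qed
      have p3: "real m * (real s / real m)\<^sup>2 * real d \<le> 1"
      proof -
        have "(real s)\<^sup>2 * real d \<le> s'\<^sup>2 * real d" using ss by (intro mult_right_mono power_mono) auto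
        hence "(real s)\<^sup>2 * real d \<le> real m" using sq mm by linarith
        thus ?thesis using m0 by (simp add: power2_eq_square divide_le_eq)
      qed
      let ?G = "{A. singular_values (A * U) \<subseteq> {1 - \<epsilon>..1 + \<epsilon>}}"
      have "measure_pmf.prob P {A. \<not> singular_values (A * U) \<subseteq> {1 - \<epsilon>..1 + \<epsilon>}} \<le> \<delta>"
        by (rule order_trans[OF osnap_sketch_failure[OF P U s0 \<epsilon> rk _ p2 p3]
              failure_bound_le[OF L1 Le r \<epsilon>(1) \<delta>(1)]])
           (use sm s1 in \<open>auto simp: L_def c_def\<close>)
      moreover have "measure_pmf.prob P {A. \<not> singular_values (A * U) \<subseteq> {1 - \<epsilon>..1 + \<epsilon>}} = 1 - measure_pmf.prob P ?G"
        using measure_pmf.prob_compl[of ?G P] by (simp add: Compl_eq_Diff_UNIV[symmetric] Collect_neg_eq)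
      ultimately show "1 - \<delta> \<le> measure_pmf.prob P ?G" by linarith
    qed
  qed
qed

end
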